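(* Suppose $X_t$ is generated by the fractional model with polynomial time trend described in the context, with memory parameter $d_0\in[\Delta_1,\Delta_2]$ and trend order $\alpha>\tfrac12$ (and trend coefficient $\mu\ne0$), and that Assumptions 1–4 listed in the context hold. Then, for $d_0\in(\tfrac12,M]$ with $1<M<\infty$, $\widehat d\overset{p}{\to}1$ as $n\to\infty$.
   Context: Model. For real $d$ and integer $k\ge0$ let $(d)_k=d(d+1)\cdots(d+k-1)$, $(d)_0=1$. Given the true memory parameter $d_0$, $X_t=\sum_{k=0}^{t-1}\frac{(d_0)_k}{k!}u_{t-k}+X_0+\mu t^\alpha$, $t=0,1,2,\dots$, $\mu\neq0$, where $X_0$ is a random variable with a certain fixed distribution, $u_t=0$ for $t\le0$, and $u_t$, $t\ge1$, is stationary with zero mean and spectral density $f_u(\lambda)$. Periodogram. For a series $a_t$, $w_a(\lambda_s)=(2\pi n)^{-1/2}\sum_{t=1}^n a_te^{it\lambda_s}$, $\lambda_s=2\pi s/n$, and $I_a(\lambda_s)=|w_a(\lambda_s)|^2$. Estimator (local Whittle). $m=m(n)$ is an integer less than $n$; $\Delta_1,\Delta_2$ are numbers with $-\tfrac12<\Delta_1<\Delta_2<\infty$. Define $\widehat G(d)=\frac1m\sum_{j=1}^m\lambda_j^{2d}I_x(\lambda_j)$ (with $I_x$ the periodogram of $X_1,\dots,X_n$), $R(d)=\log\widehat G(d)-2d\frac1m\sum_{j=1}^m\log\lambda_j$, and $\widehat d=\arg\min_{d\in[\Delta_1,\Delta_2]}R(d)$. Assumption 1. $f_u(\lambda)\sim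 f_u(0)\in(0,\infty)$ as $\lambda\to0+$. Assumption 2. In a neighborhood $(0,\delta)$ of the origin, $f_u(\lambda)$ is differentiable and $\frac{d}{d\lambda}\log f_u(\lambda)=O(\lambda^{-1})$ as $\lambda\to0+$. Assumption 3. $u_t=C(L)\varepsilon_t=\sum_{j=0}^\infty c_j\varepsilon_{t-j}$ (for $t\ge1$, $L$ the lag operator), $\sum_{j=0}^\infty c_j^2<\infty$, where $E(\varepsilon_t|F_{t-1})=0$, $E(\varepsilon_t^2|F_{t-1})=1$ a.s., $t=0,\pm1,\dots$, in which $F_t$ is the $\sigma$-field generated by $\varepsilon_s$, $s\le t$, and there exists a random variable $\varepsilon$ such that $E\varepsilon^2<\infty$ and for all $\eta>0$ and some $K>0$, $\Pr(|\varepsilon_t|>\eta)\le K\Pr(|\varepsilon|>\eta)$. Assumption 4. $\frac1m+\frac mn\to0$ as $n\to\infty$.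
   Formalization: The formal theorem additionally assumes $1\in[\Delta_1,\Delta_2]$; without it the claim is false (e.g. $d_0=0.75$, $\Delta_1=0$, $\Delta_2=0.9$), since $\widehat d$ always lies in $[\Delta_1,\Delta_2]$. *)

theory Defs
  imports "HOL-Probability.Probability" "HOL-Library.Landau_Symbols"
begin

definition converges_in_prob ::
  "'a measure \<Rightarrow> (nat \<Rightarrow> 'a \<Rightarrow> real) \<Rightarrow> real \<Rightarrow> bool" where
  "converges_in_prob M Y c \<longleftrightarrow>
     (\<forall>e>0. (\<lambda>n. measure M {\<omega> \<in> space M. \<bar>Y n \<omega> - c\<bar> > e}) \<longlonglongrightarrow> 0)"


subsection \<open>The innovations and the linear process\<close>

definition history :: "'a measure \<Rightarrow> (int \<Rightarrow> 'a \<Rightarrow> real) \<Rightarrow> int \<Rightarrow> 'a measure" where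
  "history M \<epsilon> t =
     sigma (space M) (\<Union>s\<in>{..t}. {\<epsilon> s -` A \<inter> space M | A. A \<in> sets borel})"

definition martingale_difference_innovations :: "'a measure \<Rightarrow> (int \<Rightarrow> 'a \<Rightarrow> real) \<Rightarrow> bool" where
  "martingale_difference_innovations M \<epsilon> \<longleftrightarrow>
     (\<forall>t. \<epsilon> t \<in> borel_measurable M \<and> integrable M (\<lambda>\<omega>. (\<epsilon> t \<omega>)\<^sup>2)) \<and>
     (\<forall>t. AE \<omega> in M. real_cond_exp M (history M \<epsilon> (t - 1)) (\<epsilon> t) \<omega> = 0) \<and>
     (\<forall>t. AE \<omega> in M. real_cond_exp M (history M \<epsilon> (t - 1)) (\<lambda>\<omega>. (\<epsilon> t \<omega>)\<^sup>2) \<omega> = 1)"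

definition uniformly_dominated :: "'a measure \<Rightarrow> (int \<Rightarrow> 'a \<Rightarrow> real) \<Rightarrow> bool" where
  "uniformly_dominated M \<epsilon> \<longleftrightarrow>
     (\<exists>Z. Z \<in> borel_measurable M \<and> integrable M (\<lambda>\<omega>. (Z \<omega>)\<^sup>2) \<and>
        (\<exists>K>0. \<forall>t. \<forall>\<eta>>0.
           measure M {\<omega> \<in> space M. \<bar>\<epsilon> t \<omega>\<bar> > \<eta>} \<le> K * measure M {\<omega> \<in> space M. \<bar>Z \<omega>\<bar> > \<eta>}))"

text \<open>The series defining the linear process is only square-summable, so it is
  understood as a limit in mean square.\<close>

definition linear_process ::
  "'a measure \<Rightarrow> (nat \<Rightarrow> real) \<Rightarrow> (int \<Rightarrow> 'a \<Rightarrow> real) \<Rightarrow> (int \<Rightarrow> 'a \<Rightarrow> real) \<Rightarrow> bool" where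
  "linear_process M c \<epsilon> u \<longleftrightarrow>
     summable (\<lambda>j. (c j)\<^sup>2) \<and>
     (\<forall>t\<ge>1. (\<lambda>N. \<integral>\<omega>. (u t \<omega> - (\<Sum>j<N. c j * \<epsilon> (t - int j) \<omega>))\<^sup>2 \<partial>M) \<longlonglongrightarrow> 0)"


subsection \<open>Stationarity and spectral density of \<open>u\<^sub>t\<close>, \<open>t \<ge> 1\<close>\<close>

definition zero_mean_stationary :: "'a measure \<Rightarrow> (int \<Rightarrow> 'a \<Rightarrow> real) \<Rightarrow> bool" where
  "zero_mean_stationary M u \<longleftrightarrow>
     (\<forall>t\<ge>1. u t \<in> borel_measurable M \<and> integrable M (\<lambda>\<omega>. (u t \<omega>)\<^sup>2) \<and> (\<integral>\<omega>. u t \<omega> \<partial>M) = 0) \<and>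
     (\<forall>s\<ge>1. \<forall>t\<ge>1. \<forall>h\<ge>0.
        (\<integral>\<omega>. u (s + h) \<omega> * u (t + h) \<omega> \<partial>M) = (\<integral>\<omega>. u s \<omega> * u t \<omega> \<partial>M))"

text \<open>The normalisation is that \<open>\<gamma>(h)\<close> is the integral of \<open>exp(i h \<lambda>) f(\<lambda>)\<close>
  over \<open>[-\<pi>, \<pi>]\<close>, with no factor \<open>1/(2 \<pi>)\<close>.  The mean of \<open>u\<close> is zero, so the
  expected products below are its covariances.\<close>

definition has_spectral_density ::
  "'a measure \<Rightarrow> (int \<Rightarrow> 'a \<Rightarrow> real) \<Rightarrow> (real \<Rightarrow> real) \<Rightarrow> bool" where
  "has_spectral_density M u f \<longleftrightarrow>
     (\<forall>x\<in>{-pi..pi}. 0 \<le> f x) \<and> set_integrable lborel {-pi..pi} f \<and>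
     (\<forall>s\<ge>1. \<forall>t\<ge>1. complex_of_real (\<integral>\<omega>. u s \<omega> * u t \<omega> \<partial>M) =
        (CLINT x:{-pi..pi}|lborel. cis (of_int (s - t) * x) * complex_of_real (f x)))"


subsection \<open>The fractional model with polynomial trend\<close>

text \<open>Since \<open>\<alpha> > 0\<close>, \<open>0 powr \<alpha> = 0\<close> is the intended value of the trend at time \<open>0\<close>,
  and the process starts at \<open>X0\<close>.\<close>

definition fractional_trend_process ::
  "real \<Rightarrow> real \<Rightarrow> real \<Rightarrow> ('a \<Rightarrow> real) \<Rightarrow> (int \<Rightarrow> 'a \<Rightarrow> real) \<Rightarrow> nat \<Rightarrow> 'a \<Rightarrow> real" where
  "fractional_trend_process d \<mu> \<alpha> X0 u t \<omega> =
     (\<Sum>k<t. pochhammer d k / fact k * u (int t - int k) \<omega>) + X0 \<omega> + \<mu> * real t powr \<alpha>"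


subsection \<open>Periodogram and local Whittle estimator\<close>

definition fourier_freq :: "nat \<Rightarrow> nat \<Rightarrow> real" where
  "fourier_freq n s = 2 * pi * real s / real n"

definition dft :: "nat \<Rightarrow> (nat \<Rightarrow> real) \<Rightarrow> nat \<Rightarrow> complex" where
  "dft n a s = complex_of_real (1 / sqrt (2 * pi * real n)) *
     (\<Sum>t=1..n. complex_of_real (a t) * cis (real t * fourier_freq n s))"

definition periodogram :: "nat \<Rightarrow> (nat \<Rightarrow> real) \<Rightarrow> nat \<Rightarrow> real" where
  "periodogram n a s = (cmod (dft n a s))\<^sup>2"

definition whittle_G :: "nat \<Rightarrow> nat \<Rightarrow> (nat \<Rightarrow> real) \<Rightarrow> real \<Rightarrow> real" where
  "whittle_G n m x d =
     1 / real m * (\<Sum>j=1..m. fourier_freq n j powr (2 * d) * periodogram n x j)"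

text \<open>Extended-real valued, so that \<open>log 0 = -\<infinity>\<close> rather than the \<open>ln 0 = 0\<close> of the library.
  For a degenerate sample, where the periodogram ordinates used all vanish, every \<open>d\<close> is then
  a minimiser.\<close>

definition whittle_R :: "nat \<Rightarrow> nat \<Rightarrow> (nat \<Rightarrow> real) \<Rightarrow> real \<Rightarrow> ereal" where
  "whittle_R n m x d =
     (if whittle_G n m x d = 0 then -\<infinity>
      else ereal (ln (whittle_G n m x d)
             - 2 * d * (1 / real m) * (\<Sum>j=1..m. ln (fourier_freq n j))))"

text \<open>Minimisers need not be unique, so the estimator is any measurable selection of minimisers.\<close>

definition local_whittle_estimator ::
  "'a measure \<Rightarrow> real \<Rightarrow> real \<Rightarrow> (nat \<Rightarrow> nat) \<Rightarrow> (nat \<Rightarrow> 'a \<Rightarrow> real) \<Rightarrow> (nat \<Rightarrow> 'a \<Rightarrow> real) \<Rightarrow> bool" where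
  "local_whittle_estimator M \<Delta>\<^sub>1 \<Delta>\<^sub>2 m X dhat \<longleftrightarrow>
     (\<forall>n. dhat n \<in> borel_measurable M \<and>
        (\<forall>\<omega>\<in>space M. is_arg_min (whittle_R n (m n) (\<lambda>t. X t \<omega>)) (\<lambda>d. d \<in> {\<Delta>\<^sub>1..\<Delta>\<^sub>2}) (dhat n \<omega>)))"


subsection \<open>Assumptions\<close>

definition assumption1 :: "(real \<Rightarrow> real) \<Rightarrow> bool" where
  "assumption1 f \<longleftrightarrow> 0 < f 0 \<and> f \<sim>[at_right 0] (\<lambda>_. f 0)"

definition assumption2 :: "(real \<Rightarrow> real) \<Rightarrow> bool" where
  "assumption2 f \<longleftrightarrow>
     (\<exists>\<delta>>0. \<forall>x\<in>{0<..<\<delta>}. f differentiable (at x)) \<and>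
     (\<lambda>x. deriv (\<lambda>y. ln (f y)) x) \<in> O[at_right 0](\<lambda>x. 1 / x)"

definition assumption3 :: "'a measure \<Rightarrow> (int \<Rightarrow> 'a \<Rightarrow> real) \<Rightarrow> bool" where
  "assumption3 M u \<longleftrightarrow>
     (\<exists>c \<epsilon>. martingale_difference_innovations M \<epsilon> \<and> uniformly_dominated M \<epsilon> \<and>
        linear_process M c \<epsilon> u)"

text \<open>Positivity of \<open>m n\<close> for large \<open>n\<close> is stated because \<open>1 / 0 = 0\<close>.\<close>

definition assumption4 :: "(nat \<Rightarrow> nat) \<Rightarrow> bool" where
  "assumption4 m \<longleftrightarrow>
     (\<forall>\<^sub>F n in sequentially. 0 < m n) \<and>
     (\<lambda>n. 1 / real (m n) + real (m n) / real n) \<longlonglongrightarrow> 0"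

end

theory Submission
  imports Defs "HOL-Real_Asymp.Real_Asymp"
begin

text \<open>Summation by parts at a Fourier frequency \<open>x = 2 \<pi> j / n\<close> gives
  \<open>(1 - cis x) * W = D - cis x * (X\<^sub>n - X\<^sub>0)\<close>, where \<open>W\<close> and \<open>D\<close> are the unnormalised Fourier sums of
  the series and of its increments.  The Fourier sum \<open>D\<close> is smaller than \<open>X\<^sub>n - X\<^sub>0\<close> by a factor that
  decays in \<open>j\<close>: with \<open>\<beta> = max \<alpha> (d\<^sub>0 - 1/2)\<close>, one has \<open>E \<bar>D\<bar>\<^sup>2 \<le> C n\<^sup>2\<^sup>\<beta> j powr (- \<kappa>)\<close>, and
  \<open>\<bar>X\<^sub>n - X\<^sub>0\<bar> \<ge> \<eta> n\<^sup>\<beta>\<close> up to small probability.  Hence the periodogram is essentially proportional to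
  \<open>x powr (- 2)\<close>, the shape that the Whittle objective attributes to \<open>d = 1\<close>, whatever \<open>d\<^sub>0\<close> is.  The
  objective is convex in \<open>d\<close>, so it suffices to compare its values at \<open>1\<close> and at two neighbouring points.

  The upper bound on \<open>D\<close> uses the spectral density, bounded only near the origin.  The lower bound
  follows from Chebyshev's inequality when the trend dominates; otherwise \<open>d\<^sub>0 > 1\<close> and it is an
  anticoncentration estimate, derived from a martingale central limit theorem.\<close>

section \<open>Trigonometric sums and fractional coefficients\<close>

text \<open>Two features of the setting shape the argument. The spectral density is controlled only
  on a right neighbourhood of the origin, is merely integrable elsewhere and is not assumed even.
  Second-moment estimates are therefore made on the spectral measure folded to (0, pi), and
  frequencies away from the origin are paid for by a separate term, the sum of the absolute filter
  coefficients. Moreover, the level of the scaled periodogram, proportional to (X_n - X_0)^2 / n, is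
  random, and no limit is established for it. It only has to be positive, since a common factor
  shifts the objective by a constant. All errors are measured relative to this level, which is why
  the end-point difference must be bounded from below, with probability close to 1 rather than in
  mean. The decay exponent \<kappa> may be arbitrarily small: the average of
  \<open>j powr (- \<kappa>)\<close> over j \<le> m vanishes as m grows, even with weights singular
  at j / m = 0, as long as the total exponent stays above -1. This is why the neighbouring points of
  comparison lie close to 1.\<close>

lemma abel_summation_bound:
  fixes p :: "nat \<Rightarrow> real" and z :: complex
  assumes z: "cmod z = 1" and nonneg: "\<And>j. 0 \<le> p j" and mono: "incseq p \<or> decseq p" and ab: "a < b"
  shows "cmod (1 - z) * cmod (\<Sum>j=a..<b. p j * z ^ j) \<le> 2 * max (p a) (p (b - 1))"
proof -
  \<comment> \<open>After multiplication by 1 - z the sum telescopes up to its last term. That term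
    is carried along, so that each induction step adds only an increment of \<open>p\<close>; by
    monotonicity the increments add up to the difference of the end values.\<close>
  have *: "cmod ((1 - z) * (\<Sum>j=a..<Suc (a + k). p j * z ^ j) + p (a + k) * z ^ Suc (a + k))
      \<le> p a + \<bar>p (a + k) - p a\<bar>" for k
  proof (induction k)
    case 0
    have "(1 - z) * (p a * z ^ a) + p a * z ^ Suc a = p a * z ^ a"
      by (simp add: algebra_simps)
    then show ?case
      using nonneg[of a] by (simp add: norm_mult norm_power z)
  next
    case (Suc k)
    have "(1 - z) * (\<Sum>j=a..<Suc (a + Suc k). p j * z ^ j) + p (a + Suc k) * z ^ Suc (a + Suc k) =
        ((1 - z) * (\<Sum>j=a..<Suc (a + k). p j * z ^ j) + p (a + k) * z ^ Suc (a + k)) +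
        complex_of_real (p (a + Suc k) - p (a + k)) * z ^ Suc (a + k)"
      by (simp add: algebra_simps)
    also have "cmod \<dots> \<le> p a + \<bar>p (a + k) - p a\<bar> + \<bar>p (a + Suc k) - p (a + k)\<bar>"
      by (rule order_trans[OF norm_triangle_ineq add_mono[OF Suc]])
        (simp only: norm_mult norm_power z norm_of_real, simp)
    also have "\<dots> = p a + \<bar>p (a + Suc k) - p a\<bar>"
      using mono
    proof
      assume "incseq p"
      then have "p a \<le> p (a + k)" "p (a + k) \<le> p (a + Suc k)" by (simp_all add: incseq_def)
      then show ?thesis by simp
    next
      assume "decseq p"
      then have "p a \<ge> p (a + k)" "p (a + k) \<ge> p (a + Suc k)" by (simp_all add: decseq_def)
      then show ?thesis by simp
    qed
    finally show ?case .
  qed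
  obtain k where k: "b = Suc (a + k)" using ab less_imp_Suc_add by auto
  have "cmod ((1 - z) * (\<Sum>j=a..<b. p j * z ^ j)) =
      cmod (((1 - z) * (\<Sum>j=a..<b. p j * z ^ j) + p (a + k) * z ^ Suc (a + k)) - p (a + k) * z ^ Suc (a + k))"
    by simp
  also have "\<dots> \<le> (p a + \<bar>p (a + k) - p a\<bar>) + p (a + k)"
    by (rule order_trans[OF norm_triangle_ineq4 add_mono])
      (use *[of k] nonneg[of "a + k"] in \<open>simp_all only: k norm_mult norm_power z norm_of_real, simp_all\<close>)
  also have "\<dots> = 2 * max (p a) (p (b - 1))" by (simp add: k max_def)
  finally show ?thesis by (simp only: norm_mult)
qed

lemma norm_one_minus_cis_ge:
  assumes "0 \<le> x" "x \<le> 1"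
  shows "x / 2 \<le> cmod (1 - cis x)"
proof -
  have "x / 2 \<le> sin x"
  proof (cases "x = 0")
    case False
    have "\<exists>\<xi>. 0 < \<xi> \<and> \<xi> < x \<and> sin x - sin 0 = (x - 0) * cos \<xi>"
      by (rule MVT2) (use assms False in \<open>auto intro!: derivative_eq_intros\<close>)
    then obtain \<xi> where xi: "0 < \<xi>" "\<xi> < x" "sin x = x * cos \<xi>" by auto
    have "cos (pi / 3) \<le> cos \<xi>"
      using xi assms pi_gt3 by (intro cos_monotone_0_pi_le) auto
    then show ?thesis using xi assms by (simp add: cos_60 mult_left_mono)
  qed simp
  also have "\<dots> \<le> cmod (1 - cis x)"
    using abs_Im_le_cmod[of "1 - cis x"] by simp
  finally show ?thesis .
qed

text \<open>A partial sum controls a single term by averaging over a block of length j + 1 on which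
  no term is smaller than \<open>p j\<close>: the block from j to 2 j when \<open>p\<close>
  increases, the initial block when it decreases. Doubling the range costs the factor
  \<open>2 powr g\<close>.\<close>

lemma mono_sum_imp_term_bound:
  fixes p :: "nat \<Rightarrow> real"
  assumes nonneg: "\<And>j. 0 \<le> p j" and mono: "incseq p \<or> decseq p" and g: "0 < g"
    and sum: "\<And>k. (\<Sum>j<k. p j) \<le> C * real k powr g"
  shows "p j \<le> C * 2 powr g * real (j + 1) powr (g - 1)"
proof -
  have "C \<ge> 0" using sum[of 1] nonneg[of 0] by simp
  have "real (j + 1) * p j \<le> C * (2 * real (j + 1)) powr g"
    using mono
  proof
    assume "incseq p"
    then have "(\<Sum>i=j..<2*j+1. p j) \<le> (\<Sum>i=j..<2*j+1. p i)"
      by (intro sum_mono) (simp add: incseq_def)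
    also have "\<dots> \<le> (\<Sum>i<2*j+1. p i)" by (intro sum_mono2) (auto simp: nonneg)
    also have "\<dots> \<le> C * real (2 * j + 1) powr g" by (rule sum)
    also have "\<dots> \<le> C * (2 * real (j + 1)) powr g"
      using g \<open>C \<ge> 0\<close> by (intro mult_left_mono powr_mono2) auto
    finally show ?thesis by simp
  next
    assume "decseq p"
    then have "(\<Sum>i<j+1. p j) \<le> (\<Sum>i<j+1. p i)"
      by (intro sum_mono) (simp add: decseq_def)
    also have "\<dots> \<le> C * real (j + 1) powr g" by (rule sum)
    also have "\<dots> \<le> C * (2 * real (j + 1)) powr g"
      using g \<open>C \<ge> 0\<close> by (intro mult_left_mono powr_mono2) auto
    finally show ?thesis by simp
  qed
  also have "\<dots> = real (j + 1) * (C * 2 powr g * real (j + 1) powr (g - 1))"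
    by (subst powr_mult) (simp_all add: powr_diff)
  finally show ?thesis by (simp only: mult_le_cancel_left_pos of_nat_0_less_iff)
qed

text \<open>Split the sum at \<open>1 / x\<close>: trivial bound below, Abel summation above.\<close>

lemma mono_trig_sum_bound:
  fixes p :: "nat \<Rightarrow> real"
  assumes nonneg: "\<And>j. 0 \<le> p j" and mono: "incseq p \<or> decseq p" and g: "0 < g"
    and sum: "\<And>k. (\<Sum>j<k. p j) \<le> C * real k powr g"
    and x: "0 < x" "x \<le> 1" "1 \<le> real n * x" and k: "k \<le> n"
  shows "cmod (\<Sum>j<k. p j * cis (real j * x)) \<le>
    C * (1 + 4 * 2 powr g) * (real n powr g * (real n * x) powr (- min g 1))"
proof -
  \<comment> \<open>Abel summation bounds the tail by its larger end term divided by x. The bound on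
    the terms, of order \<open>j powr (g - 1)\<close>, is largest near j = 1 / x if g \<le> 1 and
    near j = n otherwise; \<open>B\<close> merges the two outcomes \<open>x powr (- g)\<close> and
    \<open>real n powr (g - 1) / x\<close>.\<close>
  define B where "B = real n powr g * (real n * x) powr (- min g 1)"
  have C: "C \<ge> 0" using sum[of 1] nonneg[of 0] by simp
  have B0: "0 \<le> B" by (simp add: B_def)
  have n: "0 < real n" "1 / x \<le> real n" using x by (auto simp: field_simps intro: Nat.gr0I)
  have B_le: "B = x powr (- g)" if "g \<le> 1"
    using that n x by (simp add: B_def min_def powr_mult powr_minus)
  have B_ge: "B = real n powr (g - 1) / x" if "1 \<le> g"
    using that n x by (cases "g = 1") (simp_all add: B_def min_def powr_minus powr_diff field_simps)
  have xB: "x powr (- g) \<le> B"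
  proof (cases "g \<le> 1")
    case True
    show ?thesis by (simp only: B_le[OF True])
  next
    case False
    have "x powr (- g) = (1 / x) powr (g - 1) / x"
      using x by (simp add: powr_minus powr_diff powr_divide field_simps)
    also have "\<dots> \<le> real n powr (g - 1) / x"
      using False n x by (intro divide_right_mono powr_mono2) auto
    finally show ?thesis using False B_ge by simp
  qed
  define J where "J = nat \<lfloor>1 / x\<rfloor>"
  have J: "real J \<le> 1 / x" "1 / x \<le> real J + 1"
  proof -
    have "real J = of_int \<lfloor>1 / x\<rfloor>" using x by (simp add: J_def)
    then show "real J \<le> 1 / x" "1 / x \<le> real J + 1" by linarith+
  qed
  have init: "cmod (\<Sum>j<i. p j * cis (real j * x)) \<le> C * B" if "i \<le> J" for i
  proof -
    have "cmod (\<Sum>j<i. p j * cis (real j * x)) \<le> (\<Sum>j<i. p j)"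
      by (rule sum_norm_le) (simp add: norm_mult nonneg)
    also have "\<dots> \<le> C * real i powr g" by (rule sum)
    also have "\<dots> \<le> C * (1 / x) powr g"
      using that J x g C by (intro mult_left_mono powr_mono2) auto
    also have "\<dots> = C * x powr (- g)" using x by (simp add: powr_minus powr_divide field_simps)
    also have "\<dots> \<le> C * B" by (rule mult_left_mono[OF xB C])
    finally show ?thesis .
  qed
  have "cmod (\<Sum>j<k. p j * cis (real j * x)) \<le> C * (1 + 4 * 2 powr g) * B"
  proof (cases "k \<le> J")
    case True
    have "C * 1 * B \<le> C * (1 + 4 * 2 powr g) * B"
      using C B0 by (intro mult_right_mono mult_left_mono) auto
    with init[OF True] show ?thesis by simp
  next
    case False
    then have Jk: "J < k" by simp
    have bnd: "real (i + 1) powr (g - 1) / x \<le> B" if "J \<le> i" "i < k" for i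
    proof (cases "g \<le> 1")
      case True
      have "real (i + 1) powr (g - 1) \<le> (1 / x) powr (g - 1)"
        using True that J x by (intro powr_mono2') auto
      also have "\<dots> = x powr (- g) * x" using x by (simp add: powr_minus powr_diff powr_divide field_simps)
      finally show ?thesis unfolding B_le[OF True] using x by (simp add: field_simps)
    next
      case False
      then show ?thesis using B_ge that k x by (auto intro!: divide_right_mono powr_mono2)
    qed
    have pb: "p i \<le> C * 2 powr g * (x * B)" if "J \<le> i" "i < k" for i
    proof -
      have "p i \<le> C * 2 powr g * real (i + 1) powr (g - 1)"
        by (rule mono_sum_imp_term_bound[OF nonneg mono g sum])
      also have "\<dots> \<le> C * 2 powr g * (x * B)"
        using bnd[OF that] x C by (intro mult_left_mono) (auto simp: field_simps)
      finally show ?thesis .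
    qed
    have "x / 2 * cmod (\<Sum>j=J..<k. p j * cis (real j * x)) \<le>
        cmod (1 - cis x) * cmod (\<Sum>j=J..<k. p j * cis x ^ j)"
      using x norm_one_minus_cis_ge[of x] by (intro mult_mono) (auto simp: Complex.DeMoivre)
    also have "\<dots> \<le> 2 * max (p J) (p (k - 1))"
      by (rule abel_summation_bound) (use nonneg mono Jk in auto)
    also have "\<dots> \<le> 2 * (C * 2 powr g * (x * B))"
      using pb[of J] pb[of "k - 1"] Jk by auto
    finally have tail: "cmod (\<Sum>j=J..<k. p j * cis (real j * x)) \<le> 4 * (C * 2 powr g * B)"
      using x by (simp add: field_simps)
    have "(\<Sum>j<k. p j * cis (real j * x)) = (\<Sum>j<J. p j * cis (real j * x)) + (\<Sum>j=J..<k. p j * cis (real j * x))"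
      using Jk by (simp add: lessThan_atLeast0 sum.atLeastLessThan_concat)
    then have "cmod (\<Sum>j<k. p j * cis (real j * x)) \<le> C * B + 4 * (C * 2 powr g * B)"
      using norm_triangle_mono[OF init[of J] tail] by simp
    also have "\<dots> = C * (1 + 4 * 2 powr g) * B" by (simp add: algebra_simps)
    finally show ?thesis .
  qed
  then show ?thesis by (simp only: B_def)
qed

section \<open>Coefficients of the fractional integration filter\<close>

definition frac_coeff :: "real \<Rightarrow> nat \<Rightarrow> real" where
  "frac_coeff d k = pochhammer d k / fact k"

lemma frac_coeff_0 [simp]: "frac_coeff d 0 = 1"
  by (simp add: frac_coeff_def)

lemma frac_coeff_Suc: "frac_coeff d (Suc k) = frac_coeff d k * ((d + real k) / real (Suc k))"
  by (simp add: frac_coeff_def pochhammer_Suc)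

text \<open>\<open>frac_coeff d\<close> lists the power series coefficients of (1 - z) to the power
  -d, so multiplication by 1 - z, that is differencing, lowers d by one. Read backwards, partial
  summation raises d by one.\<close>

lemma frac_coeff_diff: "frac_coeff d (Suc k) - frac_coeff d k = frac_coeff (d - 1) (Suc k)"
proof -
  have "pochhammer (d - 1) (Suc k) = (d - 1) * pochhammer d k"
    by (simp add: pochhammer_rec)
  moreover have "pochhammer d (Suc k) = (d + real k) * pochhammer d k"
    by (simp add: pochhammer_Suc)
  ultimately show ?thesis
    by (simp add: frac_coeff_def divide_simps) (simp add: algebra_simps)
qed

lemma sum_frac_coeff: "(\<Sum>k<Suc n. frac_coeff (d - 1) k) = frac_coeff d n"
  by (induction n) (simp_all add: frac_coeff_diff[symmetric])

lemma frac_coeff_pos: "0 < d \<Longrightarrow> 0 < frac_coeff d k"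
  by (simp add: frac_coeff_def pochhammer_pos)

text \<open>Up to a factor tending to 1, the ratio of the two sides is the reciprocal of a sequence
  converging to Gamma d. A positive sequence with a positive limit is bounded and bounded away from
  zero. Using k + 1 instead of k covers the index 0.\<close>

lemma frac_coeff_bounds:
  assumes d: "0 < d"
  obtains c C where "0 < c" "0 < C"
    "\<And>k. c * real (k + 1) powr (d - 1) \<le> frac_coeff d k"
    "\<And>k. frac_coeff d k \<le> C * real (k + 1) powr (d - 1)"
proof -
  define r where "r k = frac_coeff d k / real (k + 1) powr (d - 1)" for k
  have pos: "0 < r k" for k using frac_coeff_pos[OF d] by (simp add: r_def)
  have "(\<lambda>k. inverse (Gamma_series' d k) * (real k powr (d - 1) / real (k + 1) powr (d - 1))) \<longlonglongrightarrow> inverse (Gamma d) * 1"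
    by (intro tendsto_mult tendsto_inverse Gamma_series'_LIMSEQ) (use Gamma_real_pos[OF d] in simp, real_asymp)
  moreover have "\<forall>\<^sub>F k in sequentially. inverse (Gamma_series' d k) * (real k powr (d - 1) / real (k + 1) powr (d - 1)) = r k"
    using eventually_gt_at_top[of 0]
  proof eventually_elim
    case (elim k)
    have "fact k = real k * fact (k - 1)" using elim by (simp add: fact_reduce)
    moreover have "Gamma_series' d k = fact (k - 1) * real k powr d / pochhammer d k"
      using elim by (simp add: Gamma_series'_def powr_def)
    ultimately show ?case using elim
      by (simp add: r_def frac_coeff_def powr_diff)
  qed
  ultimately have lim: "r \<longlonglongrightarrow> inverse (Gamma d)"
    by (simp add: tendsto_cong)
  have G: "0 < inverse (Gamma d)" using d by (simp add: Gamma_real_pos)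
  have "Bseq r" using lim by (simp add: convergent_imp_Bseq convergentI)
  then obtain C where C: "0 < C" "\<And>k. \<bar>r k\<bar> \<le> C" by (auto simp: Bseq_def)
  have "(\<lambda>k. inverse (r k)) \<longlonglongrightarrow> inverse (inverse (Gamma d))"
    using lim G by (intro tendsto_inverse) auto
  then have "Bseq (\<lambda>k. inverse (r k))" by (simp add: convergent_imp_Bseq convergentI)
  then obtain c where c: "0 < c" "\<And>k. \<bar>inverse (r k)\<bar> \<le> c" by (auto simp: Bseq_def)
  show ?thesis
  proof
    fix k
    have "inverse c \<le> r k" using c(1) c(2)[of k] pos[of k] by (simp add: field_simps)
    then show "inverse c * real (k + 1) powr (d - 1) \<le> frac_coeff d k" by (simp add: r_def field_simps)
    show "frac_coeff d k \<le> C * real (k + 1) powr (d - 1)" using C(2)[of k] pos[of k] by (simp add: r_def field_simps)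
  qed (use c C in auto)
qed

section \<open>The local Whittle objective\<close>

text \<open>By the mean value theorem the increment of \<open>F\<close> over a unit interval is a
  value of \<open>f\<close> there, hence lies between two consecutive terms of the sum. The
  resulting one-sided errors telescope to the end values.\<close>

lemma sum_minus_antiderivative_bound:
  fixes f F :: "real \<Rightarrow> real"
  assumes deriv: "\<And>x. 1 \<le> x \<Longrightarrow> (F has_real_derivative f x) (at x)"
    and mono: "mono_on {1..} f \<or> antimono_on {1..} f" and m: "1 \<le> m"
  shows "\<bar>(\<Sum>j=1..m. f (real j)) - (F (real m) - F 1)\<bar> \<le> \<bar>f 1\<bar> + \<bar>f (real m)\<bar>"
proof -
  have mv: "\<exists>\<xi>. real k \<le> \<xi> \<and> \<xi> \<le> real (Suc k) \<and> F (real (Suc k)) - F (real k) = f \<xi>" if "1 \<le> k" for k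
  proof -
    have "\<exists>\<xi>. real k < \<xi> \<and> \<xi> < real (Suc k) \<and> F (real (Suc k)) - F (real k) = (real (Suc k) - real k) * f \<xi>"
      by (rule MVT2) (use that deriv in auto)
    then show ?thesis by (auto intro: less_imp_le)
  qed
  from mono show ?thesis
  proof
    assume mono: "mono_on {1..} f"
    have "f 1 \<le> (\<Sum>j=1..m. f (real j)) - (F (real m) - F 1) \<and>
        (\<Sum>j=1..m. f (real j)) - (F (real m) - F 1) \<le> f (real m)"
      using m
    proof (induction m rule: dec_induct)
      case (step k)
      obtain \<xi> where \<xi>: "real k \<le> \<xi>" "\<xi> \<le> real (Suc k)" "F (real (Suc k)) - F (real k) = f \<xi>"
        using mv[OF step.hyps(1)] by blast
      have "f (real k) \<le> f \<xi>" "f \<xi> \<le> f (real (Suc k))"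
        using \<xi>(1,2) step.hyps by (auto intro!: mono_onD[OF mono])
      then show ?case using step.IH \<xi>(3) by (simp del: of_nat_Suc)
    qed simp
    then show ?thesis by linarith
  next
    assume mono: "antimono_on {1..} f"
    have "f (real m) \<le> (\<Sum>j=1..m. f (real j)) - (F (real m) - F 1) \<and>
        (\<Sum>j=1..m. f (real j)) - (F (real m) - F 1) \<le> f 1"
      using m
    proof (induction m rule: dec_induct)
      case (step k)
      obtain \<xi> where \<xi>: "real k \<le> \<xi>" "\<xi> \<le> real (Suc k)" "F (real (Suc k)) - F (real k) = f \<xi>"
        using mv[OF step.hyps(1)] by blast
      have "f (real k) \<ge> f \<xi>" "f \<xi> \<ge> f (real (Suc k))"
        using \<xi>(1,2) step.hyps by (auto intro!: monotone_onD[OF mono])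
      then show ?case using step.IH \<xi>(3) by (simp del: of_nat_Suc)
    qed simp
    then show ?thesis by linarith
  qed
qed

text \<open>A Riemann sum of \<open>x powr q\<close> over (0, 1], with an unbounded integrand when q
  < 0. Comparison with the antiderivative leaves an error of order
  \<open>real m powr (- q - 1) + 1 / real m\<close>, and the first term vanishes because q >
  -1.\<close>

lemma mean_powr_tendsto:
  assumes q: "-1 < q"
  shows "(\<lambda>m. 1 / real m * (\<Sum>j=1..m. (real j / real m) powr q)) \<longlonglongrightarrow> 1 / (1 + q)"
proof -
  let ?F = "\<lambda>x. x powr (q + 1) / (q + 1)"
  have bound: "\<bar>(\<Sum>j=1..m. real j powr q) - (?F (real m) - ?F 1)\<bar> \<le> \<bar>1 powr q\<bar> + \<bar>real m powr q\<bar>" if "1 \<le> m" for m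
  proof (rule sum_minus_antiderivative_bound[OF _ _ that])
    show "(?F has_real_derivative x powr q) (at x)" if "1 \<le> x" for x
      using that q by (auto intro!: derivative_eq_intros)
    show "mono_on {1..} (\<lambda>x. x powr q) \<or> antimono_on {1..} (\<lambda>x. x powr q)"
      by (cases "0 \<le> q") (simp_all add: monotone_on_def powr_mono2 powr_mono2')
  qed
  have "(\<lambda>m. real m powr (- q - 1) * ((\<Sum>j=1..m. real j powr q) - (?F (real m) - ?F 1))) \<longlonglongrightarrow> 0"
  proof (rule tendsto_0_le[where K = 1])
    have "(\<lambda>m. real m powr (- q - 1) + 1 / real m) \<longlonglongrightarrow> 0"
      by (rule tendsto_add_zero) (use q in real_asymp, real_asymp)
    moreover have "\<forall>\<^sub>F m in sequentially. real m powr (- q - 1) + 1 / real m = real m powr (- q - 1) * (1 + real m powr q)"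
      using eventually_gt_at_top[of 0]
      by eventually_elim (simp add: distrib_left powr_add[symmetric] powr_minus field_simps)
    ultimately show "(\<lambda>m. real m powr (- q - 1) * (1 + real m powr q)) \<longlonglongrightarrow> 0"
      by (simp add: tendsto_cong)
    show "\<forall>\<^sub>F m in sequentially. norm (real m powr (- q - 1) * ((\<Sum>j=1..m. real j powr q) - (?F (real m) - ?F 1)))
        \<le> norm (real m powr (- q - 1) * (1 + real m powr q)) * 1"
      using eventually_ge_at_top[of 1]
    proof eventually_elim
      case (elim m)
      then show ?case using bound[OF elim] by (auto simp: abs_mult intro!: mult_left_mono)
    qed
  qed
  moreover have "(\<lambda>m. real m powr (- q - 1) * (?F (real m) - ?F 1)) \<longlonglongrightarrow> inverse (q + 1)"
    using q by real_asymp
  ultimately have "(\<lambda>m. real m powr (- q - 1) * (\<Sum>j=1..m. real j powr q)) \<longlonglongrightarrow> 0 + inverse (q + 1)"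
    by (auto dest: tendsto_add simp: ring_distribs[symmetric])
  moreover have "real m powr (- q - 1) * (\<Sum>j=1..m. real j powr q) = 1 / real m * (\<Sum>j=1..m. (real j / real m) powr q)" for m
    by (cases "m = 0") (simp_all add: sum_distrib_left powr_divide powr_diff powr_minus field_simps)
  ultimately show ?thesis by (simp add: inverse_eq_divide add.commute)
qed

text \<open>The integral of ln over (0, 1) is -1, and the comparison error is of order ln m / m.
  This value is the source of \<open>exp (- q)\<close> in the limiting objective.\<close>

lemma mean_ln_tendsto: "(\<lambda>m. 1 / real m * (\<Sum>j=1..m. ln (real j / real m))) \<longlonglongrightarrow> -1"
proof -
  let ?F = "\<lambda>x::real. x * ln x - x"
  have bound: "\<bar>(\<Sum>j=1..m. ln (real j)) - (?F (real m) - ?F 1)\<bar> \<le> \<bar>ln 1\<bar> + \<bar>ln (real m)\<bar>" if "1 \<le> m" for m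
  proof (rule sum_minus_antiderivative_bound[OF _ _ that])
    show "(?F has_real_derivative ln x) (at x)" if "1 \<le> x" for x
      using that by (auto intro!: derivative_eq_intros)
  qed (auto intro!: mono_onI)
  have "(\<lambda>m. 1 / real m * ((\<Sum>j=1..m. ln (real j)) - (?F (real m) - ?F 1))) \<longlonglongrightarrow> 0"
  proof (rule tendsto_0_le[where K = 1])
    show "(\<lambda>m. 1 / real m * ln (real m)) \<longlonglongrightarrow> 0" by real_asymp
    show "\<forall>\<^sub>F m in sequentially. norm (1 / real m * ((\<Sum>j=1..m. ln (real j)) - (?F (real m) - ?F 1)))
        \<le> norm (1 / real m * ln (real m)) * 1"
      using eventually_ge_at_top[of 1]
    proof eventually_elim
      case (elim m)
      then show ?case using bound[OF elim] by (auto simp: abs_mult intro!: divide_right_mono)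
    qed
  qed
  moreover have "(\<lambda>m. 1 / real m * (?F (real m) - ?F 1) - ln (real m)) \<longlonglongrightarrow> -1"
    by real_asymp
  ultimately have "(\<lambda>m. 1 / real m * ((\<Sum>j=1..m. ln (real j)) - (?F (real m) - ?F 1)) +
      (1 / real m * (?F (real m) - ?F 1) - ln (real m))) \<longlonglongrightarrow> 0 + -1"
    by (rule tendsto_add)
  moreover have "\<forall>\<^sub>F m in sequentially. 1 / real m * ((\<Sum>j=1..m. ln (real j)) - (?F (real m) - ?F 1)) +
      (1 / real m * (?F (real m) - ?F 1) - ln (real m)) = 1 / real m * (\<Sum>j=1..m. ln (real j / real m))"
    using eventually_ge_at_top[of 1]
  proof eventually_elim
    case (elim m)
    have "(\<Sum>j=1..m. ln (real j / real m)) = (\<Sum>j=1..m. ln (real j) - ln (real m))"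
      using elim by (intro sum.cong) (auto simp: ln_div)
    then show ?case using elim by (simp add: sum_subtractf right_diff_distrib)
  qed
  ultimately show ?thesis by (simp add: tendsto_cong)
qed

text \<open>Log-convexity of power sums, a form of Hoelder's inequality: the terms at the two end
  exponents are normalised by their totals, Young's inequality is applied termwise, and the weighted
  sums then add up to 1.\<close>

lemma convex_on_ln_sum_powr:
  fixes w x :: "'b \<Rightarrow> real"
  assumes fin: "finite A" and w: "\<And>j. j \<in> A \<Longrightarrow> 0 \<le> w j" and x: "\<And>j. j \<in> A \<Longrightarrow> 0 < x j"
    and pos: "\<And>q. 0 < (\<Sum>j\<in>A. w j * x j powr q)"
  shows "convex_on UNIV (\<lambda>q. ln (\<Sum>j\<in>A. w j * x j powr q))"
proof (rule convex_onI)
  fix t a b :: real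
  assume t: "0 < t" "t < 1"
  define H where "H q = (\<Sum>j\<in>A. w j * x j powr q)" for q
  have H: "0 < H q" for q using pos by (simp add: H_def)
  have *: "w j * x j powr ((1 - t) * a + t * b) \<le>
      (H a powr (1 - t) * H b powr t) * ((1 - t) * (w j * x j powr a / H a) + t * (w j * x j powr b / H b))" if "j \<in> A" for j
  proof -
    have "(x j powr a / H a) powr (1 - t) * (x j powr b / H b) powr t \<le>
        (1 - t) * (x j powr a / H a) + t * (x j powr b / H b)"
      using t H[of a] H[of b] x[OF that] by (intro Youngs_inequality_0) auto
    then have "(H a powr (1 - t) * H b powr t) * ((x j powr a / H a) powr (1 - t) * (x j powr b / H b) powr t) \<le>
        (H a powr (1 - t) * H b powr t) * ((1 - t) * (x j powr a / H a) + t * (x j powr b / H b))"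
      by (intro mult_left_mono) auto
    moreover have "(H a powr (1 - t) * H b powr t) * ((x j powr a / H a) powr (1 - t) * (x j powr b / H b) powr t)
        = x j powr ((1 - t) * a + t * b)"
      using H[of a] H[of b] by (simp add: powr_divide powr_powr powr_add mult_ac)
    ultimately have "w j * x j powr ((1 - t) * a + t * b) \<le>
        w j * ((H a powr (1 - t) * H b powr t) * ((1 - t) * (x j powr a / H a) + t * (x j powr b / H b)))"
      using w[OF that] by (intro mult_left_mono) auto
    then show ?thesis by (simp add: algebra_simps)
  qed
  have "(\<Sum>j\<in>A. w j * x j powr ((1 - t) * a + t * b)) \<le> (\<Sum>j\<in>A. (H a powr (1 - t) * H b powr t) *
      ((1 - t) * (w j * x j powr a / H a) + t * (w j * x j powr b / H b)))"
    by (rule sum_mono) (rule *)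
  then have "H ((1 - t) * a + t * b) \<le>
      (H a powr (1 - t) * H b powr t) * ((1 - t) * (H a / H a) + t * (H b / H b))"
    by (simp only: H_def[symmetric] sum_distrib_left[symmetric] sum.distrib sum_divide_distrib[symmetric])
  also have "\<dots> = H a powr (1 - t) * H b powr t"
    using H[of a] H[of b] by simp
  finally have "ln (H ((1 - t) * a + t * b)) \<le> ln (H a powr (1 - t) * H b powr t)"
    using H less_imp_neq[OF H] by (subst ln_le_cancel_iff) (auto intro!: mult_pos_pos)
  also have "\<dots> = (1 - t) * ln (H a) + t * ln (H b)"
    using H[of a] H[of b] by (simp add: ln_mult ln_powr)
  finally show "ln (\<Sum>j\<in>A. w j * x j powr ((1 - t) *\<^sub>R a + t *\<^sub>R b)) \<le>
      (1 - t) * ln (\<Sum>j\<in>A. w j * x j powr a) + t * ln (\<Sum>j\<in>A. w j * x j powr b)"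
    by (simp add: H_def)
qed simp

text \<open>If d were at distance at least r from 0, one of the points r and -r would lie on the
  segment from 0 to d, where convexity keeps \<open>L\<close> at most \<open>L 0\<close>. Convexity
  on the whole line makes this work however far away d is.\<close>

lemma convex_on_sublevel_in_interval:
  fixes L :: "real \<Rightarrow> real"
  assumes conv: "convex_on UNIV L" and r: "0 < r" "L 0 < L r" "L 0 < L (- r)" and d: "L d \<le> L 0"
  shows "\<bar>d\<bar> < r"
proof (rule ccontr)
  assume "\<not> \<bar>d\<bar> < r"
  then have rd: "r \<le> \<bar>d\<bar>" by simp
  define t where "t = r / \<bar>d\<bar>"
  have t: "0 \<le> t" "t \<le> 1" using r rd by (simp_all add: t_def)
  have "L ((1 - t) *\<^sub>R 0 + t *\<^sub>R d) \<le> (1 - t) * L 0 + t * L d"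
    by (rule convex_onD[OF conv t]) auto
  also have "\<dots> \<le> (1 - t) * L 0 + t * L 0" using t d by (simp add: mult_left_mono)
  finally have "L (t * d) \<le> L 0" by (simp add: algebra_simps)
  moreover have "t * d = r \<or> t * d = - r" using r rd by (auto simp: t_def abs_if)
  ultimately show False using r by auto
qed

text \<open>After scaling out \<open>2 \<pi> m / n\<close> the objective becomes the convex function \<open>L\<close> of
  \<open>2 (d - 1)\<close>.\<close>

lemma whittle_minimiser_close_to_1:
  fixes x :: "nat \<Rightarrow> real" and n m :: nat
  defines "Q j \<equiv> (fourier_freq n j)\<^sup>2 * periodogram n x j"
  defines "W q \<equiv> 1 / real m * (\<Sum>j=1..m. (real j / real m) powr q * Q j)"
  defines "l \<equiv> 1 / real m * (\<Sum>j=1..m. ln (real j / real m))"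
  assumes arg: "is_arg_min (whittle_R n m x) (\<lambda>d. d \<in> {\<Delta>\<^sub>1..\<Delta>\<^sub>2}) d" and one: "1 \<in> {\<Delta>\<^sub>1..\<Delta>\<^sub>2}"
    and nm: "0 < n" "0 < m" and W0: "0 < W 0" and r: "0 < r"
    and upper: "W 0 * exp (r * l) < W r" and lower: "W 0 * exp (- r * l) < W (- r)"
  shows "\<bar>2 * (d - 1)\<bar> < r"
proof -
  define s where "s = 2 * pi * real m / real n"
  have s: "0 < s" using nm by (simp add: s_def)
  have freq: "fourier_freq n j = s * (real j / real m)" for j
    using nm by (simp add: fourier_freq_def s_def)
  have Q: "0 \<le> Q j" for j by (simp add: Q_def periodogram_def)
  \<comment> \<open>A positive mean at exponent 0 forces a nonzero ordinate, so \<open>W\<close> is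
    positive at every exponent. Hence \<open>whittle_R\<close> never takes the value minus infinity
    and is given by its logarithmic branch.\<close>
  have Wpos: "0 < W q" for q
  proof -
    have "\<exists>j\<in>{1..m}. Q j \<noteq> 0"
      using W0 by (rule_tac ccontr) (simp add: W_def)
    then obtain j where j: "j \<in> {1..m}" "0 < Q j" using Q by (metis less_eq_real_def)
    have "0 < (\<Sum>j=1..m. (real j / real m) powr q * Q j)"
      by (rule sum_pos2[where i = j]) (use j Q nm in auto)
    then show ?thesis using nm by (simp add: W_def)
  qed
  have G: "whittle_G n m x e = s powr (2 * (e - 1)) * W (2 * (e - 1))" for e
  proof -
    have "fourier_freq n j powr (2 * e) * periodogram n x j =
        s powr (2 * (e - 1)) * ((real j / real m) powr (2 * (e - 1)) * Q j)" if "j \<in> {1..m}" for j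
    proof -
      have pos: "0 < fourier_freq n j" using that nm by (simp add: fourier_freq_def)
      have "fourier_freq n j powr (2 * e) = fourier_freq n j powr (2 * (e - 1)) * (fourier_freq n j)\<^sup>2"
        using pos by (simp add: powr_add[symmetric] powr_numeral[symmetric] del: powr_numeral)
      also have "fourier_freq n j powr (2 * (e - 1)) = s powr (2 * (e - 1)) * (real j / real m) powr (2 * (e - 1))"
        unfolding freq using s by (subst powr_mult) auto
      finally show ?thesis by (simp add: Q_def mult_ac)
    qed
    then have "(\<Sum>j=1..m. fourier_freq n j powr (2 * e) * periodogram n x j) =
        (\<Sum>j=1..m. s powr (2 * (e - 1)) * ((real j / real m) powr (2 * (e - 1)) * Q j))"
      by (intro sum.cong) auto
    then show ?thesis by (simp add: whittle_G_def W_def sum_distrib_left[symmetric])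
  qed
  have lnfreq: "1 / real m * (\<Sum>j=1..m. ln (fourier_freq n j)) = ln s + l"
  proof -
    have "(\<Sum>j=1..m. ln (fourier_freq n j)) = (\<Sum>j=1..m. ln s + ln (real j / real m))"
      unfolding freq using s nm by (intro sum.cong refl ln_mult_pos) auto
    then show ?thesis using nm by (simp add: l_def sum.distrib ring_distribs)
  qed
  define L where "L q = ln (W q) - q * l" for q
  \<comment> \<open>The contributions of the band edge \<open>s\<close> add up to
    \<open>2 * (e - 1) * ln s - 2 * e * ln s\<close>, a constant in e. The position of the band thus
    enters only through the ordinates \<open>Q\<close>.\<close>
  have R: "whittle_R n m x e = ereal (L (2 * (e - 1)) - 2 * ln s - 2 * l)" for e
  proof -
    have pos: "0 < whittle_G n m x e" using Wpos s by (simp add: G)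
    have "ln (whittle_G n m x e) = 2 * (e - 1) * ln s + ln (W (2 * (e - 1)))"
      unfolding G using Wpos s by (subst ln_mult_pos) (auto simp: ln_powr)
    then have "ln (whittle_G n m x e) - 2 * e * (1 / real m) * (\<Sum>j=1..m. ln (fourier_freq n j)) =
        2 * (e - 1) * ln s + ln (W (2 * (e - 1))) - 2 * e * (ln s + l)"
      by (simp only: lnfreq[symmetric] mult.assoc)
    also have "\<dots> = L (2 * (e - 1)) - 2 * ln s - 2 * l"
      by (simp add: L_def algebra_simps)
    finally show ?thesis using pos by (simp add: whittle_R_def)
  qed
  have "convex_on UNIV (\<lambda>q. ln (\<Sum>j\<in>{1..m}. Q j / real m * (real j / real m) powr q))"
  proof (rule convex_on_ln_sum_powr)
    show "0 < (\<Sum>j\<in>{1..m}. Q j / real m * (real j / real m) powr q)" for q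
      using Wpos[of q] by (simp add: W_def sum_distrib_left mult_ac)
  qed (use Q nm in auto)
  moreover have "(\<Sum>j\<in>{1..m}. Q j / real m * (real j / real m) powr q) = W q" for q
    by (simp add: W_def sum_distrib_left mult_ac)
  ultimately have "convex_on UNIV (\<lambda>q. ln (W q))" by simp
  moreover have "convex_on UNIV (\<lambda>q. q * (- l))"
    by (intro convex_onI) (auto simp: algebra_simps)
  ultimately have conv: "convex_on UNIV L"
    unfolding L_def using convex_on_add by fastforce
  have ineq: "L 0 < L q" if "W 0 * exp (q * l) < W q" for q
  proof -
    have "ln (W 0 * exp (q * l)) < ln (W q)"
      using that W0 Wpos by (subst ln_less_cancel_iff) auto
    then show ?thesis using W0 by (simp add: L_def ln_mult_pos)
  qed
  have "\<not> whittle_R n m x 1 < whittle_R n m x d"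
    using arg one by (auto simp: is_arg_min_def)
  then have "L (2 * (d - 1)) \<le> L 0" by (simp add: R)
  then show ?thesis
    using convex_on_sublevel_in_interval[OF conv r] ineq[OF upper] ineq[OF lower] by blast
qed

lemma one_plus_less_exp: "x \<noteq> 0 \<Longrightarrow> 1 + x < exp (x::real)"
  using exp_ge_add_one_self[of x] ln_eq_minus_one[of "exp x"] by (cases "1 + x = exp x") (auto simp: less_le simp del: exp_ge_add_one_self)

text \<open>The strict inequality \<open>exp (- q) < 1 / (1 + q)\<close> for \<open>q \<noteq> 0\<close> leaves room for the tolerance \<open>\<tau>\<close>.\<close>

lemma whittle_minimiser_of_flat_ordinates:
  assumes r: "0 < r" "r < 1"
  obtains \<tau> :: real where "0 < \<tau>"
    "\<forall>\<^sub>F m in sequentially. \<forall>n x v d \<Delta>\<^sub>1 \<Delta>\<^sub>2. 0 < n \<longrightarrow> 0 < v \<longrightarrow> 1 \<in> {\<Delta>\<^sub>1..\<Delta>\<^sub>2} \<longrightarrow>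
       is_arg_min (whittle_R n m x) (\<lambda>d. d \<in> {\<Delta>\<^sub>1..\<Delta>\<^sub>2}) d \<longrightarrow>
       (\<forall>q\<in>{r, 0, - r}. 1 / real m * (\<Sum>j=1..m. (real j / real m) powr q *
          \<bar>(fourier_freq n j)\<^sup>2 * periodogram n x j - v\<bar>) \<le> \<tau> * v) \<longrightarrow> \<bar>2 * (d - 1)\<bar> < r"
proof -
  define \<mu> where "\<mu> q m = 1 / real m * (\<Sum>j=1..m. (real j / real m) powr q)" for q and m :: nat
  define l where "l m = 1 / real m * (\<Sum>j=1..m. ln (real j / real m))" for m :: nat
  \<comment> \<open>The comparison needed below is
    \<open>(1 + \<tau>) * exp (- q) < 1 / (1 + q) - \<tau>\<close>, equivalently
    \<open>\<tau> * (1 + exp (- q)) < 1 / (1 + q) - exp (- q)\<close>; \<open>gap q\<close> is half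
    of this threshold for \<tau>.\<close>
  define gap where "gap q = (1 / (1 + q) - exp (- q)) / (2 * (1 + exp (- q)))" for q :: real
  have lt: "exp (- q) < 1 / (1 + q)" if "q \<in> {r, - r}" for q
  proof -
    have "1 + q < exp q" "0 < 1 + q" using one_plus_less_exp[of q] that r by auto
    then show ?thesis by (simp add: exp_minus field_simps)
  qed
  have gap: "0 < gap q" if "q \<in> {r, - r}" for q
    using lt[OF that] by (simp add: gap_def add_pos_pos)
  \<comment> \<open>The bound 1 / 2 keeps \<tau> below 1, so that the mean at exponent 0, which is
    within \<tau> v of v, is positive.\<close>
  define \<tau> where "\<tau> = min (1 / 2) (min (gap r) (gap (- r)))"
  have \<tau>: "0 < \<tau>" "\<tau> < 1" "\<tau> \<le> gap r" "\<tau> \<le> gap (- r)"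
    using gap by (auto simp: \<tau>_def)
  have ev: "\<forall>\<^sub>F m in sequentially. (1 + \<tau>) * exp (q * l m) < \<mu> q m - \<tau>" if q: "q \<in> {r, - r}" for q
  proof -
    have "\<tau> * (1 + exp (- q)) \<le> gap q * (1 + exp (- q))"
      using \<tau> q by (intro mult_right_mono) (auto simp: add_nonneg_nonneg)
    also have "\<dots> = (1 / (1 + q) - exp (- q)) / 2"
    proof -
      have "1 + exp (- q) \<noteq> 0" using exp_gt_zero[of "- q"] by linarith
      moreover have "x / (2 * y) * y = x / 2" if "y \<noteq> 0" for x y :: real using that by simp
      ultimately show ?thesis unfolding gap_def by blast
    qed
    also have "\<dots> < 1 / (1 + q) - exp (- q)"
      using lt[OF q] by simp
    finally have "(1 + \<tau>) * exp (q * -1) < 1 / (1 + q) - \<tau>" by (simp add: algebra_simps)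
    moreover have "(\<lambda>m. (\<mu> q m - \<tau>) - (1 + \<tau>) * exp (q * l m)) \<longlonglongrightarrow> (1 / (1 + q) - \<tau>) - (1 + \<tau>) * exp (q * -1)"
      unfolding \<mu>_def l_def
      by (intro tendsto_intros mean_powr_tendsto mean_ln_tendsto) (use q r in auto)
    ultimately show ?thesis
      using order_tendstoD(1)[of _ _ _ 0] by (fastforce simp: algebra_simps)
  qed
  have "\<forall>\<^sub>F m in sequentially. \<forall>n x v d \<Delta>\<^sub>1 \<Delta>\<^sub>2. 0 < n \<longrightarrow> 0 < v \<longrightarrow> 1 \<in> {\<Delta>\<^sub>1..\<Delta>\<^sub>2} \<longrightarrow>
       is_arg_min (whittle_R n m x) (\<lambda>d. d \<in> {\<Delta>\<^sub>1..\<Delta>\<^sub>2}) d \<longrightarrow>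
       (\<forall>q\<in>{r, 0, - r}. 1 / real m * (\<Sum>j=1..m. (real j / real m) powr q *
          \<bar>(fourier_freq n j)\<^sup>2 * periodogram n x j - v\<bar>) \<le> \<tau> * v) \<longrightarrow> \<bar>2 * (d - 1)\<bar> < r"
    using ev[of r, simplified] ev[of "- r", simplified] eventually_gt_at_top[of 0]
  proof eventually_elim
    case (elim m)
    show ?case
    proof (intro allI impI)
      fix n :: nat and x v d \<Delta>\<^sub>1 \<Delta>\<^sub>2
      assume n: "0 < n" and v: "0 < v" and one: "1 \<in> {\<Delta>\<^sub>1..\<Delta>\<^sub>2}"
        and arg: "is_arg_min (whittle_R n m x) (\<lambda>d. d \<in> {\<Delta>\<^sub>1..\<Delta>\<^sub>2}) d"
        and flat: "\<forall>q\<in>{r, 0, - r}. 1 / real m * (\<Sum>j=1..m. (real j / real m) powr q *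
          \<bar>(fourier_freq n j)\<^sup>2 * periodogram n x j - v\<bar>) \<le> \<tau> * v"
      define Q where "Q j = (fourier_freq n j)\<^sup>2 * periodogram n x j" for j
      define W where "W q = 1 / real m * (\<Sum>j=1..m. (real j / real m) powr q * Q j)" for q
      have W: "\<bar>W q - \<mu> q m * v\<bar> \<le> \<tau> * v" if "q \<in> {r, 0, - r}" for q
      proof -
        have "W q - \<mu> q m * v = 1 / real m * (\<Sum>j=1..m. (real j / real m) powr q * (Q j - v))"
          by (simp add: W_def \<mu>_def sum_distrib_left sum_distrib_right sum_subtractf algebra_simps)
        also have "\<bar>\<dots>\<bar> \<le> 1 / real m * (\<Sum>j=1..m. \<bar>(real j / real m) powr q * (Q j - v)\<bar>)"
          by (simp only: abs_mult[of "1 / real m"]) (intro mult_mono sum_abs, auto)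
        also have "\<dots> = 1 / real m * (\<Sum>j=1..m. (real j / real m) powr q * \<bar>Q j - v\<bar>)"
          by (simp add: abs_mult)
        also have "\<dots> \<le> \<tau> * v" using bspec[OF flat that] by (simp only: Q_def)
        finally show ?thesis .
      qed
      have mu0: "\<mu> 0 m = 1" using elim by (simp add: \<mu>_def)
      have "\<tau> * v < v" using \<tau> v by simp
      then have W0: "0 < W 0" "W 0 \<le> (1 + \<tau>) * v" using W[of 0] by (auto simp: mu0 algebra_simps)
      have key: "W 0 * exp (q * l m) < W q" if q: "q \<in> {r, - r}" "(1 + \<tau>) * exp (q * l m) < \<mu> q m - \<tau>" for q
      proof -
        have "W 0 * exp (q * l m) \<le> (1 + \<tau>) * v * exp (q * l m)" using W0 by (intro mult_right_mono) auto
        also have "\<dots> = v * ((1 + \<tau>) * exp (q * l m))" by simp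
        also have "\<dots> < v * (\<mu> q m - \<tau>)" using q v by (intro mult_strict_left_mono) auto
        also have "\<dots> \<le> W q" using W[of q] q by (auto simp: algebra_simps)
        finally show ?thesis .
      qed
      have u: "W 0 * exp (r * l m) < W r" and lo: "W 0 * exp (- r * l m) < W (- r)"
        using key[of r] key[of "- r"] elim by auto
      show "\<bar>2 * (d - 1)\<bar> < r"
        by (rule whittle_minimiser_close_to_1[OF arg one n elim(3) _ r(1)])
          (use W0 u lo in \<open>simp_all only: W_def Q_def l_def\<close>)
    qed
  qed
  then show ?thesis using that \<tau>(1) by blast
qed

section \<open>The spectral measure\<close>

text \<open>The cut-off to [-pi, pi] is built into the density because \<open>f\<close> is arbitrary
  outside that interval. A measure lets symmetry be expressed through integrals, without pointwise
  evenness of \<open>f\<close>.\<close>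

definition spectral_measure :: "(real \<Rightarrow> real) \<Rightarrow> real measure" where
  "spectral_measure f = density lborel (\<lambda>x. ennreal (indicator {-pi..pi} x * f x))"

lemma space_spectral_measure [simp]: "space (spectral_measure f) = UNIV"
  and sets_spectral_measure [simp, measurable_cong]: "sets (spectral_measure f) = sets borel"
  by (simp_all add: spectral_measure_def)

context
  fixes f :: "real \<Rightarrow> real"
  assumes f_nonneg: "\<And>x. x \<in> {-pi..pi} \<Longrightarrow> 0 \<le> f x"
    and f_int: "set_integrable lborel {-pi..pi} f"
begin

lemma spectral_density_integrable: "integrable lborel (\<lambda>x. indicator {-pi..pi} x * f x)"
  using f_int by (simp add: set_integrable_def)

lemma spectral_density_measurable [measurable]: "(\<lambda>x. indicator {-pi..pi} x * f x) \<in> borel_measurable borel"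
  using borel_measurable_integrable[OF spectral_density_integrable] by simp

lemma spectral_density_nonneg: "0 \<le> indicator {-pi..pi} x * f x"
  using f_nonneg by (simp add: indicator_def)

lemma finite_spectral_measure: "finite_measure (spectral_measure f)"
proof
  have "emeasure (spectral_measure f) UNIV = (\<integral>\<^sup>+x. ennreal (indicator {-pi..pi} x * f x) \<partial>lborel)"
    by (simp add: spectral_measure_def emeasure_density)
  also have "\<dots> = ennreal (\<integral>x. indicator {-pi..pi} x * f x \<partial>lborel)"
    by (rule nn_integral_eq_integral[OF spectral_density_integrable]) (simp add: spectral_density_nonneg)
  finally show "emeasure (spectral_measure f) (space (spectral_measure f)) \<noteq> \<infinity>" by simp
qed

lemma AE_spectral_measure_iff:
  "(AE x in spectral_measure f. P x) \<longleftrightarrow> (AE x in lborel. 0 < indicator {-pi..pi} x * f x \<longrightarrow> P x)"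
  unfolding spectral_measure_def by (subst AE_density) simp_all

lemma AE_spectral_measure: "AE x in spectral_measure f. x \<in> {-pi..pi}"
  by (auto simp: AE_spectral_measure_iff indicator_def)

lemma AE_spectral_measure_neq: "AE x in spectral_measure f. x \<noteq> c"
proof -
  have "AE x in lborel. x \<noteq> c" by (rule AE_lborel_singleton)
  then show ?thesis unfolding AE_spectral_measure_iff by eventually_elim simp
qed

lemma integral_spectral_measure:
  fixes g :: "real \<Rightarrow> 'b :: {banach, second_countable_topology}"
  assumes "g \<in> borel_measurable borel"
  shows "integral\<^sup>L (spectral_measure f) g = (LINT x|lborel. (indicator {-pi..pi} x * f x) *\<^sub>R g x)"
  unfolding spectral_measure_def
  by (rule integral_density) (use assms spectral_density_nonneg in auto)

lemma integrable_spectral_measure: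
  fixes g :: "real \<Rightarrow> 'b :: {banach, second_countable_topology}"
  assumes "continuous_on UNIV g"
  shows "integrable (spectral_measure f) g"
proof -
  interpret finite_measure "spectral_measure f" by (rule finite_spectral_measure)
  have "compact (g ` {-pi..pi})"
    using assms by (intro compact_continuous_image continuous_on_subset[OF assms]) auto
  then obtain B where B: "\<And>x. x \<in> {-pi..pi} \<Longrightarrow> norm (g x) \<le> B"
    using compact_imp_bounded bounded_iff by (metis image_eqI)
  have [measurable]: "g \<in> borel_measurable borel" using assms by (rule borel_measurable_continuous_onI)
  show ?thesis
    by (rule integrable_const_bound[where B = B]) (use AE_spectral_measure B in auto)
qed

text \<open>The spectral measure is symmetric: its Fourier coefficients, being covariances, are real;
  symmetry then passes from \<open>cis\<close> to trigonometric polynomials and, by Stone--Weierstrass on the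
  unit circle, to continuous functions.\<close>

context
  assumes fourier_sym: "\<And>k::int. (LINT x|spectral_measure f. cis (of_int k * x)) = (LINT x|spectral_measure f. cis (- (of_int k * x)))"
begin

lemma integral_spectral_measure_reflect_poly:
  fixes g :: "complex \<Rightarrow> real"
  assumes "real_polynomial_function g"
  shows "(LINT x|spectral_measure f. g (cis x)) = (LINT x|spectral_measure f. g (cis (- x)))"
proof -
  let ?N = "spectral_measure f"
  \<comment> \<open>Testing against all frequencies k makes the property stable under multiplication
    by \<open>cis (of_int i * x)\<close>, which merely shifts k. The case k = 0 is the one extracted
    in the end.\<close>
  define Q :: "(real \<Rightarrow> complex) \<Rightarrow> bool" where "Q T \<longleftrightarrow> continuous_on UNIV T \<and>
    (\<forall>k::int. (LINT x|?N. T x * cis (of_int k * x)) = (LINT x|?N. T (- x) * cis (- (of_int k * x))))" for T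
  have cont_refl: "continuous_on UNIV (\<lambda>x. T (- x))" if "continuous_on UNIV T" for T :: "real \<Rightarrow> complex"
    using that by (intro continuous_on_compose2[OF that]) (auto intro!: continuous_intros)
  have int: "integrable ?N (\<lambda>x. T x * cis (of_int k * x))" "integrable ?N (\<lambda>x. T (- x) * cis (- (of_int k * x)))"
    if "continuous_on UNIV T" for T and k :: int
    using that cont_refl[OF that] by (auto intro!: integrable_spectral_measure continuous_intros)
  have Q_add: "Q (\<lambda>x. S x + T x)" if "Q S" "Q T" for S T
    using that int by (simp add: Q_def distrib_right continuous_on_add)
  have Q_scale: "Q (\<lambda>x. c * T x)" if "Q T" for c T
    using that by (simp add: Q_def mult.assoc continuous_on_mult_left)
  have Q_cis: "Q (\<lambda>x. cis (of_int i * x) * T x)" if "Q T" for T and i :: int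
  proof -
    have *: "cis (of_int (i + k) * x) = cis (of_int i * x) * cis (of_int k * x)"
      "cis (- (of_int (i + k) * x)) = cis (of_int i * (- x)) * cis (- (of_int k * x))" for k x
      by (simp_all add: cis_mult distrib_right)
    have H: "(LINT x|?N. T x * cis (of_int (i + k) * x)) = (LINT x|?N. T (- x) * cis (- (of_int (i + k) * x)))" for k
      using that unfolding Q_def by blast
    have "(LINT x|?N. cis (of_int i * x) * T x * cis (of_int k * x)) = (LINT x|?N. cis (of_int i * (- x)) * T (- x) * cis (- (of_int k * x)))" for k
      using H[of k] by (simp only: *) (simp add: mult_ac)
    then show ?thesis using that by (simp add: Q_def continuous_intros)
  qed
  \<comment> \<open>With \<open>T\<close> arbitrary, a product of polynomials is absorbed one factor
    at a time. On the unit circle a real linear functional is a combination of cis x and cis (- x),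
    which settles the linear case.\<close>
  have "Q (\<lambda>x. complex_of_real (g (cis x)) * T x)" if "Q T" for T
    using assms that
  proof (induction g arbitrary: T)
    case (linear g)
    interpret bounded_linear g by fact
    define a where "a = (complex_of_real (g 1) - \<i> * g \<i>) / 2"
    define b where "b = (complex_of_real (g 1) + \<i> * g \<i>) / 2"
    have "complex_of_real (g (cis x)) * T x = a * (cis (of_int 1 * x) * T x) + b * (cis (of_int (-1) * x) * T x)" for x
    proof -
      have "cis x = cos x *\<^sub>R 1 + sin x *\<^sub>R \<i>" by (simp add: complex_eq_iff)
      then have "g (cis x) = cos x * g 1 + sin x * g \<i>" by (simp only: add scaleR) simp
      then have "complex_of_real (g (cis x)) = a * cis x + b * cis (- x)"
        by (simp add: a_def b_def complex_eq_iff add_divide_distrib[symmetric])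
      then show ?thesis by (simp add: algebra_simps)
    qed
    then show ?case using Q_add[OF Q_scale[OF Q_cis[OF linear.prems, of 1], of a] Q_scale[OF Q_cis[OF linear.prems, of "-1"], of b]]
      by presburger
  next
    case (const c)
    then show ?case using Q_scale by blast
  next
    case (add g h)
    then show ?case using Q_add by (simp add: distrib_right)
  next
    case (mult g h)
    then show ?case by (simp add: mult.assoc)
  qed
  moreover have "Q (\<lambda>x. 1)" using fourier_sym by (simp add: Q_def)
  ultimately have "Q (\<lambda>x. complex_of_real (g (cis x)) * 1)" by blast
  then have "(LINT x|?N. complex_of_real (g (cis x)) * cis (of_int 0 * x)) =
      (LINT x|?N. complex_of_real (g (cis (- x))) * cis (- (of_int 0 * x)))" by (simp only: Q_def mult_1_right)
  then have "complex_of_real (LINT x|?N. g (cis x)) = complex_of_real (LINT x|?N. g (cis (- x)))" by simp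
  then show ?thesis by (simp only: of_real_eq_iff)
qed

lemma integral_spectral_measure_reflect:
  fixes h :: "complex \<Rightarrow> real"
  assumes h: "continuous_on UNIV h"
  shows "(LINT x|spectral_measure f. h (cis x)) = (LINT x|spectral_measure f. h (cis (- x)))"
proof -
  let ?N = "spectral_measure f"
  interpret finite_measure ?N by (rule finite_spectral_measure)
  have cc: "continuous_on UNIV (\<lambda>x. g (cis x))" "continuous_on UNIV (\<lambda>x. g (cis (- x)))" if "continuous_on UNIV g" for g :: "complex \<Rightarrow> real"
    using that by (auto intro!: continuous_intros continuous_on_compose2[OF that])
  have close: "\<bar>(LINT x|?N. h (cis x)) - (LINT x|?N. h (cis (- x)))\<bar> \<le> 2 * e * measure ?N UNIV" if e: "0 < e" for e
  proof -
    obtain g where g: "real_polynomial_function g" "\<And>z. z \<in> sphere 0 1 \<Longrightarrow> \<bar>h z - g z\<bar> < e"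
      using Stone_Weierstrass_real_polynomial_function[OF compact_sphere continuous_on_subset[OF h] e, of 0 1] by auto
    have gc: "continuous_on UNIV g"
      using g(1) continuous_on_polymonial_function real_polynomial_function_eq by blast
    have bd: "\<bar>(LINT x|?N. h (cis (s x))) - (LINT x|?N. g (cis (s x)))\<bar> \<le> e * measure ?N UNIV"
      if s: "s = (\<lambda>x. x) \<or> s = uminus" for s
    proof -
      have i: "integrable ?N (\<lambda>x. h (cis (s x)))" "integrable ?N (\<lambda>x. g (cis (s x)))"
        using s cc[OF h] cc[OF gc] by (auto intro!: integrable_spectral_measure)
      have "\<bar>LINT x|?N. h (cis (s x)) - g (cis (s x))\<bar> \<le> (LINT x|?N. \<bar>h (cis (s x)) - g (cis (s x))\<bar>)"
        using integral_norm_bound[of ?N "\<lambda>x. h (cis (s x)) - g (cis (s x))"] by simp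
      also have "\<dots> \<le> (LINT x|?N. e)"
        using i by (intro integral_mono) (auto simp: less_imp_le g(2))
      finally show ?thesis using i by (simp add: mult.commute)
    qed
    have *: "(LINT x|?N. g (cis x)) = (LINT x|?N. g (cis (- x)))"
      by (rule integral_spectral_measure_reflect_poly[OF g(1)])
    show ?thesis
      using bd[of "\<lambda>x. x"] bd[of uminus] * by auto
  qed
  show ?thesis
  proof (rule ccontr)
    assume ne: "\<not> ?thesis"
    define D where "D = \<bar>(LINT x|?N. h (cis x)) - (LINT x|?N. h (cis (- x)))\<bar>"
    have D: "0 < D" using ne by (simp add: D_def)
    define \<nu> where "\<nu> = measure ?N UNIV"
    have \<nu>: "0 \<le> \<nu>" by (simp add: \<nu>_def)
    have "D \<le> 2 * (D / (4 * (\<nu> + 1))) * \<nu>"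
      unfolding D_def \<nu>_def by (rule close) (use D in \<open>auto simp: D_def add_nonneg_pos\<close>)
    also have "\<dots> \<le> D / 2" using D \<nu> by (simp add: field_simps add_nonneg_pos)
    finally show False using D by simp
  qed
qed

text \<open>Folds the measure onto (0, pi), the side on which \<open>assumption1\<close> controls
  \<open>f\<close>. The indicator of the lower half circle is not continuous, so the reflection rule
  is applied to continuous cut-offs and passed to the limit by dominated convergence. The points 0,
  pi and - pi are null sets because the measure has a density.\<close>

lemma integral_spectral_measure_half:
  fixes h :: "complex \<Rightarrow> real"
  assumes h: "continuous_on UNIV h"
  shows "(LINT x|spectral_measure f. h (cis x)) =
    (LINT x|spectral_measure f. indicator {0<..<pi} x * (h (cis x) + h (cis (- x))))"
proof -
  let ?N = "spectral_measure f"
  interpret finite_measure ?N by (rule finite_spectral_measure)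
  have [measurable]: "h \<in> borel_measurable borel" using h by (rule borel_measurable_continuous_onI)
  have [measurable]: "cis \<in> borel_measurable borel" by (intro borel_measurable_continuous_onI continuous_intros)
  \<comment> \<open>continuous approximations of the indicator of the lower half plane\<close>
  define \<psi> :: "nat \<Rightarrow> complex \<Rightarrow> real" where "\<psi> k z = min 1 (real k * max 0 (- Im z))" for k z
  have \<psi>_cont: "continuous_on UNIV (\<lambda>z. h z * \<psi> k z)" for k
    unfolding \<psi>_def by (intro continuous_intros h)
  have \<psi>_bd: "0 \<le> \<psi> k z" "\<psi> k z \<le> 1" for k z by (auto simp: \<psi>_def)
  have \<psi>_lim: "(\<lambda>k. \<psi> k z) \<longlonglongrightarrow> indicator {z. Im z < 0} z" for z
  proof (cases "Im z < 0")
    case True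
    have "\<forall>\<^sub>F k in sequentially. \<psi> k z = 1"
      using eventually_ge_at_top[of "nat \<lceil>1 / (- Im z)\<rceil>"]
    proof eventually_elim
      case (elim k)
      then have "1 / (- Im z) \<le> real k" by linarith
      then have "1 \<le> real k * (- Im z)" using True by (simp add: field_simps)
      then show ?case using True by (simp add: \<psi>_def)
    qed
    then show ?thesis using True by (simp add: tendsto_eventually)
  qed (simp add: \<psi>_def)
  have cc: "continuous_on UNIV (\<lambda>x. \<bar>h (cis x)\<bar>)" "continuous_on UNIV (\<lambda>x. \<bar>h (cis (- x))\<bar>)" 
    "continuous_on UNIV (\<lambda>x. h (cis x))" "continuous_on UNIV (\<lambda>x. h (cis (- x)))"
    by (auto intro!: continuous_intros continuous_on_compose2[OF h])
  have "(\<lambda>k. LINT x|?N. h (cis x) * \<psi> k (cis x)) \<longlonglongrightarrow> (LINT x|?N. h (cis x) * indicator {z. Im z < 0} (cis x))"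
  proof (rule integral_dominated_convergence[where w = "\<lambda>x. \<bar>h (cis x)\<bar>"])
    show "AE x in ?N. (\<lambda>k. h (cis x) * \<psi> k (cis x)) \<longlonglongrightarrow> h (cis x) * indicator {z. Im z < 0} (cis x)"
      by (intro AE_I2 tendsto_intros \<psi>_lim)
    show "AE x in ?N. norm (h (cis x) * \<psi> k (cis x)) \<le> \<bar>h (cis x)\<bar>" for k
      using \<psi>_bd by (auto simp: abs_mult intro!: mult_left_le)
  qed (auto simp: \<psi>_def intro!: integrable_spectral_measure cc)
  moreover have "(\<lambda>k. LINT x|?N. h (cis (- x)) * \<psi> k (cis (- x))) \<longlonglongrightarrow> (LINT x|?N. h (cis (- x)) * indicator {z. Im z < 0} (cis (- x)))"
  proof (rule integral_dominated_convergence[where w = "\<lambda>x. \<bar>h (cis (- x))\<bar>"])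
    show "AE x in ?N. (\<lambda>k. h (cis (- x)) * \<psi> k (cis (- x))) \<longlonglongrightarrow> h (cis (- x)) * indicator {z. Im z < 0} (cis (- x))"
      by (intro AE_I2 tendsto_intros \<psi>_lim)
    show "AE x in ?N. norm (h (cis (- x)) * \<psi> k (cis (- x))) \<le> \<bar>h (cis (- x))\<bar>" for k
      using \<psi>_bd by (auto simp: abs_mult intro!: mult_left_le)
  qed (auto simp: \<psi>_def intro!: integrable_spectral_measure cc)
  moreover have "(LINT x|?N. h (cis x) * \<psi> k (cis x)) = (LINT x|?N. h (cis (- x)) * \<psi> k (cis (- x)))" for k
    by (rule integral_spectral_measure_reflect[OF \<psi>_cont])
  ultimately have neg: "(LINT x|?N. h (cis x) * indicator {z. Im z < 0} (cis x)) =
      (LINT x|?N. h (cis (- x)) * indicator {z. Im z < 0} (cis (- x)))"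
    using LIMSEQ_unique by fastforce
  have sgn: "(0 < sin x) = (0 < x)" if "x \<in> {-pi..pi}" "x \<noteq> 0" "x \<noteq> pi" "x \<noteq> - pi" for x :: real
    using that sin_gt_zero[of x] sin_gt_zero[of "- x"] by (cases "0 < x") auto
  have AE: "AE x in ?N. x \<in> {-pi..pi} \<and> x \<noteq> 0 \<and> x \<noteq> pi \<and> x \<noteq> - pi"
    using AE_spectral_measure AE_spectral_measure_neq[of 0] AE_spectral_measure_neq[of pi] AE_spectral_measure_neq[of "- pi"]
    by eventually_elim auto
  have i1: "integrable ?N (\<lambda>x. h (cis x) * indicator {z. Im z < 0} (cis x))"
    by (rule Bochner_Integration.integrable_bound[OF integrable_spectral_measure[OF cc(1)]]) (auto simp: indicator_def)
  have i2: "integrable ?N (\<lambda>x. h (cis x) * indicator {0<..<pi} x)"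
    by (rule Bochner_Integration.integrable_bound[OF integrable_spectral_measure[OF cc(1)]]) (auto simp: indicator_def)
  have i3: "integrable ?N (\<lambda>x. h (cis (- x)) * indicator {0<..<pi} x)"
    by (rule Bochner_Integration.integrable_bound[OF integrable_spectral_measure[OF cc(2)]]) (auto simp: indicator_def)
  have "(LINT x|?N. h (cis x)) = (LINT x|?N. h (cis x) * indicator {z. Im z < 0} (cis x) + h (cis x) * indicator {0<..<pi} x)"
  proof (rule integral_cong_AE)
    show "AE x in ?N. h (cis x) = h (cis x) * indicator {z. Im z < 0} (cis x) + h (cis x) * indicator {0<..<pi} x"
      using AE
    proof eventually_elim
      case (elim x)
      then show ?case using sgn[of x] sgn[of "- x"] by (auto simp: indicator_def)
    qed
  qed auto
  also have "\<dots> = (LINT x|?N. h (cis (- x)) * indicator {z. Im z < 0} (cis (- x))) + (LINT x|?N. h (cis x) * indicator {0<..<pi} x)"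
    using i1 i2 by (simp add: neg)
  also have "(LINT x|?N. h (cis (- x)) * indicator {z. Im z < 0} (cis (- x))) = (LINT x|?N. h (cis (- x)) * indicator {0<..<pi} x)"
  proof (rule integral_cong_AE)
    show "AE x in ?N. h (cis (- x)) * indicator {z. Im z < 0} (cis (- x)) = h (cis (- x)) * indicator {0<..<pi} x"
      using AE
    proof eventually_elim
      case (elim x)
      then show ?case using sgn[of x] by (auto simp: indicator_def)
    qed
  qed auto
  also have "\<dots> + (LINT x|?N. h (cis x) * indicator {0<..<pi} x) = (LINT x|?N. indicator {0<..<pi} x * (h (cis x) + h (cis (- x))))"
    using i2 i3 by (simp add: distrib_left mult.commute)
  finally show ?thesis .
qed

end

end

section \<open>Second moments of linear combinations of a stationary process\<close>

lemma integrable_mult_square_integrable: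
  fixes f g :: "'a \<Rightarrow> real"
  assumes [measurable]: "f \<in> borel_measurable M" "g \<in> borel_measurable M"
    and "integrable M (\<lambda>x. (f x)\<^sup>2)" "integrable M (\<lambda>x. (g x)\<^sup>2)"
  shows "integrable M (\<lambda>x. f x * g x)"
proof (rule Bochner_Integration.integrable_bound)
  show "integrable M (\<lambda>x. (f x)\<^sup>2 + (g x)\<^sup>2)" using assms by simp
  show "AE x in M. norm (f x * g x) \<le> norm ((f x)\<^sup>2 + (g x)\<^sup>2)"
  proof (rule AE_I2)
    fix x
    have "2 * (\<bar>f x\<bar> * \<bar>g x\<bar>) \<le> (f x)\<^sup>2 + (g x)\<^sup>2"
      using sum_squares_bound[of "\<bar>f x\<bar>" "\<bar>g x\<bar>"] by simp
    moreover have "0 \<le> \<bar>f x\<bar> * \<bar>g x\<bar>" by simp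
    ultimately have "\<bar>f x\<bar> * \<bar>g x\<bar> \<le> (f x)\<^sup>2 + (g x)\<^sup>2" by linarith
    then show "norm (f x * g x) \<le> norm ((f x)\<^sup>2 + (g x)\<^sup>2)" by (simp add: abs_mult)
  qed
qed simp

lemma integral_cis_of_int:
  "(LINT x|lborel. indicator {-pi..pi} x *\<^sub>R cis (of_int k * x)) = (if k = 0 then 2 * complex_of_real pi else 0)"
proof (cases "k = 0")
  case True
  have "(LINT x|lborel. indicator {-pi..pi} x *\<^sub>R (1::complex)) = of_real (2 * pi)"
    by (subst integral_scaleR_left) (auto simp: scaleR_conv_of_real)
  then show ?thesis using True by simp
next
  case False
  have "(LINT x|lborel. indicator {-pi..pi} x *\<^sub>R cis (of_int k * x)) =
      - \<i> / of_int k * cis (of_int k * pi) - (- \<i> / of_int k * cis (of_int k * - pi))"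
  proof (rule integral_FTC_Icc[where F = "\<lambda>x. - \<i> / of_int k * cis (of_int k * x)"])
    fix x :: real
    have "((\<lambda>x. - \<i> / of_int k * cis (of_int k * x)) has_vector_derivative - \<i> / of_int k * (of_int k * (\<i> * cis (of_int k * x)))) (at x within {-pi..pi})"
      unfolding cis_conv_exp
      by (rule has_vector_derivative_eq_rhs, (rule derivative_eq_intros refl has_vector_derivative_real_field | simp)+, simp add: mult.commute[of _ \<i>])
    then show "((\<lambda>x. - \<i> / of_int k * cis (of_int k * x)) has_vector_derivative cis (of_int k * x)) (at x within {-pi..pi})"
      using False by simp
  qed (auto intro!: continuous_intros)
  also have "cis (of_int k * pi) = cis (of_int k * - pi)"
    by (simp add: complex_eq_iff sin_int_times_real mult.commute[of _ pi])
  finally show ?thesis using False by simp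
qed

lemma norm_trig_sum_square:
  "complex_of_real ((cmod (\<Sum>r\<in>R. a r * cis (real r * x)))\<^sup>2) =
    (\<Sum>r\<in>R. \<Sum>s\<in>R. a r * cnj (a s) * cis (of_int (int r - int s) * x))"
proof -
  have "complex_of_real ((cmod (\<Sum>r\<in>R. a r * cis (real r * x)))\<^sup>2) =
      (\<Sum>r\<in>R. a r * cis (real r * x)) * (\<Sum>s\<in>R. cnj (a s * cis (real s * x)))"
    by (simp only: complex_norm_square cnj_sum)
  also have "\<dots> = (\<Sum>r\<in>R. \<Sum>s\<in>R. a r * cnj (a s) * cis (of_int (int r - int s) * x))"
    unfolding sum_product
  proof (intro sum.cong refl)
    fix r s
    have "cis (of_int (int r - int s) * x) = cis (real r * x) * cnj (cis (real s * x))"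
      by (simp add: cis_cnj cis_mult left_diff_distrib)
    then show "a r * cis (real r * x) * cnj (a s * cis (real s * x)) = a r * cnj (a s) * cis (of_int (int r - int s) * x)"
      by (simp only: complex_cnj_mult mult_ac)
  qed
  finally show ?thesis .
qed

text \<open>Parseval's identity: in the expanded square, integration of \<open>cis\<close> over a
  full period removes all pairs with different indices.\<close>

lemma integral_norm_trig_sum_square:
  fixes a :: "nat \<Rightarrow> complex"
  assumes "finite R"
  shows "(LINT x|lborel. indicator {-pi..pi} x * (cmod (\<Sum>r\<in>R. a r * cis (real r * x)))\<^sup>2) = 2 * pi * (\<Sum>r\<in>R. (cmod (a r))\<^sup>2)"
proof -
  have int: "integrable lborel (\<lambda>x. indicator {-pi..pi} x *\<^sub>R cis (of_int k * x))" for k :: int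
    by (intro borel_integrable_compact compact_Icc continuous_intros)
  have "complex_of_real (LINT x|lborel. indicator {-pi..pi} x * (cmod (\<Sum>r\<in>R. a r * cis (real r * x)))\<^sup>2) =
      (LINT x|lborel. indicator {-pi..pi} x *\<^sub>R complex_of_real ((cmod (\<Sum>r\<in>R. a r * cis (real r * x)))\<^sup>2))"
    by (simp add: integral_complex_of_real[symmetric] scaleR_conv_of_real del: integral_complex_of_real)
  also have "\<dots> = (LINT x|lborel. (\<Sum>r\<in>R. \<Sum>s\<in>R. a r * cnj (a s) * (indicator {-pi..pi} x *\<^sub>R cis (of_int (int r - int s) * x))))"
    unfolding norm_trig_sum_square by (simp only: scaleR_sum_right mult_scaleR_right)
  also have "\<dots> = (\<Sum>r\<in>R. \<Sum>s\<in>R. a r * cnj (a s) * (LINT x|lborel. indicator {-pi..pi} x *\<^sub>R cis (of_int (int r - int s) * x)))"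
    by (subst Bochner_Integration.integral_sum;
        (intro Bochner_Integration.integrable_sum integrable_mult_right int sum.cong refl)?)
      (subst Bochner_Integration.integral_sum;
        (intro integrable_mult_right int sum.cong refl integral_mult_right_zero)?)
  also have "\<dots> = (\<Sum>r\<in>R. \<Sum>s\<in>R. if s = r then complex_of_real (2 * pi * (cmod (a r))\<^sup>2) else 0)"
    unfolding integral_cis_of_int by (intro sum.cong refl) (auto simp: complex_norm_square[symmetric])
  also have "\<dots> = complex_of_real (2 * pi * (\<Sum>r\<in>R. (cmod (a r))\<^sup>2))"
    using assms by (simp add: sum_distrib_left)
  finally show ?thesis by (simp only: of_real_eq_iff)
qed

locale stationary_process = prob_space M for M :: "'a measure" +
  fixes u :: "int \<Rightarrow> 'a \<Rightarrow> real" and f :: "real \<Rightarrow> real"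
  assumes stationary: "zero_mean_stationary M u"
    and spectral_density: "has_spectral_density M u f"
    and spectral_density_at_0: "assumption1 f"
begin

lemma u_measurable [measurable]: "1 \<le> t \<Longrightarrow> u t \<in> borel_measurable M"
  and u_square_integrable: "1 \<le> t \<Longrightarrow> integrable M (\<lambda>\<omega>. (u t \<omega>)\<^sup>2)"
  using stationary by (simp_all add: zero_mean_stationary_def)

lemma u_mult_integrable: "1 \<le> s \<Longrightarrow> 1 \<le> t \<Longrightarrow> integrable M (\<lambda>\<omega>. u s \<omega> * u t \<omega>)"
  by (intro integrable_mult_square_integrable u_measurable u_square_integrable)

lemma f_nonneg: "x \<in> {-pi..pi} \<Longrightarrow> 0 \<le> f x"
  and f_integrable: "set_integrable lborel {-pi..pi} f"
  using spectral_density by (simp_all add: has_spectral_density_def)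

lemma covariance_eq:
  assumes "1 \<le> s" "1 \<le> t"
  shows "complex_of_real (\<integral>\<omega>. u s \<omega> * u t \<omega> \<partial>M) = (LINT x|spectral_measure f. cis (of_int (s - t) * x))"
proof -
  have "complex_of_real (\<integral>\<omega>. u s \<omega> * u t \<omega> \<partial>M) =
      (CLINT x:{-pi..pi}|lborel. cis (of_int (s - t) * x) * complex_of_real (f x))"
    using spectral_density assms by (simp add: has_spectral_density_def)
  also have "\<dots> = (LINT x|spectral_measure f. cis (of_int (s - t) * x))"
    by (subst integral_spectral_measure[OF f_nonneg f_integrable])
      (auto intro!: borel_measurable_continuous_onI continuous_intros Bochner_Integration.integral_cong
        simp: set_lebesgue_integral_def scaleR_conv_of_real mult_ac)
  finally show ?thesis .
qed

text \<open>The product moment is symmetric in s and t, whereas exchanging them in the spectral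
  representation turns k into -k. The times are chosen so that both are at least 1, the range in
  which the representation is available.\<close>

lemma spectral_measure_fourier_symmetric:
  "(LINT x|spectral_measure f. cis (of_int k * x)) = (LINT x|spectral_measure f. cis (- (of_int k * x)))"
proof -
  define s t where "s = max 1 (1 + k)" and "t = s - k"
  have st: "1 \<le> s" "1 \<le> t" "s - t = k" "t - s = - k" by (auto simp: s_def t_def)
  have "(LINT x|spectral_measure f. cis (of_int (s - t) * x)) = (LINT x|spectral_measure f. cis (of_int (t - s) * x))"
    using covariance_eq[OF st(1,2)] covariance_eq[OF st(2,1)] by (simp add: mult.commute)
  then show ?thesis by (simp add: st)
qed

text \<open>Expanding the square gives a quadratic form in the covariances, and the spectral
  representation collects it into the squared modulus of a trigonometric sum. As the coefficients
  are complex, this square need not be even in x, so folding to (0, pi) leaves both signs.\<close>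

lemma expectation_norm_square_eq:
  fixes a :: "nat \<Rightarrow> complex"
  shows "(\<integral>\<omega>. (cmod (\<Sum>r=1..n. a r * u (int r) \<omega>))\<^sup>2 \<partial>M) =
    (LINT x|spectral_measure f. indicator {0<..<pi} x * ((cmod (\<Sum>r=1..n. a r * cis (real r * x)))\<^sup>2 +
      (cmod (\<Sum>r=1..n. a r * cis (real r * - x)))\<^sup>2))"
proof -
  let ?N = "spectral_measure f"
  have int: "integrable ?N (\<lambda>x. cis (of_int k * x))" for k :: int
    by (intro integrable_spectral_measure[OF f_nonneg f_integrable] continuous_intros)
  have "complex_of_real (\<integral>\<omega>. (cmod (\<Sum>r=1..n. a r * u (int r) \<omega>))\<^sup>2 \<partial>M) =
      (\<integral>\<omega>. complex_of_real ((cmod (\<Sum>r=1..n. a r * u (int r) \<omega>))\<^sup>2) \<partial>M)"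
    by (rule integral_complex_of_real[symmetric])
  also have "\<dots> = (\<integral>\<omega>. (\<Sum>r=1..n. \<Sum>s=1..n. a r * cnj (a s) * complex_of_real (u (int r) \<omega> * u (int s) \<omega>)) \<partial>M)"
    by (simp only: complex_norm_square cnj_sum sum_product) (simp add: mult_ac)
  also have "\<dots> = (\<Sum>r=1..n. \<Sum>s=1..n. a r * cnj (a s) * complex_of_real (\<integral>\<omega>. u (int r) \<omega> * u (int s) \<omega> \<partial>M))"
  proof -
    have i: "integrable M (\<lambda>\<omega>. a r * cnj (a s) * complex_of_real (u (int r) \<omega> * u (int s) \<omega>))"
      if "r \<in> {1..n}" "s \<in> {1..n}" for r s
      using u_mult_integrable[of "int r" "int s"] that by (intro integrable_mult_right integrable_of_real) auto
    then have "(\<integral>\<omega>. (\<Sum>r=1..n. \<Sum>s=1..n. a r * cnj (a s) * complex_of_real (u (int r) \<omega> * u (int s) \<omega>)) \<partial>M) =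
        (\<Sum>r=1..n. \<Sum>s=1..n. (\<integral>\<omega>. a r * cnj (a s) * complex_of_real (u (int r) \<omega> * u (int s) \<omega>) \<partial>M))"
      by (subst Bochner_Integration.integral_sum; (intro Bochner_Integration.integrable_sum sum.cong refl Bochner_Integration.integral_sum)?) auto
    then show ?thesis by (simp only: integral_mult_right_zero integral_complex_of_real)
  qed
  also have "\<dots> = (\<Sum>r=1..n. \<Sum>s=1..n. a r * cnj (a s) * (LINT x|?N. cis (of_int (int r - int s) * x)))"
    by (intro sum.cong refl arg_cong2[where f = "(*)"] covariance_eq) auto
  also have "\<dots> = (LINT x|?N. (\<Sum>r=1..n. \<Sum>s=1..n. a r * cnj (a s) * cis (of_int (int r - int s) * x)))"
    by (simp add: int integral_mult_right_zero Bochner_Integration.integral_sum del: of_int_diff)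
  also have "\<dots> = (LINT x|?N. complex_of_real ((cmod (\<Sum>r=1..n. a r * cis (real r * x)))\<^sup>2))"
    by (simp only: norm_trig_sum_square)
  also have "\<dots> = complex_of_real (LINT x|?N. (cmod (\<Sum>r=1..n. a r * cis (real r * x)))\<^sup>2)"
    by (rule integral_complex_of_real)
  finally have "(\<integral>\<omega>. (cmod (\<Sum>r=1..n. a r * u (int r) \<omega>))\<^sup>2 \<partial>M) =
      (LINT x|?N. (cmod (\<Sum>r=1..n. a r * cis (real r * x)))\<^sup>2)"
    by (simp only: of_real_eq_iff)
  also have "\<dots> = (LINT x|?N. (\<lambda>z. (cmod (\<Sum>r=1..n. a r * z ^ r))\<^sup>2) (cis x))"
    by (simp add: Complex.DeMoivre)
  also have "\<dots> = (LINT x|?N. indicator {0<..<pi} x *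
      ((\<lambda>z. (cmod (\<Sum>r=1..n. a r * z ^ r))\<^sup>2) (cis x) + (\<lambda>z. (cmod (\<Sum>r=1..n. a r * z ^ r))\<^sup>2) (cis (- x))))"
    by (rule integral_spectral_measure_half[OF f_nonneg f_integrable spectral_measure_fourier_symmetric])
      (auto intro!: continuous_intros)
  finally show ?thesis by (simp add: Complex.DeMoivre)
qed

lemma f_bounds_near_0:
  obtains \<delta> where "0 < \<delta>" "\<delta> \<le> 1" "0 < f 0" "\<And>x. 0 < x \<Longrightarrow> x < \<delta> \<Longrightarrow> f 0 / 2 \<le> f x" "\<And>x. 0 < x \<Longrightarrow> x < \<delta> \<Longrightarrow> f x \<le> 2 * f 0"
proof -
  have f0: "0 < f 0" and eq: "f \<sim>[at_right 0] (\<lambda>_. f 0)"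
    using spectral_density_at_0 by (auto simp: assumption1_def)
  then have lim: "(f \<longlongrightarrow> f 0) (at_right 0)"
    using tendsto_asymp_equiv_cong[OF eq] by simp
  have "\<forall>\<^sub>F x in at_right 0. f 0 / 2 < f x \<and> f x < 2 * f 0"
    using order_tendstoD(1)[OF lim, of "f 0 / 2"] order_tendstoD(2)[OF lim, of "2 * f 0"] f0
    by (auto intro: eventually_conj)
  then obtain b where b: "0 < b" "\<And>x. 0 < x \<Longrightarrow> x < b \<Longrightarrow> f 0 / 2 < f x \<and> f x < 2 * f 0"
    by (auto simp: eventually_at_right_field)
  show ?thesis
    by (rule that[of "min b 1"]) (use b f0 in \<open>auto intro: less_imp_le\<close>)
qed

text \<open>Near the origin the spectral density is bounded and Parseval applies; elsewhere it is merely
  integrable, and one needs a uniform bound for the trigonometric sum.\<close>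

lemma expectation_norm_square_upper:
  "\<exists>C \<delta>. 0 < C \<and> 0 < \<delta> \<and> \<delta> \<le> 1 \<and>
    (\<forall>n (a :: nat \<Rightarrow> complex) B. (\<forall>x. \<delta> \<le> \<bar>x\<bar> \<longrightarrow> \<bar>x\<bar> \<le> pi \<longrightarrow> cmod (\<Sum>r=1..n. a r * cis (real r * x)) \<le> B) \<longrightarrow>
      (\<integral>\<omega>. (cmod (\<Sum>r=1..n. a r * u (int r) \<omega>))\<^sup>2 \<partial>M) \<le> C * ((\<Sum>r=1..n. (cmod (a r))\<^sup>2) + B\<^sup>2))"
proof -
  let ?N = "spectral_measure f"
  interpret N: finite_measure ?N by (rule finite_spectral_measure[OF f_nonneg f_integrable])
  obtain \<delta> where \<delta>: "0 < \<delta>" "\<delta> \<le> 1" "0 < f 0" "\<And>x. 0 < x \<Longrightarrow> x < \<delta> \<Longrightarrow> f x \<le> 2 * f 0"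
    using f_bounds_near_0 by metis
  \<comment> \<open>The first part is the bound 2 f(0) for the density times two Parseval integrals,
    each 2 pi times the sum of squares; the second is the bound 2 B^2 integrated over the whole
    spectral measure.\<close>
  define C where "C = 8 * pi * f 0 + 2 * measure ?N UNIV"
  have C: "0 < C" using \<delta> by (simp add: C_def add_pos_nonneg)
  show ?thesis
  proof (rule exI[of _ C], rule exI[of _ \<delta>], intro conjI allI impI C \<delta>(1,2))
    fix n and a :: "nat \<Rightarrow> complex" and B
    assume B: "\<forall>x. \<delta> \<le> \<bar>x\<bar> \<longrightarrow> \<bar>x\<bar> \<le> pi \<longrightarrow> cmod (\<Sum>r=1..n. a r * cis (real r * x)) \<le> B"
    define A where "A x = (cmod (\<Sum>r=1..n. a r * cis (real r * x)))\<^sup>2" for x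
    have A_cont: "continuous_on UNIV A" "continuous_on UNIV (\<lambda>x. A (- x))"
      unfolding A_def by (auto intro!: continuous_intros)
    have A_meas [measurable]: "A \<in> borel_measurable borel" by (rule borel_measurable_continuous_onI[OF A_cont(1)])
    have A_nonneg: "0 \<le> A x" for x by (simp add: A_def)
    have A_int: "integrable lborel (\<lambda>x. indicator {-pi..pi} x * A x)" "integrable lborel (\<lambda>x. indicator {-pi..pi} x * A (- x))"
      using borel_integrable_compact[of "{-pi..pi}" A] borel_integrable_compact[of "{-pi..pi}" "\<lambda>x. A (- x)"]
        A_cont[THEN continuous_on_subset] by auto
    have A_total: "(LINT x|lborel. indicator {-pi..pi} x * A x) = 2 * pi * (\<Sum>r=1..n. (cmod (a r))\<^sup>2)"
      unfolding A_def by (rule integral_norm_trig_sum_square) simp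
    \<comment> \<open>Reflection of x amounts, up to an overall conjugation, to conjugating the
      coefficients, which leaves the Parseval sum unchanged.\<close>
    have A_refl: "A (- x) = (cmod (\<Sum>r=1..n. cnj (a r) * cis (real r * x)))\<^sup>2" for x
    proof -
      have "cnj (\<Sum>r=1..n. a r * cis (real r * - x)) = (\<Sum>r=1..n. cnj (a r) * cis (real r * x))"
        by (simp add: cis_cnj)
      then show ?thesis unfolding A_def by (metis complex_mod_cnj)
    qed
    have A_total': "(LINT x|lborel. indicator {-pi..pi} x * A (- x)) = 2 * pi * (\<Sum>r=1..n. (cmod (a r))\<^sup>2)"
      unfolding A_refl by (subst integral_norm_trig_sum_square) simp_all
    have near_int: "integrable ?N (\<lambda>x. indicator {0<..<\<delta>} x * (A x + A (- x)))"
      by (rule Bochner_Integration.integrable_bound[OF integrable_spectral_measure[OF f_nonneg f_integrable, of "\<lambda>x. A x + A (- x)"]])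
        (auto simp: indicator_def A_nonneg add_nonneg_nonneg intro!: continuous_intros A_cont)
    have "(\<integral>\<omega>. (cmod (\<Sum>r=1..n. a r * u (int r) \<omega>))\<^sup>2 \<partial>M) = (LINT x|?N. indicator {0<..<pi} x * (A x + A (- x)))"
      unfolding A_def by (rule expectation_norm_square_eq)
    also have "\<dots> \<le> (LINT x|?N. indicator {0<..<\<delta>} x * (A x + A (- x)) + 2 * B\<^sup>2)"
    proof (rule integral_mono)
      fix x
      have "A x \<le> B\<^sup>2 \<and> A (- x) \<le> B\<^sup>2" if "\<delta> \<le> x" "x < pi"
        unfolding A_def using B[rule_format, of x] B[rule_format, of "- x"] that \<delta>(1) by (auto intro!: power_mono)
      moreover have "0 \<le> A x + A (- x)" by (simp add: A_nonneg)
      ultimately show "indicator {0<..<pi} x * (A x + A (- x)) \<le> indicator {0<..<\<delta>} x * (A x + A (- x)) + 2 * B\<^sup>2"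
        by (auto simp: indicator_def)
    next
      show "integrable ?N (\<lambda>x. indicator {0<..<pi} x * (A x + A (- x)))"
        by (rule Bochner_Integration.integrable_bound[OF integrable_spectral_measure[OF f_nonneg f_integrable, of "\<lambda>x. A x + A (- x)"]])
          (auto simp: indicator_def A_nonneg add_nonneg_nonneg intro!: continuous_intros A_cont)
    qed (use near_int in simp)
    also have "\<dots> = (LINT x|?N. indicator {0<..<\<delta>} x * (A x + A (- x))) + 2 * measure ?N UNIV * B\<^sup>2"
      using near_int by simp
    also have "(LINT x|?N. indicator {0<..<\<delta>} x * (A x + A (- x))) =
        (LINT x|lborel. (indicator {-pi..pi} x * f x) * (indicator {0<..<\<delta>} x * (A x + A (- x))))"
      by (subst integral_spectral_measure[OF f_nonneg f_integrable]) auto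
    also have "\<dots> \<le> (LINT x|lborel. 2 * f 0 * (indicator {-pi..pi} x * A x + indicator {-pi..pi} x * A (- x)))"
    proof (rule integral_mono')
      show "integrable lborel (\<lambda>x. 2 * f 0 * (indicator {-pi..pi} x * A x + indicator {-pi..pi} x * A (- x)))"
        using A_int by simp
      show "(indicator {-pi..pi} x * f x) * (indicator {0<..<\<delta>} x * (A x + A (- x))) \<le>
          2 * f 0 * (indicator {-pi..pi} x * A x + indicator {-pi..pi} x * A (- x))" for x
        using \<delta>(3) \<delta>(4)[of x] A_nonneg[of x] A_nonneg[of "- x"]
        by (auto simp: indicator_def distrib_left[symmetric] intro!: mult_right_mono)
      show "0 \<le> 2 * f 0 * (indicator {-pi..pi} x * A x + indicator {-pi..pi} x * A (- x))" for x
        using \<delta>(3) A_nonneg by (auto simp: indicator_def add_nonneg_nonneg)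
    qed
    also have "\<dots> = 8 * pi * f 0 * (\<Sum>r=1..n. (cmod (a r))\<^sup>2)"
      using A_int by (simp add: A_total A_total')
    also have "8 * pi * f 0 * (\<Sum>r=1..n. (cmod (a r))\<^sup>2) + 2 * measure ?N UNIV * B\<^sup>2 \<le> C * ((\<Sum>r=1..n. (cmod (a r))\<^sup>2) + B\<^sup>2)"
      unfolding C_def distrib_left
      by (intro add_mono mult_right_mono) (use \<delta>(3) in \<open>auto intro!: sum_nonneg\<close>)
    finally show "(\<integral>\<omega>. (cmod (\<Sum>r=1..n. a r * u (int r) \<omega>))\<^sup>2 \<partial>M) \<le> C * ((\<Sum>r=1..n. (cmod (a r))\<^sup>2) + B\<^sup>2)"
      by simp
  qed
qed

text \<open>For 0 < x < 1 / n and r \<le> n all phases r x stay below pi / 3, so nonnegative weights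
  cannot cancel and the trigonometric sum is at least half of their total. Integrating
  \<open>f 0 / 2\<close> times a quarter of the squared total over an interval of length 1 / n
  yields the constant \<open>f 0 / 8\<close>.\<close>

lemma expectation_square_lower:
  obtains c where "0 < c"
    "\<forall>\<^sub>F n in sequentially. \<forall>a :: nat \<Rightarrow> real. (\<forall>r. 0 \<le> a r) \<longrightarrow>
      c / real n * (\<Sum>r=1..n. a r)\<^sup>2 \<le> (\<integral>\<omega>. (\<Sum>r=1..n. a r * u (int r) \<omega>)\<^sup>2 \<partial>M)"
proof -
  let ?N = "spectral_measure f"
  obtain \<delta> where \<delta>: "0 < \<delta>" "\<delta> \<le> 1" "0 < f 0" "\<And>x. 0 < x \<Longrightarrow> x < \<delta> \<Longrightarrow> f 0 / 2 \<le> f x"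
    using f_bounds_near_0 by metis
  have "\<forall>\<^sub>F n in sequentially. 1 / real n < \<delta>"
    using \<delta>(1) by real_asymp
  then have "\<forall>\<^sub>F n in sequentially. \<forall>a :: nat \<Rightarrow> real. (\<forall>r. 0 \<le> a r) \<longrightarrow>
      (f 0 / 8) / real n * (\<Sum>r=1..n. a r)\<^sup>2 \<le> (\<integral>\<omega>. (\<Sum>r=1..n. a r * u (int r) \<omega>)\<^sup>2 \<partial>M)"
    using eventually_gt_at_top[of 0]
  proof eventually_elim
    case (elim n)
    show ?case
    proof (intro allI impI)
      fix a :: "nat \<Rightarrow> real" assume a: "\<forall>r. 0 \<le> a r"
      define S where "S = (\<Sum>r=1..n. a r)"
      define A where "A x = (cmod (\<Sum>r=1..n. complex_of_real (a r) * cis (real r * x)))\<^sup>2" for x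
      have S: "0 \<le> S" using a by (simp add: S_def sum_nonneg)
      have A_cont: "continuous_on UNIV A" "continuous_on UNIV (\<lambda>x. A (- x))"
        unfolding A_def by (auto intro!: continuous_intros)
      have A_meas [measurable]: "A \<in> borel_measurable borel" by (rule borel_measurable_continuous_onI[OF A_cont(1)])
      have A_nonneg: "0 \<le> A x" for x by (simp add: A_def)
      have A_lower: "S\<^sup>2 / 4 \<le> A x" if x: "0 < x" "x < 1 / real n" for x
      proof -
        have "S / 2 = (\<Sum>r=1..n. a r * (1 / 2))" by (simp add: S_def sum_divide_distrib)
        also have "\<dots> \<le> (\<Sum>r=1..n. a r * cos (real r * x))"
        proof (intro sum_mono mult_left_mono)
          fix r assume r: "r \<in> {1..n}"
          have "real r * x \<le> real n * (1 / real n)" using r x by (intro mult_mono) auto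
          then have "real r * x \<le> pi / 3" using elim pi_gt3 by simp
          then have "cos (pi / 3) \<le> cos (real r * x)" using r x by (intro cos_monotone_0_pi_le) auto
          then show "1 / 2 \<le> cos (real r * x)" by (simp add: cos_60)
        qed (use a in auto)
        also have "\<dots> = Re (\<Sum>r=1..n. complex_of_real (a r) * cis (real r * x))" by simp
        also have "\<dots> \<le> cmod (\<Sum>r=1..n. complex_of_real (a r) * cis (real r * x))" by (rule complex_Re_le_cmod)
        finally have "(S / 2)\<^sup>2 \<le> A x" unfolding A_def using S by (intro power_mono) auto
        then show ?thesis by (simp add: power_divide)
      qed
      have int: "integrable ?N (\<lambda>x. indicator {0<..<pi} x * (A x + A (- x)))"
        by (rule Bochner_Integration.integrable_bound[OF integrable_spectral_measure[OF f_nonneg f_integrable, of "\<lambda>x. A x + A (- x)"]])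
          (auto simp: indicator_def A_nonneg add_nonneg_nonneg intro!: continuous_intros A_cont)
      have "f 0 / 8 / real n * S\<^sup>2 = (LINT x|lborel. f 0 / 2 * (S\<^sup>2 / 4) * indicator {0<..<1 / real n} x)"
        using elim by simp
      also have "\<dots> \<le> (LINT x|lborel. (indicator {-pi..pi} x * f x) * (indicator {0<..<pi} x * (A x + A (- x))))"
      proof (rule integral_mono)
        show "integrable lborel (\<lambda>x. (indicator {-pi..pi} x * f x) * (indicator {0<..<pi} x * (A x + A (- x))))"
          using int spectral_density_measurable[OF f_nonneg f_integrable] spectral_density_nonneg[OF f_nonneg f_integrable]
          unfolding spectral_measure_def by (subst (asm) integrable_real_density) auto
        fix x :: real
        show "f 0 / 2 * (S\<^sup>2 / 4) * indicator {0<..<1 / real n} x \<le>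
            (indicator {-pi..pi} x * f x) * (indicator {0<..<pi} x * (A x + A (- x)))"
        proof (cases "x \<in> {0<..<1 / real n}")
          case True
          then have x: "0 < x" "x < 1 / real n" "x < \<delta>" "x < pi" "- pi \<le> x" using elim \<delta>(2) pi_gt3 by auto
          have "f 0 / 2 * (S\<^sup>2 / 4) \<le> f x * (A x + A (- x))"
            using \<delta>(3) \<delta>(4)[of x] f_nonneg[of x] x A_lower[OF x(1,2)] A_nonneg[of "- x"] by (intro mult_mono) auto
          then show ?thesis using True x by (simp add: indicator_def)
        next
          case False
          then show ?thesis using f_nonneg[of x] A_nonneg by (auto simp: indicator_def add_nonneg_nonneg)
        qed
      qed (use elim in auto)
      also have "\<dots> = (LINT x|?N. indicator {0<..<pi} x * (A x + A (- x)))"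
        by (subst integral_spectral_measure[OF f_nonneg f_integrable]) auto
      also have "\<dots> = (\<integral>\<omega>. (cmod (\<Sum>r=1..n. complex_of_real (a r) * u (int r) \<omega>))\<^sup>2 \<partial>M)"
        unfolding A_def by (rule expectation_norm_square_eq[symmetric])
      also have "\<dots> = (\<integral>\<omega>. (\<Sum>r=1..n. a r * u (int r) \<omega>)\<^sup>2 \<partial>M)"
        by (simp only: of_real_mult[symmetric] of_real_sum[symmetric] norm_of_real power2_abs)
      finally show "f 0 / 8 / real n * (\<Sum>r=1..n. a r)\<^sup>2 \<le> (\<integral>\<omega>. (\<Sum>r=1..n. a r * u (int r) \<omega>)\<^sup>2 \<partial>M)"
        by (simp add: S_def)
    qed
  qed
  then show ?thesis using that[of "f 0 / 8"] \<delta>(3) by simp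
qed

end

section \<open>Martingale differences and anticoncentration\<close>

text \<open>Dominate the indicator of an interval by a Gaussian, and write the Gaussian as its own Fourier
  transform.\<close>

lemma (in prob_space) prob_abs_le_char_bound:
  assumes [measurable]: "Y \<in> borel_measurable M" and \<eta>: "0 < \<eta>"
  shows "prob {\<omega> \<in> space M. \<bar>Y \<omega>\<bar> \<le> \<eta>} \<le>
    exp (1 / 2) * (LINT t|std_normal_distribution. cmod (CLINT \<omega>|M. iexp (t / \<eta> * Y \<omega>)))"
proof -
  let ?N = std_normal_distribution
  interpret N: real_distribution ?N by (rule real_dist_normal_dist)
  interpret P: pair_prob_space ?N M ..
  have gauss: "complex_of_real (exp (- ((Y \<omega> / \<eta>)\<^sup>2 / 2))) = (CLINT t|?N. iexp (t / \<eta> * Y \<omega>))" for \<omega>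
    using fun_cong[OF char_std_normal_distribution, of "Y \<omega> / \<eta>"] by (simp add: char_def mult_ac)
  have int: "integrable (?N \<Otimes>\<^sub>M M) (\<lambda>(t, \<omega>). iexp (t / \<eta> * Y \<omega>))"
    by (rule P.integrable_const_bound[where B = 1]) (auto simp: split_beta)
  have "prob {\<omega> \<in> space M. \<bar>Y \<omega>\<bar> \<le> \<eta>} = (\<integral>\<omega>. indicator {\<omega> \<in> space M. \<bar>Y \<omega>\<bar> \<le> \<eta>} \<omega> \<partial>M)"
    by simp
  also have "\<dots> \<le> (\<integral>\<omega>. exp (1 / 2) * exp (- ((Y \<omega> / \<eta>)\<^sup>2 / 2)) \<partial>M)"
  proof (rule integral_mono)
    show "integrable M (\<lambda>\<omega>. exp (1 / 2) * exp (- ((Y \<omega> / \<eta>)\<^sup>2 / 2)))"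
      by (rule integrable_mult_right, rule integrable_const_bound[where B = 1]) auto
    show "indicator {\<omega> \<in> space M. \<bar>Y \<omega>\<bar> \<le> \<eta>} \<omega> \<le> exp (1 / 2) * exp (- ((Y \<omega> / \<eta>)\<^sup>2 / 2))" for \<omega>
    proof (cases "\<bar>Y \<omega>\<bar> \<le> \<eta>")
      case True
      then have "\<bar>Y \<omega> / \<eta>\<bar> \<le> 1" using \<eta> by (simp add: abs_div_pos[symmetric])
      then have "(Y \<omega> / \<eta>)\<^sup>2 \<le> 1" by (simp add: abs_square_le_1)
      then have "1 \<le> exp (1 / 2 + - ((Y \<omega> / \<eta>)\<^sup>2 / 2))" by simp
      then show ?thesis unfolding exp_add by (auto simp: indicator_def)
    qed (auto simp: indicator_def)
    show "integrable M (indicator {\<omega> \<in> space M. \<bar>Y \<omega>\<bar> \<le> \<eta>} :: 'a \<Rightarrow> real)"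
      by (rule integrable_const_bound[where B = 1]) auto
  qed
  also have "\<dots> = exp (1 / 2) * (\<integral>\<omega>. exp (- ((Y \<omega> / \<eta>)\<^sup>2 / 2)) \<partial>M)" by simp
  also have "(\<integral>\<omega>. exp (- ((Y \<omega> / \<eta>)\<^sup>2 / 2)) \<partial>M) \<le> cmod (CLINT \<omega>|M. complex_of_real (exp (- ((Y \<omega> / \<eta>)\<^sup>2 / 2))))"
    unfolding integral_complex_of_real by simp
  also have "(CLINT \<omega>|M. complex_of_real (exp (- ((Y \<omega> / \<eta>)\<^sup>2 / 2)))) = (CLINT t|?N. CLINT \<omega>|M. iexp (t / \<eta> * Y \<omega>))"
    unfolding gauss by (rule P.Fubini_integral[OF int])
  also have "cmod \<dots> \<le> (LINT t|?N. cmod (CLINT \<omega>|M. iexp (t / \<eta> * Y \<omega>)))"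
    by (rule integral_norm_bound)
  finally show ?thesis by (simp add: mult_left_mono)
qed

text \<open>For t \<noteq> 0 the integrand tends to 0, and t = 0 is a null set. The average is the
  smoothing bound of a standard Gaussian at scale 1 / k.\<close>

lemma gaussian_average_tendsto_0:
  "(\<lambda>k. LINT t|std_normal_distribution. exp (- ((t * real k)\<^sup>2 / 2))) \<longlonglongrightarrow> 0"
proof -
  let ?N = std_normal_distribution
  interpret N: real_distribution ?N by (rule real_dist_normal_dist)
  have "(\<lambda>k. LINT t|?N. exp (- ((t * real k)\<^sup>2 / 2))) \<longlonglongrightarrow> (LINT t|?N. 0)"
  proof (rule integral_dominated_convergence[where w = "\<lambda>_. 1"])
    have "AE t in ?N. t \<noteq> 0"
    proof -
      have "AE t in lborel. t \<noteq> (0::real)" by (rule AE_lborel_singleton)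
      then show ?thesis by (subst AE_density) (auto elim: eventually_mono)
    qed
    then show "AE t in ?N. (\<lambda>k. exp (- ((t * real k)\<^sup>2 / 2))) \<longlonglongrightarrow> 0"
    proof eventually_elim
      case (elim t)
      then have "0 < t\<^sup>2" by simp
      then have "(\<lambda>k. exp (- (t\<^sup>2 * (real k)\<^sup>2 / 2))) \<longlonglongrightarrow> 0" by real_asymp
      then show ?case by (simp add: power_mult_distrib)
    qed
  qed auto
  then show ?thesis by simp
qed

text \<open>The smoothing bound involves only moduli of characteristic functions, which a shift by b
  does not change; this is the source of the uniformity in b. At scale 1 / k the bound tends, by
  dominated convergence, to a Gaussian average that is small for a suitable k.\<close>

lemma (in prob_space) anticoncentration_of_char_tendsto_gaussian:
  assumes meas [measurable]: "\<And>n. S n \<in> borel_measurable M"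
    and lim: "\<And>t. (\<lambda>n. CLINT \<omega>|M. iexp (t * S n \<omega>)) \<longlonglongrightarrow> complex_of_real (exp (- (t\<^sup>2 / 2)))"
    and e: "0 < e"
  obtains \<eta> where "0 < \<eta>" "\<forall>\<^sub>F n in sequentially. \<forall>b. prob {\<omega> \<in> space M. \<bar>S n \<omega> + b\<bar> \<le> \<eta>} < e"
proof -
  let ?N = std_normal_distribution
  interpret N: real_distribution ?N by (rule real_dist_normal_dist)
  have "(\<lambda>k. exp (1 / 2) * (LINT t|?N. exp (- ((t * real k)\<^sup>2 / 2)))) \<longlonglongrightarrow> exp (1 / 2) * 0"
    by (intro tendsto_intros gaussian_average_tendsto_0)
  then have "\<forall>\<^sub>F k in sequentially. exp (1 / 2) * (LINT t|?N. exp (- ((t * real k)\<^sup>2 / 2))) < e"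
    using e by (intro order_tendstoD(2)) auto
  then have "\<forall>\<^sub>F k in sequentially. exp (1 / 2) * (LINT t|?N. exp (- ((t * real k)\<^sup>2 / 2))) < e \<and> 0 < k"
    using eventually_gt_at_top[of 0] by eventually_elim simp
  then obtain k where k: "exp (1 / 2) * (LINT t|?N. exp (- ((t * real k)\<^sup>2 / 2))) < e" "0 < k"
    by (auto simp: eventually_sequentially)
  have "(\<lambda>n. LINT t|?N. cmod (CLINT \<omega>|M. iexp (t * real k * S n \<omega>))) \<longlonglongrightarrow> (LINT t|?N. exp (- ((t * real k)\<^sup>2 / 2)))"
  proof (rule integral_dominated_convergence[where w = "\<lambda>_. 1"])
    show "AE t in ?N. (\<lambda>n. cmod (CLINT \<omega>|M. iexp (t * real k * S n \<omega>))) \<longlonglongrightarrow> exp (- ((t * real k)\<^sup>2 / 2))"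
    proof (rule AE_I2)
      fix t
      show "(\<lambda>n. cmod (CLINT \<omega>|M. iexp (t * real k * S n \<omega>))) \<longlonglongrightarrow> exp (- ((t * real k)\<^sup>2 / 2))"
        using tendsto_norm[OF lim[of "t * real k"]] by (simp only: norm_of_real abs_exp_cancel)
    qed
    show "AE t in ?N. norm (cmod (CLINT \<omega>|M. iexp (t * real k * S n \<omega>))) \<le> 1" for n
    proof (rule AE_I2)
      fix t
      have "cmod (CLINT \<omega>|M. iexp (t * real k * S n \<omega>)) \<le> (LINT \<omega>|M. cmod (iexp (t * real k * S n \<omega>)))"
        by (rule integral_norm_bound)
      then show "norm (cmod (CLINT \<omega>|M. iexp (t * real k * S n \<omega>))) \<le> 1" by (simp add: prob_space)
    qed
  qed auto
  then have "(\<lambda>n. exp (1 / 2) * (LINT t|?N. cmod (CLINT \<omega>|M. iexp (t * real k * S n \<omega>)))) \<longlonglongrightarrow>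
      exp (1 / 2) * (LINT t|?N. exp (- ((t * real k)\<^sup>2 / 2)))"
    by (intro tendsto_intros)
  then have ev: "\<forall>\<^sub>F n in sequentially. exp (1 / 2) * (LINT t|?N. cmod (CLINT \<omega>|M. iexp (t * real k * S n \<omega>))) < e"
    using k(1) by (rule order_tendstoD(2))
  show ?thesis
  proof (rule that[of "1 / real k"])
    show "\<forall>\<^sub>F n in sequentially. \<forall>b. prob {\<omega> \<in> space M. \<bar>S n \<omega> + b\<bar> \<le> 1 / real k} < e"
      using ev
    proof eventually_elim
      case (elim n)
      show ?case
      proof
        fix b
        have mod: "cmod (CLINT \<omega>|M. iexp (t / (1 / real k) * (S n \<omega> + b))) = cmod (CLINT \<omega>|M. iexp (t * real k * S n \<omega>))" for t
        proof -
          have "iexp (t / (1 / real k) * (S n \<omega> + b)) = iexp (t * real k * b) * iexp (t * real k * S n \<omega>)" for \<omega>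
            by (simp add: exp_add[symmetric] algebra_simps)
          then have "(CLINT \<omega>|M. iexp (t / (1 / real k) * (S n \<omega> + b))) = iexp (t * real k * b) * (CLINT \<omega>|M. iexp (t * real k * S n \<omega>))"
            by (simp only: integral_mult_right_zero)
          then show ?thesis by (simp only: norm_mult norm_exp_i_times mult_1_left)
        qed
        have "prob {\<omega> \<in> space M. \<bar>S n \<omega> + b\<bar> \<le> 1 / real k} \<le>
            exp (1 / 2) * (LINT t|?N. cmod (CLINT \<omega>|M. iexp (t / (1 / real k) * (S n \<omega> + b))))"
          by (rule prob_abs_le_char_bound) (use k in auto)
        also have "\<dots> < e" unfolding mod by (rule elim)
        finally show "prob {\<omega> \<in> space M. \<bar>S n \<omega> + b\<bar> \<le> 1 / real k} < e" .
      qed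
    qed
  qed (use k in simp)
qed

section \<open>Uniform square integrability of the innovations\<close>

definition tail_square :: "real \<Rightarrow> real \<Rightarrow> real" where
  "tail_square L x = (if L < \<bar>x\<bar> then x\<^sup>2 else 0)"

lemma tail_square_measurable [measurable]: "tail_square L \<in> borel_measurable borel"
  unfolding tail_square_def by measurable

lemma tail_square_bounds: "0 \<le> tail_square L x" "tail_square L x \<le> x\<^sup>2"
  by (simp_all add: tail_square_def)

text \<open>The layer-cake formula turns a comparison of tail probabilities into one of truncated second
  moments.\<close>

lemma (in prob_space) nn_integral_tail_square:
  assumes [measurable]: "X \<in> borel_measurable M" and L: "0 < L"
  shows "(\<integral>\<^sup>+\<omega>. ennreal (tail_square L (X \<omega>)) \<partial>M) =
    (\<integral>\<^sup>+y. indicator {0..} y * emeasure M {\<omega> \<in> space M. max L (sqrt y) < \<bar>X \<omega>\<bar>} \<partial>lborel)"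
proof -
  interpret P: pair_sigma_finite M lborel ..
  define h :: "'a \<Rightarrow> real \<Rightarrow> ennreal" where "h \<omega> y = indicator {0..} y * (if max L (sqrt y) < \<bar>X \<omega>\<bar> then 1 else 0)" for \<omega> y
  have h_meas: "case_prod h \<in> borel_measurable (M \<Otimes>\<^sub>M lborel)"
    unfolding h_def split_beta by measurable
  have inner: "ennreal (tail_square L (X \<omega>)) = (\<integral>\<^sup>+y. h \<omega> y \<partial>lborel)" for \<omega>
  proof (cases "L < \<bar>X \<omega>\<bar>")
    case True
    have "sqrt y < \<bar>X \<omega>\<bar> \<longleftrightarrow> y < (X \<omega>)\<^sup>2" if "0 \<le> y" for y
      using that real_sqrt_less_iff[of y "(X \<omega>)\<^sup>2"] by simp
    then have "h \<omega> y = indicator {0..<(X \<omega>)\<^sup>2} y" for y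
      using True by (auto simp: h_def indicator_def)
    then have "(\<integral>\<^sup>+y. h \<omega> y \<partial>lborel) = (\<integral>\<^sup>+y. indicator {0..<(X \<omega>)\<^sup>2} y \<partial>lborel)" by simp
    also have "\<dots> = ennreal ((X \<omega>)\<^sup>2)" by (subst nn_integral_indicator) auto
    finally show ?thesis using True by (simp add: tail_square_def)
  next
    case False
    then have "h \<omega> = (\<lambda>y. 0)" by (auto simp: h_def)
    then show ?thesis using False by (simp add: tail_square_def)
  qed
  have "(\<integral>\<^sup>+\<omega>. ennreal (tail_square L (X \<omega>)) \<partial>M) = (\<integral>\<^sup>+y. (\<integral>\<^sup>+\<omega>. h \<omega> y \<partial>M) \<partial>lborel)"
    unfolding inner by (rule P.Fubini'[OF h_meas, symmetric])
  also have "\<dots> = (\<integral>\<^sup>+y. indicator {0..} y * emeasure M {\<omega> \<in> space M. max L (sqrt y) < \<bar>X \<omega>\<bar>} \<partial>lborel)"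
  proof (rule nn_integral_cong)
    fix y :: real
    have "(\<integral>\<^sup>+\<omega>. h \<omega> y \<partial>M) = (\<integral>\<^sup>+\<omega>. indicator {0..} y * indicator {\<omega> \<in> space M. max L (sqrt y) < \<bar>X \<omega>\<bar>} \<omega> \<partial>M)"
      by (intro nn_integral_cong) (auto simp: h_def indicator_def)
    also have "\<dots> = indicator {0..} y * emeasure M {\<omega> \<in> space M. max L (sqrt y) < \<bar>X \<omega>\<bar>}"
      by (subst nn_integral_cmult_indicator) auto
    finally show "(\<integral>\<^sup>+\<omega>. h \<omega> y \<partial>M) = indicator {0..} y * emeasure M {\<omega> \<in> space M. max L (sqrt y) < \<bar>X \<omega>\<bar>}" .
  qed
  finally show ?thesis .
qed

lemma (in prob_space) expectation_tail_square_tendsto_0: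
  assumes [measurable]: "Z \<in> borel_measurable M" and "integrable M (\<lambda>\<omega>. (Z \<omega>)\<^sup>2)"
  shows "(\<lambda>k. \<integral>\<omega>. tail_square (real k) (Z \<omega>) \<partial>M) \<longlonglongrightarrow> 0"
proof -
  have "(\<lambda>k. \<integral>\<omega>. tail_square (real k) (Z \<omega>) \<partial>M) \<longlonglongrightarrow> (\<integral>\<omega>. 0 \<partial>M)"
  proof (rule integral_dominated_convergence[where w = "\<lambda>\<omega>. (Z \<omega>)\<^sup>2"])
    show "AE \<omega> in M. (\<lambda>k. tail_square (real k) (Z \<omega>)) \<longlonglongrightarrow> 0"
    proof (rule AE_I2)
      fix \<omega>
      show "(\<lambda>k. tail_square (real k) (Z \<omega>)) \<longlonglongrightarrow> 0"
      proof (rule tendsto_eventually, rule eventually_sequentiallyI[of "nat \<lceil>\<bar>Z \<omega>\<bar>\<rceil>"])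
        fix k assume "nat \<lceil>\<bar>Z \<omega>\<bar>\<rceil> \<le> k"
        then have "\<bar>Z \<omega>\<bar> \<le> real k" by linarith
        then show "tail_square (real k) (Z \<omega>) = 0" by (simp add: tail_square_def)
      qed
    qed
  qed (use assms tail_square_bounds in auto)
  then show ?thesis by simp
qed

text \<open>Through the layer-cake formula the tail comparison with a single square-integrable
  variable passes to truncated second moments with the factor \<open>K\<close>, so one level
  \<open>L\<close> serves all times t.\<close>

lemma (in prob_space) uniformly_dominated_imp_uniformly_square_integrable:
  assumes meas: "\<And>t. \<epsilon> t \<in> borel_measurable M" and sq: "\<And>t. integrable M (\<lambda>\<omega>. (\<epsilon> t \<omega>)\<^sup>2)"
    and dom: "uniformly_dominated M \<epsilon>" and e: "0 < e"
  obtains L where "0 < L" "\<And>t. (\<integral>\<omega>. tail_square L (\<epsilon> t \<omega>) \<partial>M) \<le> e"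
proof -
  note [measurable] = meas
  obtain Z K where Z [measurable]: "Z \<in> borel_measurable M" and Z_sq: "integrable M (\<lambda>\<omega>. (Z \<omega>)\<^sup>2)" and K: "0 < K"
    and tails: "\<And>t \<eta>. 0 < \<eta> \<Longrightarrow> prob {\<omega> \<in> space M. \<eta> < \<bar>\<epsilon> t \<omega>\<bar>} \<le> K * prob {\<omega> \<in> space M. \<eta> < \<bar>Z \<omega>\<bar>}"
    using dom by (auto simp: uniformly_dominated_def)
  have "(\<lambda>k. K * (\<integral>\<omega>. tail_square (real k) (Z \<omega>) \<partial>M)) \<longlonglongrightarrow> K * 0"
    by (intro tendsto_intros expectation_tail_square_tendsto_0[OF Z Z_sq])
  then have "\<forall>\<^sub>F k in sequentially. K * (\<integral>\<omega>. tail_square (real k) (Z \<omega>) \<partial>M) < e"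
    using e by (intro order_tendstoD(2)) auto
  then have "\<forall>\<^sub>F k in sequentially. K * (\<integral>\<omega>. tail_square (real k) (Z \<omega>) \<partial>M) < e \<and> 0 < k"
    using eventually_gt_at_top[of 0] by eventually_elim simp
  then obtain k where k: "K * (\<integral>\<omega>. tail_square (real k) (Z \<omega>) \<partial>M) < e" "0 < k"
    by (auto simp: eventually_sequentially)
  have tail_int: "integrable M (\<lambda>\<omega>. tail_square L (X \<omega>))"
    if "X \<in> borel_measurable M" "integrable M (\<lambda>\<omega>. (X \<omega>)\<^sup>2)" for L X
    by (rule Bochner_Integration.integrable_bound[OF that(2)]) (use that(1) tail_square_bounds in \<open>auto simp: abs_of_nonneg\<close>)
  show ?thesis
  proof (rule that[of "real k"])
    fix t
    have "ennreal (\<integral>\<omega>. tail_square (real k) (\<epsilon> t \<omega>) \<partial>M) = (\<integral>\<^sup>+\<omega>. ennreal (tail_square (real k) (\<epsilon> t \<omega>)) \<partial>M)"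
      by (intro nn_integral_eq_integral[symmetric] tail_int meas sq) (simp add: tail_square_bounds)
    also have "\<dots> = (\<integral>\<^sup>+y. indicator {0..} y * emeasure M {\<omega> \<in> space M. max (real k) (sqrt y) < \<bar>\<epsilon> t \<omega>\<bar>} \<partial>lborel)"
      by (rule nn_integral_tail_square) (use k in auto)
    also have "\<dots> \<le> (\<integral>\<^sup>+y. ennreal K * (indicator {0..} y * emeasure M {\<omega> \<in> space M. max (real k) (sqrt y) < \<bar>Z \<omega>\<bar>}) \<partial>lborel)"
    proof (rule nn_integral_mono)
      fix y :: real
      have "0 < max (real k) (sqrt y)" using k by simp
      from tails[OF this, of t]
      have "emeasure M {\<omega> \<in> space M. max (real k) (sqrt y) < \<bar>\<epsilon> t \<omega>\<bar>} \<le> ennreal K * emeasure M {\<omega> \<in> space M. max (real k) (sqrt y) < \<bar>Z \<omega>\<bar>}"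
        using K by (simp add: emeasure_eq_measure ennreal_mult[symmetric] ennreal_leI del: max_less_iff_conj)
      then show "indicator {0..} y * emeasure M {\<omega> \<in> space M. max (real k) (sqrt y) < \<bar>\<epsilon> t \<omega>\<bar>} \<le>
          ennreal K * (indicator {0..} y * emeasure M {\<omega> \<in> space M. max (real k) (sqrt y) < \<bar>Z \<omega>\<bar>})"
        by (simp add: indicator_def)
    qed
    also have "\<dots> = ennreal K * (\<integral>\<^sup>+y. indicator {0..} y * emeasure M {\<omega> \<in> space M. max (real k) (sqrt y) < \<bar>Z \<omega>\<bar>} \<partial>lborel)"
      by (rule nn_integral_cmult) measurable
    also have "\<dots> = ennreal K * (\<integral>\<^sup>+\<omega>. ennreal (tail_square (real k) (Z \<omega>)) \<partial>M)"
      by (subst nn_integral_tail_square) (use k in auto)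
    also have "\<dots> = ennreal K * ennreal (\<integral>\<omega>. tail_square (real k) (Z \<omega>) \<partial>M)"
      by (subst nn_integral_eq_integral) (auto intro: tail_int Z_sq simp: tail_square_bounds)
    also have "\<dots> = ennreal (K * (\<integral>\<omega>. tail_square (real k) (Z \<omega>) \<partial>M))"
      using K by (simp add: ennreal_mult tail_square_bounds)
    finally have "(\<integral>\<omega>. tail_square (real k) (\<epsilon> t \<omega>) \<partial>M) \<le> K * (\<integral>\<omega>. tail_square (real k) (Z \<omega>) \<partial>M)"
      using K by (subst (asm) ennreal_le_iff) (auto simp: tail_square_bounds)
    then show "(\<integral>\<omega>. tail_square (real k) (\<epsilon> t \<omega>) \<partial>M) \<le> e" using k by simp
  qed (use k in simp)
qed

section \<open>Innovations with unit conditional variance: orthogonality and a central limit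
  theorem\<close>

locale martingale_innovations = prob_space M for M :: "'a measure" +
  fixes \<epsilon> :: "int \<Rightarrow> 'a \<Rightarrow> real"
  assumes innovations: "martingale_difference_innovations M \<epsilon>"
    and dominated: "uniformly_dominated M \<epsilon>"
begin

lemma \<epsilon>_measurable [measurable]: "\<epsilon> t \<in> borel_measurable M"
  and \<epsilon>_square_integrable: "integrable M (\<lambda>\<omega>. (\<epsilon> t \<omega>)\<^sup>2)"
  using innovations by (simp_all add: martingale_difference_innovations_def)

lemma space_history [simp]: "space (history M \<epsilon> t) = space M"
  by (simp add: history_def space_measure_of_conv)

lemma sets_history: "sets (history M \<epsilon> t) = sigma_sets (space M) (\<Union>s\<in>{..t}. {\<epsilon> s -` A \<inter> space M | A. A \<in> sets borel})"
  unfolding history_def by (rule sets_measure_of) auto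

lemma subalgebra_history: "subalgebra M (history M \<epsilon> t)"
proof (rule subalgebra_def[THEN iffD2], intro conjI)
  show "sets (history M \<epsilon> t) \<subseteq> sets M"
    unfolding sets_history by (rule sets.sigma_sets_subset) (auto intro: measurable_sets[OF \<epsilon>_measurable])
qed simp

lemma \<epsilon>_measurable_history: "s \<le> t \<Longrightarrow> \<epsilon> s \<in> borel_measurable (history M \<epsilon> t)"
  by (rule measurableI) (auto simp: sets_history intro!: sigma_sets.Basic)

text \<open>A factor known at time t - 1 may be pulled out of the conditional expectation, which
  replaces the innovation by 0 and its square by 1.\<close>

lemma
  assumes g: "g \<in> borel_measurable (history M \<epsilon> (t - 1))"
  shows expectation_mult_innovation: "integrable M (\<lambda>\<omega>. g \<omega> * \<epsilon> t \<omega>) \<Longrightarrow> (\<integral>\<omega>. g \<omega> * \<epsilon> t \<omega> \<partial>M) = 0"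
    and expectation_mult_innovation_square:
      "integrable M (\<lambda>\<omega>. g \<omega> * (\<epsilon> t \<omega>)\<^sup>2) \<Longrightarrow> (\<integral>\<omega>. g \<omega> * (\<epsilon> t \<omega>)\<^sup>2 \<partial>M) = (\<integral>\<omega>. g \<omega> \<partial>M)"
proof -
  interpret F: finite_measure_subalgebra M "history M \<epsilon> (t - 1)"
    by unfold_locales (rule subalgebra_history)
  have gM [measurable]: "g \<in> borel_measurable M"
    by (rule measurable_from_subalg[OF subalgebra_history g])
  have ce: "AE \<omega> in M. real_cond_exp M (history M \<epsilon> (t - 1)) (\<epsilon> t) \<omega> = 0"
    "AE \<omega> in M. real_cond_exp M (history M \<epsilon> (t - 1)) (\<lambda>\<omega>. (\<epsilon> t \<omega>)\<^sup>2) \<omega> = 1"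
    using innovations by (simp_all add: martingale_difference_innovations_def)
  {
    assume "integrable M (\<lambda>\<omega>. g \<omega> * \<epsilon> t \<omega>)"
    then have "(\<integral>\<omega>. g \<omega> * \<epsilon> t \<omega> \<partial>M) = (\<integral>\<omega>. g \<omega> * real_cond_exp M (history M \<epsilon> (t - 1)) (\<epsilon> t) \<omega> \<partial>M)"
      by (rule F.real_cond_exp_intg(2)[symmetric]) (use g in auto)
    also have "\<dots> = (\<integral>\<omega>. 0 \<partial>M)"
      by (rule integral_cong_AE) (use ce(1) in auto)
    finally show "(\<integral>\<omega>. g \<omega> * \<epsilon> t \<omega> \<partial>M) = 0" by simp
  next
    assume "integrable M (\<lambda>\<omega>. g \<omega> * (\<epsilon> t \<omega>)\<^sup>2)"
    then have "(\<integral>\<omega>. g \<omega> * (\<epsilon> t \<omega>)\<^sup>2 \<partial>M) = (\<integral>\<omega>. g \<omega> * real_cond_exp M (history M \<epsilon> (t - 1)) (\<lambda>\<omega>. (\<epsilon> t \<omega>)\<^sup>2) \<omega> \<partial>M)"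
      by (rule F.real_cond_exp_intg(2)[symmetric]) (use g in auto)
    also have "\<dots> = (\<integral>\<omega>. g \<omega> \<partial>M)"
      by (rule integral_cong_AE) (use ce(2) in auto)
    finally show "(\<integral>\<omega>. g \<omega> * (\<epsilon> t \<omega>)\<^sup>2 \<partial>M) = (\<integral>\<omega>. g \<omega> \<partial>M)" .
  }
qed

lemma expectation_innovation_square: "(\<integral>\<omega>. (\<epsilon> t \<omega>)\<^sup>2 \<partial>M) = 1"
  using expectation_mult_innovation_square[of "\<lambda>_. 1" t] \<epsilon>_square_integrable by (simp add: prob_space)

lemma innovations_orthogonal:
  assumes "s < t"
  shows "(\<integral>\<omega>. \<epsilon> s \<omega> * \<epsilon> t \<omega> \<partial>M) = 0"
  by (rule expectation_mult_innovation) (use assms in \<open>auto intro!: \<epsilon>_measurable_history integrable_mult_square_integrable \<epsilon>_square_integrable\<close>)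

lemma expectation_innovation_mult: "(\<integral>\<omega>. \<epsilon> s \<omega> * \<epsilon> t \<omega> \<partial>M) = (if s = t then 1 else 0)"
  using innovations_orthogonal[of s t] innovations_orthogonal[of t s] expectation_innovation_square[of s]
  by (cases s t rule: linorder_cases) (auto simp: mult.commute power2_eq_square)

lemma integrable_innovation_mult: "integrable M (\<lambda>\<omega>. \<epsilon> s \<omega> * \<epsilon> t \<omega>)"
  by (intro integrable_mult_square_integrable \<epsilon>_square_integrable) simp_all

lemma expectation_sum_innovations_square:
  assumes "finite A" "inj_on s A"
  shows "(\<integral>\<omega>. (\<Sum>i\<in>A. v i * \<epsilon> (s i) \<omega>)\<^sup>2 \<partial>M) = (\<Sum>i\<in>A. (v i)\<^sup>2)"
proof -
  have "(\<integral>\<omega>. (\<Sum>i\<in>A. v i * \<epsilon> (s i) \<omega>)\<^sup>2 \<partial>M) = (\<integral>\<omega>. (\<Sum>i\<in>A. \<Sum>j\<in>A. (v i * v j) * (\<epsilon> (s i) \<omega> * \<epsilon> (s j) \<omega>)) \<partial>M)"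
    by (simp add: power2_eq_square sum_product mult_ac)
  also have "\<dots> = (\<Sum>i\<in>A. \<Sum>j\<in>A. (v i * v j) * (\<integral>\<omega>. \<epsilon> (s i) \<omega> * \<epsilon> (s j) \<omega> \<partial>M))"
    by (simp add: Bochner_Integration.integral_sum integrable_innovation_mult)
  also have "\<dots> = (\<Sum>i\<in>A. \<Sum>j\<in>A. if j = i then (v i)\<^sup>2 else 0)"
    unfolding expectation_innovation_mult
    by (intro sum.cong refl) (use assms(2) in \<open>auto simp: power2_eq_square inj_on_eq_iff\<close>)
  finally show ?thesis using assms(1) by simp
qed

text \<open>Real and imaginary parts reduce this to the real case, and the bound on \<open>G\<close>
  supplies the integrability. In the application \<open>G\<close> is a complex exponential of
  earlier innovations.\<close>

lemma expectation_complex_mult_innovation: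
  fixes G :: "'a \<Rightarrow> complex"
  assumes G: "G \<in> borel_measurable (history M \<epsilon> (t - 1))" "\<And>\<omega>. cmod (G \<omega>) \<le> 1"
  shows "(CLINT \<omega>|M. G \<omega> * \<epsilon> t \<omega>) = 0" "(CLINT \<omega>|M. G \<omega> * (\<epsilon> t \<omega>)\<^sup>2) = (CLINT \<omega>|M. G \<omega>)"
    and "integrable M (\<lambda>\<omega>. G \<omega> * \<epsilon> t \<omega>)" "integrable M (\<lambda>\<omega>. G \<omega> * (\<epsilon> t \<omega>)\<^sup>2)" "integrable M G"
proof -
  have GM [measurable]: "G \<in> borel_measurable M"
    by (rule measurable_from_subalg[OF subalgebra_history G(1)])
  have \<epsilon>_int: "integrable M (\<epsilon> t)"
    using integrable_mult_square_integrable[of "\<epsilon> t" M "\<lambda>_. 1"] \<epsilon>_square_integrable by simp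
  show i1: "integrable M (\<lambda>\<omega>. G \<omega> * \<epsilon> t \<omega>)"
    by (rule Bochner_Integration.integrable_bound[OF \<epsilon>_int])
      (use G(2) in \<open>auto simp: norm_mult intro!: mult_left_le_one_le\<close>)
  show i2: "integrable M (\<lambda>\<omega>. G \<omega> * (\<epsilon> t \<omega>)\<^sup>2)"
    by (rule Bochner_Integration.integrable_bound[OF \<epsilon>_square_integrable[of t]])
      (use G(2) in \<open>auto simp: norm_mult norm_power intro!: mult_left_le_one_le\<close>)
  show i3: "integrable M G"
    by (rule integrable_const_bound[where B = 1]) (use G(2) in auto)
  have meas: "(\<lambda>\<omega>. Re (G \<omega>)) \<in> borel_measurable (history M \<epsilon> (t - 1))" "(\<lambda>\<omega>. Im (G \<omega>)) \<in> borel_measurable (history M \<epsilon> (t - 1))"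
    using G(1) by measurable
  have "(\<integral>\<omega>. Re (G \<omega>) * \<epsilon> t \<omega> \<partial>M) = 0" "(\<integral>\<omega>. Im (G \<omega>) * \<epsilon> t \<omega> \<partial>M) = 0"
    using integrable_Re[OF i1] integrable_Im[OF i1] by (auto intro!: expectation_mult_innovation meas)
  then show "(CLINT \<omega>|M. G \<omega> * \<epsilon> t \<omega>) = 0"
    using integral_Re[OF i1] integral_Im[OF i1] by (simp add: complex_eq_iff)
  have "(\<integral>\<omega>. Re (G \<omega>) * (\<epsilon> t \<omega>)\<^sup>2 \<partial>M) = (\<integral>\<omega>. Re (G \<omega>) \<partial>M)" "(\<integral>\<omega>. Im (G \<omega>) * (\<epsilon> t \<omega>)\<^sup>2 \<partial>M) = (\<integral>\<omega>. Im (G \<omega>) \<partial>M)"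
    using integrable_Re[OF i2] integrable_Im[OF i2]
    by (auto intro!: expectation_mult_innovation_square meas simp: of_real_power[symmetric] simp del: of_real_power)
  then show "(CLINT \<omega>|M. G \<omega> * (\<epsilon> t \<omega>)\<^sup>2) = (CLINT \<omega>|M. G \<omega>)"
    using integral_Re[OF i2] integral_Im[OF i2] integral_Re[OF i3] integral_Im[OF i3]
    by (simp add: complex_eq_iff of_real_power[symmetric] del: of_real_power)
qed

text \<open>Second-order Taylor expansion of the exponential: given the past, the linear term
  vanishes and the quadratic one contributes exactly a^2 / 2, which agrees with
  \<open>exp (- (a\<^sup>2 / 2))\<close> up to order a^4. The remainder is bounded by a square where
  the innovation exceeds \<open>L\<close> and by a cube elsewhere, one factor of which is at most
  \<open>L\<close>.\<close>

lemma char_innovation_step: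
  fixes G :: "'a \<Rightarrow> complex"
  assumes G: "G \<in> borel_measurable (history M \<epsilon> (t - 1))" "\<And>\<omega>. cmod (G \<omega>) \<le> 1"
    and L: "0 < L" and U: "(\<integral>\<omega>. tail_square L (\<epsilon> t \<omega>) \<partial>M) \<le> U"
  shows "cmod ((CLINT \<omega>|M. G \<omega> * iexp (a * \<epsilon> t \<omega>)) - complex_of_real (exp (- (a\<^sup>2 / 2))) * (CLINT \<omega>|M. G \<omega>)) \<le>
    a\<^sup>2 * (U + \<bar>a\<bar> * L + a\<^sup>2)"
proof -
  note E = expectation_complex_mult_innovation[OF G]
  have GM [measurable]: "G \<in> borel_measurable M"
    by (rule measurable_from_subalg[OF subalgebra_history G(1)])
  define T where "T x = iexp x - 1 - \<i> * x + complex_of_real x ^ 2 / 2" for x :: real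
  have sum2: "(\<Sum>k\<le>2. (\<i> * complex_of_real x) ^ k / fact k) = 1 + \<i> * x - complex_of_real x ^ 2 / 2" for x
    by (simp add: numeral_2_eq_2 mult.assoc mult.left_commute[of "complex_of_real x" \<i>])
  have T1: "cmod (T x) \<le> \<bar>x\<bar> ^ 3" and T2: "cmod (T x) \<le> x\<^sup>2" for x
  proof -
    have "cmod (T x) \<le> \<bar>x\<bar> ^ Suc 2 / fact (Suc 2)"
      using iexp_approx1[of x 2] by (simp only: sum2 T_def) (simp add: algebra_simps)
    also have "\<dots> \<le> \<bar>x\<bar> ^ 3" by (simp add: fact_numeral numeral_3_eq_3[symmetric])
    finally show "cmod (T x) \<le> \<bar>x\<bar> ^ 3" .
    show "cmod (T x) \<le> x\<^sup>2"
      using iexp_approx2[of x 2] by (simp only: sum2 T_def) (simp add: algebra_simps)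
  qed
  have T_bound: "cmod (T (a * y)) \<le> a\<^sup>2 * tail_square L y + \<bar>a\<bar> ^ 3 * L * y\<^sup>2" for y
  proof (cases "L < \<bar>y\<bar>")
    case True
    then show ?thesis using T2[of "a * y"] L by (simp add: tail_square_def power_mult_distrib add_increasing2)
  next
    case False
    have "cmod (T (a * y)) \<le> \<bar>a\<bar> ^ 3 * (\<bar>y\<bar> * y\<^sup>2)"
    proof -
      have "\<bar>y\<bar> ^ 3 = \<bar>y\<bar> * y\<^sup>2" by (simp add: power3_eq_cube power2_eq_square)
      then show ?thesis using T1[of "a * y"] by (simp only: abs_mult power_mult_distrib)
    qed
    also have "\<dots> \<le> \<bar>a\<bar> ^ 3 * (L * y\<^sup>2)" using False by (intro mult_left_mono mult_right_mono) auto
    finally show ?thesis using False by (simp add: tail_square_def mult_ac)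
  qed
  have [measurable]: "T \<in> borel_measurable borel" unfolding T_def by measurable
  have tail_int: "integrable M (\<lambda>\<omega>. tail_square L (\<epsilon> t \<omega>))"
    by (rule Bochner_Integration.integrable_bound[OF \<epsilon>_square_integrable[of t]])
      (use tail_square_bounds in \<open>auto simp: abs_of_nonneg\<close>)
  have bound_int: "integrable M (\<lambda>\<omega>. a\<^sup>2 * tail_square L (\<epsilon> t \<omega>) + \<bar>a\<bar> ^ 3 * L * (\<epsilon> t \<omega>)\<^sup>2)"
    using tail_int \<epsilon>_square_integrable by simp
  have GT_bound: "cmod (G \<omega> * T (a * \<epsilon> t \<omega>)) \<le> a\<^sup>2 * tail_square L (\<epsilon> t \<omega>) + \<bar>a\<bar> ^ 3 * L * (\<epsilon> t \<omega>)\<^sup>2" for \<omega>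
    unfolding norm_mult using mult_mono[OF G(2)[of \<omega>] T_bound[of "\<epsilon> t \<omega>"]] by simp
  have GT_int: "integrable M (\<lambda>\<omega>. G \<omega> * T (a * \<epsilon> t \<omega>))"
    by (rule Bochner_Integration.integrable_bound[OF bound_int]) (auto intro!: AE_I2 order_trans[OF GT_bound abs_ge_self])
  have "(CLINT \<omega>|M. G \<omega> * iexp (a * \<epsilon> t \<omega>)) =
      (CLINT \<omega>|M. G \<omega> * T (a * \<epsilon> t \<omega>) + G \<omega> + \<i> * a * (G \<omega> * \<epsilon> t \<omega>) - complex_of_real a ^ 2 / 2 * (G \<omega> * (\<epsilon> t \<omega>)\<^sup>2))"
    by (intro Bochner_Integration.integral_cong refl) (simp add: T_def algebra_simps power_mult_distrib)
  also have "\<dots> = (CLINT \<omega>|M. G \<omega> * T (a * \<epsilon> t \<omega>)) + (1 - complex_of_real a ^ 2 / 2) * (CLINT \<omega>|M. G \<omega>)"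
  proof -
    have "(CLINT \<omega>|M. G \<omega> * T (a * \<epsilon> t \<omega>) + G \<omega> + \<i> * a * (G \<omega> * \<epsilon> t \<omega>) - complex_of_real a ^ 2 / 2 * (G \<omega> * (\<epsilon> t \<omega>)\<^sup>2)) =
        (CLINT \<omega>|M. G \<omega> * T (a * \<epsilon> t \<omega>)) + (CLINT \<omega>|M. G \<omega>) + \<i> * a * (CLINT \<omega>|M. G \<omega> * \<epsilon> t \<omega>) -
        complex_of_real a ^ 2 / 2 * (CLINT \<omega>|M. G \<omega> * (\<epsilon> t \<omega>)\<^sup>2)"
      by (simp only: Bochner_Integration.integral_add Bochner_Integration.integral_diff integral_mult_right_zero
        Bochner_Integration.integrable_add integrable_mult_right GT_int E(3,4,5))
    then show ?thesis unfolding E(1,2) by (simp add: left_diff_distrib)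
  qed
  finally have eq: "(CLINT \<omega>|M. G \<omega> * iexp (a * \<epsilon> t \<omega>)) - complex_of_real (exp (- (a\<^sup>2 / 2))) * (CLINT \<omega>|M. G \<omega>) =
      (CLINT \<omega>|M. G \<omega> * T (a * \<epsilon> t \<omega>)) + complex_of_real (1 - a\<^sup>2 / 2 - exp (- (a\<^sup>2 / 2))) * (CLINT \<omega>|M. G \<omega>)"
    by (simp add: algebra_simps)
  have "cmod (CLINT \<omega>|M. G \<omega> * T (a * \<epsilon> t \<omega>)) \<le> (LINT \<omega>|M. cmod (G \<omega> * T (a * \<epsilon> t \<omega>)))"
    by (rule integral_norm_bound)
  also have "\<dots> \<le> (LINT \<omega>|M. a\<^sup>2 * tail_square L (\<epsilon> t \<omega>) + \<bar>a\<bar> ^ 3 * L * (\<epsilon> t \<omega>)\<^sup>2)"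
    using GT_int bound_int GT_bound by (intro integral_mono) auto
  also have "\<dots> = a\<^sup>2 * (LINT \<omega>|M. tail_square L (\<epsilon> t \<omega>)) + \<bar>a\<bar> ^ 3 * L"
    using tail_int \<epsilon>_square_integrable by (simp add: expectation_innovation_square)
  also have "\<dots> \<le> a\<^sup>2 * U + \<bar>a\<bar> ^ 3 * L" using U by (simp add: mult_left_mono)
  also have "\<bar>a\<bar> ^ 3 * L = a\<^sup>2 * (\<bar>a\<bar> * L)" by (simp add: power3_eq_cube power2_eq_square)
  finally have 1: "cmod (CLINT \<omega>|M. G \<omega> * T (a * \<epsilon> t \<omega>)) \<le> a\<^sup>2 * U + a\<^sup>2 * (\<bar>a\<bar> * L)" .
  have "cmod (CLINT \<omega>|M. G \<omega>) \<le> (LINT \<omega>|M. cmod (G \<omega>))" by (rule integral_norm_bound)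
  also have "\<dots> \<le> (LINT \<omega>|M. 1)" using E(5) G(2) by (intro integral_mono) auto
  finally have G1: "cmod (CLINT \<omega>|M. G \<omega>) \<le> 1" by (simp add: prob_space)
  have exp_quad: "\<bar>1 - y - exp (- y)\<bar> \<le> y\<^sup>2" if "0 \<le> y" for y :: real
  proof -
    have "exp (- y) * (1 + y) \<le> exp (- y) * exp y" using exp_ge_add_one_self[of y] by (intro mult_left_mono) auto
    also have "\<dots> \<le> (1 - y + y\<^sup>2) * (1 + y)"
      using that by (simp add: exp_minus algebra_simps power2_eq_square)
    finally have "exp (- y) \<le> 1 - y + y\<^sup>2" using that by (subst (asm) mult_le_cancel_right_pos) auto
    then show ?thesis using exp_ge_add_one_self[of "- y"] by simp
  qed
  have "\<bar>1 - a\<^sup>2 / 2 - exp (- (a\<^sup>2 / 2))\<bar> \<le> (a\<^sup>2 / 2)\<^sup>2" by (rule exp_quad) simp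
  also have "\<dots> = a\<^sup>2 * a\<^sup>2 / 4" by (simp add: power2_eq_square)
  also have "\<dots> \<le> a\<^sup>2 * a\<^sup>2" using mult_nonneg_nonneg[of "a\<^sup>2" "a\<^sup>2"] by simp
  finally have "\<bar>1 - a\<^sup>2 / 2 - exp (- (a\<^sup>2 / 2))\<bar> * cmod (CLINT \<omega>|M. G \<omega>) \<le> (a\<^sup>2 * a\<^sup>2) * 1"
    using G1 by (intro mult_mono) auto
  then have 2: "cmod (complex_of_real (1 - a\<^sup>2 / 2 - exp (- (a\<^sup>2 / 2))) * (CLINT \<omega>|M. G \<omega>)) \<le> a\<^sup>2 * a\<^sup>2"
    by (simp only: norm_mult norm_of_real mult_1_right)
  have "cmod ((CLINT \<omega>|M. G \<omega> * iexp (a * \<epsilon> t \<omega>)) - complex_of_real (exp (- (a\<^sup>2 / 2))) * (CLINT \<omega>|M. G \<omega>)) \<le>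
      (a\<^sup>2 * U + a\<^sup>2 * (\<bar>a\<bar> * L)) + a\<^sup>2 * a\<^sup>2"
    unfolding eq by (rule norm_triangle_mono[OF 1 2])
  then show ?thesis by (simp only: distrib_left)
qed

text \<open>As the conditional variance is exactly \<open>1\<close>, the Gaussian factor belonging to each summand is
  deterministic, so the summands can be exchanged for Gaussian ones successively, newest first.\<close>

lemma char_sum_innovations_bound:
  assumes L: "0 < L" and U: "\<And>t. (\<integral>\<omega>. tail_square L (\<epsilon> t \<omega>) \<partial>M) \<le> U"
    and b: "\<And>j. j < k \<Longrightarrow> \<bar>\<theta> * v j\<bar> \<le> b"
  shows "cmod ((CLINT \<omega>|M. iexp (\<theta> * (\<Sum>j<k. v j * \<epsilon> (s + int j) \<omega>))) - complex_of_real (exp (- (\<theta>\<^sup>2 * (\<Sum>j<k. (v j)\<^sup>2) / 2)))) \<le>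
    \<theta>\<^sup>2 * (\<Sum>j<k. (v j)\<^sup>2) * (U + b * L + b\<^sup>2)"
  using b
proof (induction k)
  case 0
  then show ?case by (simp add: prob_space)
next
  case (Suc k)
  define G where "G \<omega> = iexp (\<theta> * (\<Sum>j<k. v j * \<epsilon> (s + int j) \<omega>))" for \<omega>
  define a where "a = \<theta> * v k"
  define g where "g = exp (- (\<theta>\<^sup>2 * (\<Sum>j<k. (v j)\<^sup>2) / 2))"
  have ab: "\<bar>a\<bar> \<le> b" "0 \<le> b" using Suc.prems[of k] by (auto simp: a_def)
  have G_meas: "G \<in> borel_measurable (history M \<epsilon> (s + int k - 1))"
  proof -
    have [measurable]: "\<epsilon> (s + int j) \<in> borel_measurable (history M \<epsilon> (s + int k - 1))" if "j \<in> {..<k}" for j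
      using that by (intro \<epsilon>_measurable_history) auto
    have [measurable]: "(\<lambda>\<omega>. \<theta> * (\<Sum>j<k. v j * \<epsilon> (s + int j) \<omega>)) \<in> borel_measurable (history M \<epsilon> (s + int k - 1))"
      by measurable
    show ?thesis unfolding G_def by measurable
  qed
  have IH: "cmod ((CLINT \<omega>|M. G \<omega>) - complex_of_real g) \<le> \<theta>\<^sup>2 * (\<Sum>j<k. (v j)\<^sup>2) * (U + b * L + b\<^sup>2)"
    unfolding G_def g_def by (rule Suc.IH) (use Suc.prems in auto)
  have "cmod ((CLINT \<omega>|M. G \<omega> * iexp (a * \<epsilon> (s + int k) \<omega>)) - complex_of_real (exp (- (a\<^sup>2 / 2))) * (CLINT \<omega>|M. G \<omega>)) \<le>
      a\<^sup>2 * (U + \<bar>a\<bar> * L + a\<^sup>2)"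
    using char_innovation_step[OF G_meas _ L U, of a] by (simp add: G_def)
  also have "\<dots> \<le> a\<^sup>2 * (U + b * L + b\<^sup>2)"
    using ab L power_mono[of "\<bar>a\<bar>" b 2] by (intro mult_left_mono add_mono mult_right_mono) auto
  finally have step: "cmod ((CLINT \<omega>|M. G \<omega> * iexp (a * \<epsilon> (s + int k) \<omega>)) - complex_of_real (exp (- (a\<^sup>2 / 2))) * (CLINT \<omega>|M. G \<omega>)) \<le>
      a\<^sup>2 * (U + b * L + b\<^sup>2)" .
  have "cmod (complex_of_real (exp (- (a\<^sup>2 / 2))) * (CLINT \<omega>|M. G \<omega>) - complex_of_real (exp (- (a\<^sup>2 / 2)) * g)) =
      exp (- (a\<^sup>2 / 2)) * cmod ((CLINT \<omega>|M. G \<omega>) - complex_of_real g)"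
    by (simp add: right_diff_distrib[symmetric] norm_mult)
  also have "\<dots> \<le> 1 * (\<theta>\<^sup>2 * (\<Sum>j<k. (v j)\<^sup>2) * (U + b * L + b\<^sup>2))"
    by (intro mult_mono IH) auto
  finally have prev: "cmod (complex_of_real (exp (- (a\<^sup>2 / 2))) * (CLINT \<omega>|M. G \<omega>) - complex_of_real (exp (- (a\<^sup>2 / 2)) * g)) \<le>
      \<theta>\<^sup>2 * (\<Sum>j<k. (v j)\<^sup>2) * (U + b * L + b\<^sup>2)" by simp
  have e1: "(CLINT \<omega>|M. iexp (\<theta> * (\<Sum>j<Suc k. v j * \<epsilon> (s + int j) \<omega>))) = (CLINT \<omega>|M. G \<omega> * iexp (a * \<epsilon> (s + int k) \<omega>))"
    by (simp add: G_def a_def exp_add[symmetric] algebra_simps)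
  have e2: "exp (- (\<theta>\<^sup>2 * (\<Sum>j<Suc k. (v j)\<^sup>2) / 2)) = exp (- (a\<^sup>2 / 2)) * g"
    by (simp add: g_def a_def exp_add[symmetric] power_mult_distrib algebra_simps add_divide_distrib)
  have "cmod ((CLINT \<omega>|M. G \<omega> * iexp (a * \<epsilon> (s + int k) \<omega>)) - complex_of_real (exp (- (a\<^sup>2 / 2)) * g)) \<le>
      a\<^sup>2 * (U + b * L + b\<^sup>2) + \<theta>\<^sup>2 * (\<Sum>j<k. (v j)\<^sup>2) * (U + b * L + b\<^sup>2)"
    using norm_triangle_mono[OF step prev] by simp
  also have "\<dots> = \<theta>\<^sup>2 * (\<Sum>j<Suc k. (v j)\<^sup>2) * (U + b * L + b\<^sup>2)"
    by (simp add: a_def power_mult_distrib distrib_left distrib_right)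
  finally show ?case unfolding e1 e2 .
qed

text \<open>A central limit theorem for martingale differences with deterministic weights. As the
  squared weights sum to 1, the accumulated error is
  \<open>\<theta>\<^sup>2 * (e + b * L + b\<^sup>2)\<close>: uniform square integrability fixes the
  truncation level \<open>L\<close>, and the bound b on the weights is then chosen small compared
  with it. Uniformity of the tails in t allows the starting time \<open>s n\<close> to move with
  n.\<close>

lemma char_weighted_innovations_tendsto_gaussian:
  assumes normed: "\<forall>\<^sub>F n in sequentially. (\<Sum>j<k n. (v n j)\<^sup>2) = 1"
    and small: "\<And>b. 0 < b \<Longrightarrow> \<forall>\<^sub>F n in sequentially. \<forall>j<k n. \<bar>v n j\<bar> \<le> b"
  shows "(\<lambda>n. CLINT \<omega>|M. iexp (\<theta> * (\<Sum>j<k n. v n j * \<epsilon> (s n + int j) \<omega>))) \<longlonglongrightarrow> complex_of_real (exp (- (\<theta>\<^sup>2 / 2)))"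
proof (rule LIMSEQ_I)
  fix r :: real assume r: "0 < r"
  \<comment> \<open>With \<open>b * L + b\<^sup>2\<close> at most e, the total error is at most 2 e
    (\<theta>^2 + 1) = 2 r / 3; the added 1 excludes a zero denominator at \<theta> = 0.\<close>
  define e where "e = r / (3 * (\<theta>\<^sup>2 + 1))"
  have e: "0 < e" using r by (simp add: e_def add_nonneg_pos)
  obtain L where L: "0 < L" "\<And>t. (\<integral>\<omega>. tail_square L (\<epsilon> t \<omega>) \<partial>M) \<le> e"
    using uniformly_dominated_imp_uniformly_square_integrable[OF \<epsilon>_measurable \<epsilon>_square_integrable dominated e] by metis
  define b where "b = min (e / (L + 1)) 1"
  have b: "0 < b" "b \<le> 1" "b * (L + 1) \<le> e"
  proof -
    show "0 < b" "b \<le> 1" using e L(1) by (auto simp: b_def)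
    have "b \<le> e / (L + 1)" by (simp add: b_def)
    then show "b * (L + 1) \<le> e" using L(1) by (simp add: pos_le_divide_eq)
  qed
  have b_sum: "b * L + b\<^sup>2 \<le> e"
  proof -
    have "b\<^sup>2 \<le> b" using b by (simp add: power2_eq_square mult_left_le)
    then show ?thesis using b(3) by (simp add: distrib_left)
  qed
  have "0 < b / (\<bar>\<theta>\<bar> + 1)" using b by (simp add: add_nonneg_pos)
  from normed small[OF this]
  have "\<forall>\<^sub>F n in sequentially. norm ((CLINT \<omega>|M. iexp (\<theta> * (\<Sum>j<k n. v n j * \<epsilon> (s n + int j) \<omega>))) - complex_of_real (exp (- (\<theta>\<^sup>2 / 2)))) < r"
  proof eventually_elim
    case (elim n)
    have "\<bar>\<theta> * v n j\<bar> \<le> b" if "j < k n" for j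
    proof -
      have "\<bar>\<theta> * v n j\<bar> \<le> (\<bar>\<theta>\<bar> + 1) * (b / (\<bar>\<theta>\<bar> + 1))"
        unfolding abs_mult using elim(2) that b by (intro mult_mono) auto
      then show ?thesis by (simp add: add_nonneg_pos)
    qed
    from char_sum_innovations_bound[OF L, where v = "v n" and k = "k n" and s = "s n", OF this]
    have "cmod ((CLINT \<omega>|M. iexp (\<theta> * (\<Sum>j<k n. v n j * \<epsilon> (s n + int j) \<omega>))) - complex_of_real (exp (- (\<theta>\<^sup>2 / 2)))) \<le> \<theta>\<^sup>2 * (e + b * L + b\<^sup>2)"
      using elim(1) by simp
    also have "\<dots> \<le> \<theta>\<^sup>2 * (2 * e)" using b_sum by (intro mult_left_mono) auto
    also have "\<dots> \<le> (\<theta>\<^sup>2 + 1) * (2 * e)" using e by (intro mult_right_mono) auto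
    also have "\<dots> = 2 / 3 * r" by (simp add: e_def add_nonneg_pos divide_simps) (smt (verit) zero_le_power2)
    also have "\<dots> < r" using r by simp
    finally show ?case .
  qed
  then show "\<exists>no. \<forall>n\<ge>no. norm ((CLINT \<omega>|M. iexp (\<theta> * (\<Sum>j<k n. v n j * \<epsilon> (s n + int j) \<omega>))) - complex_of_real (exp (- (\<theta>\<^sup>2 / 2)))) < r"
    by (simp add: eventually_sequentially)
qed

end

section \<open>Discrete Fourier transforms of the increments\<close>

text \<open>Input r is first felt at time r, so the transform collects for it the phase
  \<open>cis (real r * x)\<close> times a transfer sum cut off after n + 1 - r terms. Passing from n
  to n + 1 lengthens each transfer sum by one term, and all the new terms carry the common phase
  \<open>cis (real (Suc n) * x)\<close>.\<close>

lemma dft_convolution: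
  fixes p :: "nat \<Rightarrow> complex" and w :: "nat \<Rightarrow> complex"
  shows "(\<Sum>t=1..n. (\<Sum>k<t. p k * w (t - k)) * cis (real t * x)) =
    (\<Sum>r=1..n. cis (real r * x) * (\<Sum>j<n + 1 - r. p j * cis (real j * x)) * w r)"
proof (induction n)
  case (Suc n)
  let ?P = "\<lambda>m. \<Sum>j<m. p j * cis (real j * x)"
  have "(\<Sum>r=1..Suc n. cis (real r * x) * ?P (Suc n + 1 - r) * w r) =
      (\<Sum>r=1..Suc n. cis (real r * x) * ?P (n + 1 - r) * w r + p (Suc n - r) * w r * cis (real (Suc n) * x))"
  proof (intro sum.cong refl)
    fix r assume r: "r \<in> {1..Suc n}"
    then have "Suc n + 1 - r = Suc (Suc n - r)" "n + 1 - r = Suc n - r" by auto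
    moreover have "cis (real r * x) * cis (real (Suc n - r) * x) = cis (real (Suc n) * x)"
      using r by (simp add: cis_mult distrib_right[symmetric] of_nat_diff)
    ultimately show "cis (real r * x) * ?P (Suc n + 1 - r) * w r =
        cis (real r * x) * ?P (n + 1 - r) * w r + p (Suc n - r) * w r * cis (real (Suc n) * x)"
      by (simp add: algebra_simps del: of_nat_Suc)
  qed
  also have "\<dots> = (\<Sum>r=1..Suc n. cis (real r * x) * ?P (n + 1 - r) * w r) + (\<Sum>r=1..Suc n. p (Suc n - r) * w r) * cis (real (Suc n) * x)"
    by (simp only: sum.distrib sum_distrib_right)
  also have "(\<Sum>r=1..Suc n. cis (real r * x) * ?P (n + 1 - r) * w r) = (\<Sum>r=1..n. cis (real r * x) * ?P (n + 1 - r) * w r)"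
    by simp
  also have "(\<Sum>r=1..Suc n. p (Suc n - r) * w r) = (\<Sum>k<Suc n. p k * w (Suc n - k))"
    by (rule sum.reindex_bij_witness[of _ "\<lambda>k. Suc n - k" "\<lambda>r. Suc n - r"]) auto
  finally show ?case by (simp add: Suc.IH[simplified])
qed simp

lemma geometric_cis_sum_bound:
  "cmod (1 - cis y) * cmod (\<Sum>r=1..m. cis (real r * y)) \<le> 2"
proof -
  have "(1 - cis y) * (\<Sum>r=1..m. cis (real r * y)) = cis y - cis (real (Suc m) * y)"
  proof (induction m)
    case (Suc m)
    have "cis (real (Suc (Suc m)) * y) = cis y * cis (real (Suc m) * y)" by (simp add: cis_mult distrib_right)
    then show ?case using Suc by (simp add: distrib_left left_diff_distrib del: of_nat_Suc)
  qed simp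
  then have "cmod (1 - cis y) * cmod (\<Sum>r=1..m. cis (real r * y)) = cmod (cis y - cis (real (Suc m) * y))"
    by (simp only: norm_mult[symmetric])
  also have "\<dots> \<le> cmod (cis y) + cmod (cis (real (Suc m) * y))" by (rule norm_triangle_ineq4)
  finally show ?thesis by simp
qed

lemma norm_one_minus_cis_lower:
  assumes "0 < \<delta>" "\<delta> \<le> \<bar>y\<bar>" "\<bar>y\<bar> \<le> 2 * pi - \<delta>"
  shows "sqrt (2 - 2 * cos \<delta>) \<le> cmod (1 - cis y)"
proof -
  have "cos \<bar>y\<bar> \<le> cos \<delta>"
  proof (cases "\<bar>y\<bar> \<le> pi")
    case True
    then show ?thesis using assms by (intro cos_monotone_0_pi_le) auto
  next
    case False
    have "cos \<bar>y\<bar> = cos (2 * pi - \<bar>y\<bar>)" by (simp add: cos_diff)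
    also have "\<dots> \<le> cos \<delta>" using assms False by (intro cos_monotone_0_pi_le) auto
    finally show ?thesis .
  qed
  then have "cos y \<le> cos \<delta>" by simp
  moreover have "(cmod (1 - cis y))\<^sup>2 = 2 - 2 * cos y"
    using sin_cos_squared_add[of y] by (simp add: cmod_power2 power2_diff)
  ultimately show ?thesis by (intro real_le_lsqrt) auto
qed

text \<open>In terms of the inputs, each coefficient is a partial transfer sum of modulus at most
  \<open>B\<close>, which feeds the Parseval part. At frequencies y away from the origin the order
  of summation is exchanged: the inner sums are geometric with ratio \<open>cis (x + y)\<close>.
  Keeping x below half of the cutoff for y holds x + y away from the multiples of 2 pi, so these
  sums are bounded and only the total \<open>T\<close> of the absolute coefficients remains.\<close>

lemma (in stationary_process) expectation_dft_convolution_upper: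
  "\<exists>C \<delta>. 0 < C \<and> 0 < \<delta> \<and> \<delta> \<le> 1 \<and>
    (\<forall>n (p :: nat \<Rightarrow> real) x B T. 0 \<le> x \<longrightarrow> x \<le> \<delta> \<longrightarrow>
      (\<forall>k\<le>n. cmod (\<Sum>j<k. complex_of_real (p j) * cis (real j * x)) \<le> B) \<longrightarrow> (\<Sum>j<n. \<bar>p j\<bar>) \<le> T \<longrightarrow>
      (\<integral>\<omega>. (cmod (\<Sum>t=1..n. complex_of_real (\<Sum>k<t. p k * u (int t - int k) \<omega>) * cis (real t * x)))\<^sup>2 \<partial>M) \<le> C * (real n * B\<^sup>2 + T\<^sup>2))"
proof -
  obtain C \<delta> where C: "0 < C" "0 < \<delta>" "\<delta> \<le> 1"
    and upper: "\<forall>n (a :: nat \<Rightarrow> complex) B. (\<forall>x. \<delta> \<le> \<bar>x\<bar> \<longrightarrow> \<bar>x\<bar> \<le> pi \<longrightarrow> cmod (\<Sum>r=1..n. a r * cis (real r * x)) \<le> B) \<longrightarrow>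
      (\<integral>\<omega>. (cmod (\<Sum>r=1..n. a r * u (int r) \<omega>))\<^sup>2 \<partial>M) \<le> C * ((\<Sum>r=1..n. (cmod (a r))\<^sup>2) + B\<^sup>2)"
    using expectation_norm_square_upper by (elim exE conjE)
  define c where "c = sqrt (2 - 2 * cos (\<delta> / 2))"
  have "cos (\<delta> / 2) < cos 0" using C pi_gt3 by (intro cos_monotone_0_pi) auto
  then have c: "0 < c" by (simp add: c_def)
  show ?thesis
  proof (rule exI[of _ "C * (1 + (2 / c)\<^sup>2)"], rule exI[of _ "\<delta> / 2"], intro conjI allI impI)
    fix n and p :: "nat \<Rightarrow> real" and x B T
    assume x: "0 \<le> x" "x \<le> \<delta> / 2" and B': "\<forall>k\<le>n. cmod (\<Sum>j<k. complex_of_real (p j) * cis (real j * x)) \<le> B"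
      and T: "(\<Sum>j<n. \<bar>p j\<bar>) \<le> T"
    note B = B'[rule_format]
    have B0: "0 \<le> B" using B[of 0] by simp
    have T0: "0 \<le> T" using T by (rule order_trans[OF sum_nonneg, rotated]) simp
    define a where "a r = cis (real r * x) * (\<Sum>j<n + 1 - r. complex_of_real (p j) * cis (real j * x))" for r
    have bound: "cmod (\<Sum>r=1..n. a r * cis (real r * y)) \<le> 2 / c * T" if y: "\<delta> \<le> \<bar>y\<bar>" "\<bar>y\<bar> \<le> pi" for y
    proof -
      have "(\<Sum>r=1..n. a r * cis (real r * y)) =
          (\<Sum>r=1..n. \<Sum>j\<in>{j\<in>{..<n}. j + r \<le> n}. (complex_of_real (p j) * cis (real j * x)) * cis (real r * (x + y)))"
      proof (intro sum.cong refl)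
        fix r assume "r \<in> {1..n}"
        then have "{j\<in>{..<n}. j + r \<le> n} = {..<n + 1 - r}" by auto
        then show "a r * cis (real r * y) = (\<Sum>j\<in>{j\<in>{..<n}. j + r \<le> n}. (complex_of_real (p j) * cis (real j * x)) * cis (real r * (x + y)))"
          by (simp add: a_def sum_distrib_left sum_distrib_right distrib_left cis_mult[symmetric] mult_ac)
      qed
      also have "\<dots> = (\<Sum>j<n. \<Sum>r\<in>{r\<in>{1..n}. j + r \<le> n}. (complex_of_real (p j) * cis (real j * x)) * cis (real r * (x + y)))"
        by (rule sum.swap_restrict) auto
      also have "\<dots> = (\<Sum>j<n. (complex_of_real (p j) * cis (real j * x)) * (\<Sum>r=1..n - j. cis (real r * (x + y))))"
      proof (intro sum.cong refl)
        fix j assume "j \<in> {..<n}"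
        then have "{r\<in>{1..n}. j + r \<le> n} = {1..n - j}" by auto
        then show "(\<Sum>r\<in>{r\<in>{1..n}. j + r \<le> n}. (complex_of_real (p j) * cis (real j * x)) * cis (real r * (x + y))) =
            (complex_of_real (p j) * cis (real j * x)) * (\<Sum>r=1..n - j. cis (real r * (x + y)))"
          by (simp add: sum_distrib_left)
      qed
      also have "cmod \<dots> \<le> (\<Sum>j<n. \<bar>p j\<bar> * (2 / c))"
      proof (rule sum_norm_le)
        fix j
        have "\<bar>y\<bar> - x \<le> \<bar>x + y\<bar>" "\<bar>x + y\<bar> \<le> \<bar>y\<bar> + x" using x by linarith+
        then have "\<delta> / 2 \<le> \<bar>x + y\<bar>" "\<bar>x + y\<bar> \<le> 2 * pi - \<delta> / 2" using C x y pi_gt3 by linarith+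
        then have "c \<le> cmod (1 - cis (x + y))"
          unfolding c_def using C by (intro norm_one_minus_cis_lower) auto
        then have "c * cmod (\<Sum>r=1..n - j. cis (real r * (x + y))) \<le> cmod (1 - cis (x + y)) * cmod (\<Sum>r=1..n - j. cis (real r * (x + y)))"
          by (rule mult_right_mono) simp
        also have "\<dots> \<le> 2" by (rule geometric_cis_sum_bound)
        finally have "cmod (\<Sum>r=1..n - j. cis (real r * (x + y))) \<le> 2 / c"
          using c by (simp add: field_simps)
        then show "cmod ((complex_of_real (p j) * cis (real j * x)) * (\<Sum>r=1..n - j. cis (real r * (x + y)))) \<le> \<bar>p j\<bar> * (2 / c)"
          unfolding norm_mult by (simp only: norm_of_real norm_cis mult_1_right) (rule mult_left_mono, auto)
      qed
      also have "\<dots> = (\<Sum>j<n. \<bar>p j\<bar>) * (2 / c)" by (rule sum_distrib_right[symmetric])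
      also have "\<dots> \<le> T * (2 / c)" using T c by (intro mult_right_mono) auto
      finally show ?thesis by (simp only: mult.commute)
    qed
    have "(\<Sum>t=1..n. complex_of_real (\<Sum>k<t. p k * u (int t - int k) \<omega>) * cis (real t * x)) = (\<Sum>r=1..n. a r * u (int r) \<omega>)" for \<omega>
    proof -
      have "(\<Sum>t=1..n. complex_of_real (\<Sum>k<t. p k * u (int t - int k) \<omega>) * cis (real t * x)) =
          (\<Sum>t=1..n. (\<Sum>k<t. complex_of_real (p k) * complex_of_real (u (int (t - k)) \<omega>)) * cis (real t * x))"
        by (intro sum.cong refl) (simp add: of_nat_diff)
      also have "\<dots> = (\<Sum>r=1..n. a r * u (int r) \<omega>)"
        unfolding a_def by (rule dft_convolution)
      finally show ?thesis .
    qed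
    then have "(\<integral>\<omega>. (cmod (\<Sum>t=1..n. complex_of_real (\<Sum>k<t. p k * u (int t - int k) \<omega>) * cis (real t * x)))\<^sup>2 \<partial>M) =
        (\<integral>\<omega>. (cmod (\<Sum>r=1..n. a r * u (int r) \<omega>))\<^sup>2 \<partial>M)" by simp
    also have "\<dots> \<le> C * ((\<Sum>r=1..n. (cmod (a r))\<^sup>2) + (2 / c * T)\<^sup>2)"
      by (intro upper[rule_format] bound)
    also have "(\<Sum>r=1..n. (cmod (a r))\<^sup>2) \<le> (\<Sum>r=1..n. B\<^sup>2)"
    proof (rule sum_mono)
      fix r assume "r \<in> {1..n}"
      then have "n + 1 - r \<le> n" by auto
      then have "cmod (a r) \<le> B" using B[of "n + 1 - r"] by (simp add: a_def norm_mult)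
      then show "(cmod (a r))\<^sup>2 \<le> B\<^sup>2" by (intro power_mono) auto
    qed
    also have "C * ((\<Sum>r=1..n. B\<^sup>2) + (2 / c * T)\<^sup>2) = C * (1 * (real n * B\<^sup>2) + (2 / c)\<^sup>2 * T\<^sup>2)"
      by (simp add: power_mult_distrib power_divide)
    also have "\<dots> \<le> C * ((1 + (2 / c)\<^sup>2) * (real n * B\<^sup>2) + (1 + (2 / c)\<^sup>2) * T\<^sup>2)"
      using C(1) by (intro mult_left_mono add_mono mult_right_mono) auto
    finally show "(\<integral>\<omega>. (cmod (\<Sum>t=1..n. complex_of_real (\<Sum>k<t. p k * u (int t - int k) \<omega>) * cis (real t * x)))\<^sup>2 \<partial>M)
        \<le> C * (1 + (2 / c)\<^sup>2) * (real n * B\<^sup>2 + T\<^sup>2)"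
      using C(1) by (simp add: algebra_simps)
  qed (use C c in \<open>auto intro!: mult_pos_pos add_pos_nonneg\<close>)
qed

text \<open>After the leading 1 all coefficients of order d - 1 are at most 0, while their partial
  sums are the positive numbers \<open>frac_coeff d n\<close>. Hence the negative part totals
  \<open>1 - frac_coeff d n\<close>.\<close>

lemma frac_coeff_diff_sum_abs_le:
  assumes d: "0 < d" "d \<le> 1"
  shows "(\<Sum>j<n. \<bar>frac_coeff (d - 1) j\<bar>) \<le> 2"
proof -
  have "(\<Sum>j<Suc n. \<bar>frac_coeff (d - 1) j\<bar>) = 2 - frac_coeff d n" for n
  proof (induction n)
    case (Suc n)
    have "frac_coeff d (Suc n) \<le> frac_coeff d n"
      unfolding frac_coeff_Suc using d frac_coeff_pos[OF d(1), of n] by (intro mult_left_le) (auto simp: divide_le_eq_1)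
    then have "\<bar>frac_coeff (d - 1) (Suc n)\<bar> = frac_coeff d n - frac_coeff d (Suc n)"
      by (simp add: frac_coeff_diff[symmetric])
    then show ?case using Suc by simp
  qed simp
  then have "(\<Sum>j<Suc n. \<bar>frac_coeff (d - 1) j\<bar>) \<le> 2" using frac_coeff_pos[OF d(1), of n] by simp
  then show ?thesis by simp
qed

text \<open>The ratio of consecutive coefficients is (d + k) / (k + 1), which lies on the same side
  of 1 for all k.\<close>

lemma frac_coeff_mono: "0 < d \<Longrightarrow> incseq (frac_coeff d) \<or> decseq (frac_coeff d)"
proof (cases "1 \<le> d")
  case True
  have "frac_coeff d k \<le> frac_coeff d (Suc k)" for k
    unfolding frac_coeff_Suc using True frac_coeff_pos[of d k] mult_left_mono[of 1 "(d + real k) / real (Suc k)" "frac_coeff d k"] by simp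
  then show ?thesis by (simp add: incseq_SucI)
next
  case False
  assume "0 < d"
  then have "frac_coeff d (Suc k) \<le> frac_coeff d k" for k
    unfolding frac_coeff_Suc using False frac_coeff_pos[of d k] by (intro mult_left_le) (auto simp: divide_le_eq_1)
  then show ?thesis by (simp add: decseq_SucI)
qed

text \<open>A partial sum is a single coefficient of order d + 1, whose growth is known.\<close>

lemma frac_coeff_sum_upper:
  assumes d: "0 < d"
  obtains C where "0 < C" "\<And>k. (\<Sum>j<k. frac_coeff d j) \<le> C * real k powr d"
proof -
  obtain C where C: "0 < C" "\<And>k. frac_coeff (d + 1) k \<le> C * real (k + 1) powr d"
    using frac_coeff_bounds[of "d + 1"] d by (metis add_diff_cancel_right' add_pos_pos zero_less_one)
  show ?thesis
  proof (rule that[OF C(1)])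
    show "(\<Sum>j<k. frac_coeff d j) \<le> C * real k powr d" for k
    proof (cases k)
      case (Suc j)
      then show ?thesis using C(2)[of j] sum_frac_coeff[of "d + 1" j] by simp
    qed simp
  qed
qed

text \<open>For \<alpha> < 1 the power function is not differentiable at 0, so j = 0 calls for the
  form of the mean value theorem that asks for differentiability in the open interval only.\<close>

lemma powr_increment_mvt:
  assumes a: "0 < \<alpha>"
  obtains \<xi> where "real j < \<xi>" "\<xi> < real (Suc j)" "real (Suc j) powr \<alpha> - real j powr \<alpha> = \<alpha> * \<xi> powr (\<alpha> - 1)"
proof -
  obtain l \<xi> where *: "real j < \<xi>" "\<xi> < real (Suc j)" "DERIV (\<lambda>x. x powr \<alpha>) \<xi> :> l"
    "real (Suc j) powr \<alpha> - real j powr \<alpha> = (real (Suc j) - real j) * l"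
  proof (rule exE[OF MVT[of "real j" "real (Suc j)" "\<lambda>x. x powr \<alpha>"]])
    show "continuous_on {real j..real (Suc j)} (\<lambda>x. x powr \<alpha>)"
      using a by (intro continuous_intros continuous_on_powr') auto
    show "(\<lambda>x. x powr \<alpha>) differentiable (at x)" if "real j < x" "x < real (Suc j)" for x
    proof -
      have "0 < x" using that(1) by (rule le_less_trans[OF of_nat_0_le_iff])
      then have "DERIV (\<lambda>x. x powr \<alpha>) x :> \<alpha> * x powr (\<alpha> - 1)" by (rule has_real_derivative_powr)
      then show ?thesis by (auto simp: real_differentiable_def)
    qed
  qed auto
  have "0 < \<xi>" using *(1) by (rule le_less_trans[OF of_nat_0_le_iff])
  then have "DERIV (\<lambda>x. x powr \<alpha>) \<xi> :> \<alpha> * \<xi> powr (\<alpha> - 1)"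
    by (rule has_real_derivative_powr)
  then have "l = \<alpha> * \<xi> powr (\<alpha> - 1)" using *(3) DERIV_unique by blast
  then show ?thesis using that * by auto
qed

lemma powr_increment_mono:
  assumes a: "0 < \<alpha>"
  shows "incseq (\<lambda>j. real (Suc j) powr \<alpha> - real j powr \<alpha>) \<or> decseq (\<lambda>j. real (Suc j) powr \<alpha> - real j powr \<alpha>)"
proof -
  have "\<exists>\<xi> \<zeta>. 0 < \<xi> \<and> \<xi> \<le> \<zeta> \<and> real (Suc j) powr \<alpha> - real j powr \<alpha> = \<alpha> * \<xi> powr (\<alpha> - 1) \<and>
      real (Suc (Suc j)) powr \<alpha> - real (Suc j) powr \<alpha> = \<alpha> * \<zeta> powr (\<alpha> - 1)" for j
  proof -
    obtain \<xi> where \<xi>: "real j < \<xi>" "\<xi> < real (Suc j)" "real (Suc j) powr \<alpha> - real j powr \<alpha> = \<alpha> * \<xi> powr (\<alpha> - 1)"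
      by (rule powr_increment_mvt[OF a])
    obtain \<zeta> where \<zeta>: "real (Suc j) < \<zeta>" "\<zeta> < real (Suc (Suc j))" "real (Suc (Suc j)) powr \<alpha> - real (Suc j) powr \<alpha> = \<alpha> * \<zeta> powr (\<alpha> - 1)"
      by (rule powr_increment_mvt[OF a])
    have "0 < \<xi>" "\<xi> \<le> \<zeta>" using \<xi>(1,2) \<zeta>(1) by linarith+
    then show ?thesis using \<xi>(3) \<zeta>(3) by blast
  qed
  note * = this
  show ?thesis
  proof (cases "1 \<le> \<alpha>")
    case True
    have "real (Suc j) powr \<alpha> - real j powr \<alpha> \<le> real (Suc (Suc j)) powr \<alpha> - real (Suc j) powr \<alpha>" for j
    proof -
      obtain \<xi> \<zeta> where "0 < \<xi>" "\<xi> \<le> \<zeta>" and eq: "real (Suc j) powr \<alpha> - real j powr \<alpha> = \<alpha> * \<xi> powr (\<alpha> - 1)"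
        "real (Suc (Suc j)) powr \<alpha> - real (Suc j) powr \<alpha> = \<alpha> * \<zeta> powr (\<alpha> - 1)" using *[of j] by blast
      then show ?thesis unfolding eq using True by (intro mult_left_mono powr_mono2) auto
    qed
    then show ?thesis by (intro disjI1 incseq_SucI)
  next
    case False
    have "real (Suc (Suc j)) powr \<alpha> - real (Suc j) powr \<alpha> \<le> real (Suc j) powr \<alpha> - real j powr \<alpha>" for j
    proof -
      obtain \<xi> \<zeta> where "0 < \<xi>" "\<xi> \<le> \<zeta>" and eq: "real (Suc j) powr \<alpha> - real j powr \<alpha> = \<alpha> * \<xi> powr (\<alpha> - 1)"
        "real (Suc (Suc j)) powr \<alpha> - real (Suc j) powr \<alpha> = \<alpha> * \<zeta> powr (\<alpha> - 1)" using *[of j] by blast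
      then show ?thesis unfolding eq using False a by (intro mult_left_mono powr_mono2') auto
    qed
    then show ?thesis by (intro disjI2 decseq_SucI)
  qed
qed

text \<open>The increments of the trend are nonnegative and monotone, and they sum to
  \<open>real k powr \<alpha>\<close> exactly, so the bound for monotone coefficients applies with
  exponent \<alpha> and constant 1. Reindexing by t = j + 1 adds only a phase.\<close>

lemma trend_increment_dft_bound:
  assumes a: "0 < \<alpha>"
  shows "\<exists>C>0. \<forall>n x. 0 < x \<longrightarrow> x \<le> 1 \<longrightarrow> 1 \<le> real n * x \<longrightarrow>
    cmod (\<Sum>t=1..n. complex_of_real (real t powr \<alpha> - real (t - 1) powr \<alpha>) * cis (real t * x)) \<le>
      C * (real n powr \<alpha> * (real n * x) powr (- min \<alpha> 1))"
proof (rule exI[of _ "1 * (1 + 4 * 2 powr \<alpha>)"], intro conjI allI impI)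
  fix n and x :: real assume x: "0 < x" "x \<le> 1" "1 \<le> real n * x"
  define p where "p j = real (Suc j) powr \<alpha> - real j powr \<alpha>" for j
  have sum_p: "(\<Sum>j<k. p j) \<le> 1 * real k powr \<alpha>" for k
  proof -
    have "(\<Sum>j<k. p j) = real k powr \<alpha>" by (induction k) (use a in \<open>auto simp: p_def\<close>)
    then show ?thesis by simp
  qed
  have "(\<Sum>t=1..n. complex_of_real (real t powr \<alpha> - real (t - 1) powr \<alpha>) * cis (real t * x)) =
      (\<Sum>j<n. complex_of_real (p j) * cis (real (Suc j) * x))"
    by (rule sum.reindex_bij_witness[of _ Suc "\<lambda>t. t - 1"]) (auto simp: p_def)
  also have "\<dots> = cis x * (\<Sum>j<n. complex_of_real (p j) * cis (real j * x))"
    unfolding sum_distrib_left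
  proof (intro sum.cong refl)
    fix j
    have "cis (real (Suc j) * x) = cis x * cis (real j * x)" by (simp add: cis_mult distrib_right)
    then show "complex_of_real (p j) * cis (real (Suc j) * x) = cis x * (complex_of_real (p j) * cis (real j * x))"
      by (simp only: mult.left_commute)
  qed
  finally have "cmod (\<Sum>t=1..n. complex_of_real (real t powr \<alpha> - real (t - 1) powr \<alpha>) * cis (real t * x)) =
      cmod (\<Sum>j<n. complex_of_real (p j) * cis (real j * x))"
    by (simp only: norm_mult norm_cis mult_1_left)
  also have "\<dots> \<le> 1 * (1 + 4 * 2 powr \<alpha>) * (real n powr \<alpha> * (real n * x) powr (- min \<alpha> 1))"
  proof (rule mono_trig_sum_bound[OF _ _ a sum_p x order_refl])
    show "0 \<le> p j" for j unfolding p_def using a by (simp add: powr_mono2)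
    show "incseq p \<or> decseq p" using powr_increment_mono[OF a] unfolding p_def .
  qed
  finally show "cmod (\<Sum>t=1..n. complex_of_real (real t powr \<alpha> - real (t - 1) powr \<alpha>) * cis (real t * x)) \<le>
      1 * (1 + 4 * 2 powr \<alpha>) * (real n powr \<alpha> * (real n * x) powr (- min \<alpha> 1))" .
qed (simp add: add_pos_nonneg)

section \<open>Fractional partial sums in mean square\<close>

definition in_L2 :: "'a measure \<Rightarrow> ('a \<Rightarrow> real) \<Rightarrow> bool" where
  "in_L2 M f \<longleftrightarrow> f \<in> borel_measurable M \<and> integrable M (\<lambda>x. (f x)\<^sup>2)"

lemma in_L2_add:
  assumes "in_L2 M f" "in_L2 M g" shows "in_L2 M (\<lambda>x. f x + g x)"
  using assms integrable_mult_square_integrable[of f M g] by (auto simp: in_L2_def power2_sum mult.assoc intro: borel_measurable_add)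

lemma in_L2_cmult: "in_L2 M f \<Longrightarrow> in_L2 M (\<lambda>x. c * f x)"
  by (auto simp: in_L2_def power_mult_distrib intro: borel_measurable_times)

lemma in_L2_zero: "in_L2 M (\<lambda>x. 0)"
  by (simp add: in_L2_def)

lemma in_L2_sum: "(\<And>i. i \<in> A \<Longrightarrow> in_L2 M (f i)) \<Longrightarrow> in_L2 M (\<lambda>x. \<Sum>i\<in>A. f i x)"
  by (induction A rule: infinite_finite_induct) (auto intro: in_L2_add in_L2_zero)

text \<open>The stochastic part of the model, with the order kept variable because differencing
  lowers it by one. Since k < t, only inputs at times at least 1 occur.\<close>

definition frac_sum :: "real \<Rightarrow> (int \<Rightarrow> 'a \<Rightarrow> real) \<Rightarrow> nat \<Rightarrow> 'a \<Rightarrow> real" where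
  "frac_sum d u t \<omega> = (\<Sum>k<t. frac_coeff d k * u (int t - int k) \<omega>)"

lemma frac_sum_0 [simp]: "frac_sum d u 0 \<omega> = 0"
  by (simp add: frac_sum_def)

text \<open>The newest input has coefficient 1 whatever the order, and for the older ones the
  difference rule for the coefficients applies.\<close>

lemma frac_sum_diff: "frac_sum d u (Suc t) \<omega> - frac_sum d u t \<omega> = frac_sum (d - 1) u (Suc t) \<omega>"
proof -
  have "frac_sum e u (Suc t) \<omega> = u (int (Suc t)) \<omega> + (\<Sum>k<t. frac_coeff e (Suc k) * u (int t - int k) \<omega>)" for e
    by (simp add: frac_sum_def sum.lessThan_Suc_shift del: sum.lessThan_Suc)
  then show ?thesis
    by (simp add: frac_sum_def[of d u t] frac_coeff_diff[symmetric] left_diff_distrib sum_subtractf)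
qed

lemma frac_sum_telescope: "(\<Sum>t=1..n. frac_sum (d - 1) u t \<omega>) = frac_sum d u n \<omega>"
  by (induction n) (simp_all add: frac_sum_diff[symmetric])

context stationary_process
begin

lemma in_L2_u: "1 \<le> t \<Longrightarrow> in_L2 M (u t)"
  by (simp add: in_L2_def u_square_integrable)

lemma in_L2_frac_sum: "in_L2 M (frac_sum d u t)"
  unfolding frac_sum_def by (intro in_L2_sum in_L2_cmult in_L2_u) auto

lemma frac_sum_measurable [measurable]: "frac_sum d u t \<in> borel_measurable M"
  using in_L2_frac_sum by (simp add: in_L2_def)

lemma integrable_norm_square_frac_sum_dft:
  "integrable M (\<lambda>\<omega>. (cmod (\<Sum>t=1..n. complex_of_real (frac_sum d u t \<omega>) * c t))\<^sup>2)"
proof -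
  have "in_L2 M (\<lambda>\<omega>. \<Sum>t=1..n. Re (c t) * frac_sum d u t \<omega>)" "in_L2 M (\<lambda>\<omega>. \<Sum>t=1..n. Im (c t) * frac_sum d u t \<omega>)"
    by (intro in_L2_sum in_L2_cmult in_L2_frac_sum)+
  then show ?thesis by (simp add: cmod_power2 in_L2_def mult.commute)
qed

lemma frac_sum_dft_upper:
  "\<exists>C \<delta>. 0 < C \<and> 0 < \<delta> \<and> \<delta> \<le> 1 \<and>
    (\<forall>n e x B T. 0 \<le> x \<longrightarrow> x \<le> \<delta> \<longrightarrow>
      (\<forall>k\<le>n. cmod (\<Sum>j<k. complex_of_real (frac_coeff e j) * cis (real j * x)) \<le> B) \<longrightarrow> (\<Sum>j<n. \<bar>frac_coeff e j\<bar>) \<le> T \<longrightarrow>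
      (\<integral>\<omega>. (cmod (\<Sum>t=1..n. complex_of_real (frac_sum e u t \<omega>) * cis (real t * x)))\<^sup>2 \<partial>M) \<le> C * (real n * B\<^sup>2 + T\<^sup>2))"
proof -
  obtain C \<delta> where C: "0 < C" "0 < \<delta>" "\<delta> \<le> 1" and upper: "\<forall>n (p :: nat \<Rightarrow> real) x B T. 0 \<le> x \<longrightarrow> x \<le> \<delta> \<longrightarrow>
      (\<forall>k\<le>n. cmod (\<Sum>j<k. complex_of_real (p j) * cis (real j * x)) \<le> B) \<longrightarrow> (\<Sum>j<n. \<bar>p j\<bar>) \<le> T \<longrightarrow>
      (\<integral>\<omega>. (cmod (\<Sum>t=1..n. complex_of_real (\<Sum>k<t. p k * u (int t - int k) \<omega>) * cis (real t * x)))\<^sup>2 \<partial>M) \<le> C * (real n * B\<^sup>2 + T\<^sup>2)"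
    using expectation_dft_convolution_upper by (elim exE conjE)
  show ?thesis
  proof (rule exI[of _ C], rule exI[of _ \<delta>], intro conjI allI impI C)
    fix n e x B T
    assume a: "0 \<le> x" "x \<le> \<delta>" "\<forall>k\<le>n. cmod (\<Sum>j<k. complex_of_real (frac_coeff e j) * cis (real j * x)) \<le> B"
      "(\<Sum>j<n. \<bar>frac_coeff e j\<bar>) \<le> T"
    show "(\<integral>\<omega>. (cmod (\<Sum>t=1..n. complex_of_real (frac_sum e u t \<omega>) * cis (real t * x)))\<^sup>2 \<partial>M) \<le> C * (real n * B\<^sup>2 + T\<^sup>2)"
      unfolding frac_sum_def by (rule upper[rule_format, OF a(1,2) _ a(4)]) (use a(3) in simp)
  qed
qed

text \<open>\<open>frac_sum d\<close> is the Fourier sum of \<open>frac_sum (d - 1)\<close> at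
  frequency 0, so the transform bound applies with \<open>B\<close> and \<open>T\<close> both taken
  as a bound for the sum of the absolute coefficients. That sum is at most 2 for d \<le> 1 and at
  most of order \<open>real n powr (d - 1)\<close> otherwise.\<close>

lemma expectation_frac_sum_square_upper:
  assumes d: "0 < d"
  obtains C where "0 < C" "\<And>n. 1 \<le> n \<Longrightarrow> (\<integral>\<omega>. (frac_sum d u n \<omega>)\<^sup>2 \<partial>M) \<le> C * real n powr max 1 (2 * d - 1)"
proof -
  obtain C \<delta> where C: "0 < C" "0 < \<delta>" and upper: "\<forall>n e x B T. 0 \<le> x \<longrightarrow> x \<le> \<delta> \<longrightarrow>
      (\<forall>k\<le>n. cmod (\<Sum>j<k. complex_of_real (frac_coeff e j) * cis (real j * x)) \<le> B) \<longrightarrow> (\<Sum>j<n. \<bar>frac_coeff e j\<bar>) \<le> T \<longrightarrow>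
      (\<integral>\<omega>. (cmod (\<Sum>t=1..n. complex_of_real (frac_sum e u t \<omega>) * cis (real t * x)))\<^sup>2 \<partial>M) \<le> C * (real n * B\<^sup>2 + T\<^sup>2)"
    using frac_sum_dft_upper by (elim exE conjE)
  have *: "(\<integral>\<omega>. (frac_sum d u n \<omega>)\<^sup>2 \<partial>M) \<le> C * (real n * T\<^sup>2 + T\<^sup>2)" if "(\<Sum>j<n. \<bar>frac_coeff (d - 1) j\<bar>) \<le> T" for n T
  proof -
    have "cmod (\<Sum>j<k. complex_of_real (frac_coeff (d - 1) j) * cis (real j * 0)) \<le> T" if "k \<le> n" for k
    proof -
      have "cmod (\<Sum>j<k. complex_of_real (frac_coeff (d - 1) j) * cis (real j * 0)) \<le> (\<Sum>j<k. \<bar>frac_coeff (d - 1) j\<bar>)"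
        by (rule sum_norm_le) simp
      also have "\<dots> \<le> (\<Sum>j<n. \<bar>frac_coeff (d - 1) j\<bar>)" using that by (intro sum_mono2) auto
      finally show ?thesis using \<open>(\<Sum>j<n. \<bar>frac_coeff (d - 1) j\<bar>) \<le> T\<close> by simp
    qed
    then have "(\<integral>\<omega>. (cmod (\<Sum>t=1..n. complex_of_real (frac_sum (d - 1) u t \<omega>) * cis (real t * 0)))\<^sup>2 \<partial>M) \<le> C * (real n * T\<^sup>2 + T\<^sup>2)"
      using that C(2) by (intro upper[rule_format]) auto
    moreover have "(cmod (\<Sum>t=1..n. complex_of_real (frac_sum (d - 1) u t \<omega>) * cis (real t * 0)))\<^sup>2 = (frac_sum d u n \<omega>)\<^sup>2" for \<omega>
    proof -
      have "(\<Sum>t=1..n. complex_of_real (frac_sum (d - 1) u t \<omega>) * cis (real t * 0)) = complex_of_real (\<Sum>t=1..n. frac_sum (d - 1) u t \<omega>)"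
        by simp
      then show ?thesis unfolding frac_sum_telescope by (simp only: norm_of_real power2_abs)
    qed
    ultimately show ?thesis by simp
  qed
  show ?thesis
  proof (cases "d \<le> 1")
    case True
    show ?thesis
    proof (rule that[of "C * 8"])
      fix n :: nat assume n: "1 \<le> n"
      have "(\<integral>\<omega>. (frac_sum d u n \<omega>)\<^sup>2 \<partial>M) \<le> C * (real n * 2\<^sup>2 + 2\<^sup>2)"
        by (rule *) (rule frac_coeff_diff_sum_abs_le[OF d True])
      also have "\<dots> \<le> C * (8 * real n)" using n C by (intro mult_left_mono) auto
      also have "\<dots> = C * 8 * real n powr max 1 (2 * d - 1)" using n True by (simp add: max_def)
      finally show "(\<integral>\<omega>. (frac_sum d u n \<omega>)\<^sup>2 \<partial>M) \<le> C * 8 * real n powr max 1 (2 * d - 1)" .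
    qed (use C in simp)
  next
    case False
    then have e: "0 < d - 1" by simp
    obtain K where K: "0 < K" "\<And>k. (\<Sum>j<k. frac_coeff (d - 1) j) \<le> K * real k powr (d - 1)"
      using frac_coeff_sum_upper[OF e] by metis
    show ?thesis
    proof (rule that[of "C * 2 * K\<^sup>2"])
      fix n :: nat assume n: "1 \<le> n"
      have "(\<integral>\<omega>. (frac_sum d u n \<omega>)\<^sup>2 \<partial>M) \<le> C * (real n * (K * real n powr (d - 1))\<^sup>2 + (K * real n powr (d - 1))\<^sup>2)"
        by (rule *) (use K(2)[of n] frac_coeff_pos[OF e] in \<open>simp add: abs_of_pos\<close>)
      also have "\<dots> \<le> C * (real n * (K * real n powr (d - 1))\<^sup>2 + real n * (K * real n powr (d - 1))\<^sup>2)"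
        using n C by (intro mult_left_mono add_left_mono mult_right_mono[of 1, simplified]) (auto simp: mult_le_cancel_right1)
      also have "\<dots> = C * 2 * K\<^sup>2 * (real n powr 1 * (real n powr (d - 1) * real n powr (d - 1)))"
        using n by (simp add: power2_eq_square algebra_simps)
      also have "real n powr 1 * (real n powr (d - 1) * real n powr (d - 1)) = real n powr max 1 (2 * d - 1)"
        using False by (simp only: powr_add[symmetric]) (simp add: max_def)
      finally show "(\<integral>\<omega>. (frac_sum d u n \<omega>)\<^sup>2 \<partial>M) \<le> C * 2 * K\<^sup>2 * real n powr max 1 (2 * d - 1)" .
    qed (use C K in simp)
  qed
qed

lemma fourier_freq_scaled:
  assumes "1 \<le> s" "s \<le> n"
  shows "0 < fourier_freq n s" "real s \<le> real n * fourier_freq n s" "1 \<le> real n * fourier_freq n s"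
proof -
  have "1 * real s \<le> 2 * pi * real s" using pi_gt3 by (intro mult_right_mono) auto
  then show "real s \<le> real n * fourier_freq n s" using assms by (simp add: fourier_freq_def)
  moreover have "1 \<le> real s" using assms by simp
  ultimately show "1 \<le> real n * fourier_freq n s" by linarith
  show "0 < fourier_freq n s" using assms by (simp add: fourier_freq_def)
qed

text \<open>As s \<le> n, a surplus negative power of n can be spent as decay in s.\<close>

lemma powr_trade:
  fixes n s :: real
  assumes "1 \<le> s" "s \<le> n" "0 \<le> b" "k \<le> b"
  shows "n powr (- b) \<le> s powr (- k)"
proof -
  have "n powr (- b) \<le> s powr (- b)" using assms by (intro powr_mono2') auto
  also have "\<dots> \<le> s powr (- k)" using assms by (intro powr_mono) auto
  finally show ?thesis .
qed

text \<open>For d \<le> 1 the absolute filter coefficients sum to at most 2, the second moment is of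
  order at most n, and the surplus \<open>2 * \<beta> - 1 > 0\<close> is traded for decay in s. For
  d > 1 the coefficients are positive and monotone: the part near the origin decays in s with
  exponent \<open>2 * min (d - 1) 1\<close>, and the far part is smaller than
  \<open>real n powr (2 * d - 1)\<close> by a factor n, which is traded as well.\<close>

lemma frac_sum_dft_bound:
  assumes d: "1 / 2 < d" and \<beta>: "1 / 2 < \<beta>" "d - 1 / 2 \<le> \<beta>"
  shows "\<exists>C \<kappa> \<delta>. 0 < C \<and> 0 < \<kappa> \<and> \<kappa> \<le> 1 \<and> 0 < \<delta> \<and> \<delta> \<le> 1 \<and>
    (\<forall>n s. 1 \<le> s \<longrightarrow> s \<le> n \<longrightarrow> fourier_freq n s \<le> \<delta> \<longrightarrow>
      (\<integral>\<omega>. (cmod (\<Sum>t=1..n. complex_of_real (frac_sum (d - 1) u t \<omega>) * cis (real t * fourier_freq n s)))\<^sup>2 \<partial>M) \<le>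
        C * (real n powr (2 * \<beta>) * real s powr (- \<kappa>)))"
proof -
  obtain C \<delta> where C: "0 < C" "0 < \<delta>" "\<delta> \<le> 1" and upper: "\<forall>n e x B T. 0 \<le> x \<longrightarrow> x \<le> \<delta> \<longrightarrow>
      (\<forall>k\<le>n. cmod (\<Sum>j<k. complex_of_real (frac_coeff e j) * cis (real j * x)) \<le> B) \<longrightarrow> (\<Sum>j<n. \<bar>frac_coeff e j\<bar>) \<le> T \<longrightarrow>
      (\<integral>\<omega>. (cmod (\<Sum>t=1..n. complex_of_real (frac_sum e u t \<omega>) * cis (real t * x)))\<^sup>2 \<partial>M) \<le> C * (real n * B\<^sup>2 + T\<^sup>2)"
    using frac_sum_dft_upper by (elim exE conjE)
  let ?E = "\<lambda>n s. \<integral>\<omega>. (cmod (\<Sum>t=1..n. complex_of_real (frac_sum (d - 1) u t \<omega>) * cis (real t * fourier_freq n s)))\<^sup>2 \<partial>M"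
  show ?thesis
  proof (cases "d \<le> 1")
    case True
    define \<kappa> where "\<kappa> = min 1 (2 * \<beta> - 1)"
    have sum_le: "(\<Sum>j<n. \<bar>frac_coeff (d - 1) j\<bar>) \<le> 2" for n
      using frac_coeff_diff_sum_abs_le[of d n] True d by simp
    have E: "?E n s \<le> C * 8 * (real n powr (2 * \<beta>) * real s powr (- \<kappa>))" if s: "1 \<le> s" "s \<le> n" "fourier_freq n s \<le> \<delta>" for n s
    proof -
      have "?E n s \<le> C * (real n * 2\<^sup>2 + 2\<^sup>2)"
      proof (rule upper[rule_format])
        show "cmod (\<Sum>j<k. complex_of_real (frac_coeff (d - 1) j) * cis (real j * fourier_freq n s)) \<le> 2" for k
          by (rule order_trans[OF sum_norm_le[where g = "\<lambda>j. \<bar>frac_coeff (d - 1) j\<bar>"] sum_le]) (simp add: norm_mult)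
      qed (use s sum_le in \<open>auto simp: fourier_freq_def\<close>)
      also have "\<dots> \<le> C * (8 * real n)" using s C by (intro mult_left_mono) auto
      also have "real n = real n powr (2 * \<beta>) * real n powr (- (2 * \<beta> - 1))"
        using s by (simp only: powr_add[symmetric]) simp
      also have "C * (8 * (real n powr (2 * \<beta>) * real n powr (- (2 * \<beta> - 1)))) \<le> C * (8 * (real n powr (2 * \<beta>) * real s powr (- \<kappa>)))"
        using s C \<beta> by (intro mult_left_mono powr_trade) (auto simp: \<kappa>_def)
      finally show ?thesis by (simp only: mult.assoc)
    qed
    have "0 < \<kappa>" "\<kappa> \<le> 1" using \<beta> by (auto simp: \<kappa>_def)
    with C show ?thesis
      by - (rule exI[of _ "C * 8"], rule exI[of _ \<kappa>], rule exI[of _ \<delta>], intro conjI allI impI E, simp_all)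
  next
    case False
    then have e: "0 < d - 1" by simp
    obtain K where K: "0 < K" "\<And>k. (\<Sum>j<k. frac_coeff (d - 1) j) \<le> K * real k powr (d - 1)"
      using frac_coeff_sum_upper[OF e] by metis
    define K' where "K' = K * (1 + 4 * 2 powr (d - 1))"
    have K': "0 < K'" "K \<le> K'" using K by (auto simp: K'_def add_pos_nonneg)
    define g where "g = min (d - 1) 1"
    define \<kappa> where "\<kappa> = min 1 (2 * g)"
    have g: "0 < g" "\<kappa> \<le> 2 * g" "0 < \<kappa>" "\<kappa> \<le> 1" using e by (auto simp: g_def \<kappa>_def)
    have E: "?E n s \<le> C * (K'\<^sup>2 * 2) * (real n powr (2 * \<beta>) * real s powr (- \<kappa>))" if s: "1 \<le> s" "s \<le> n" "fourier_freq n s \<le> \<delta>" for n s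
    proof -
      let ?x = "fourier_freq n s"
      have x: "0 < ?x" "?x \<le> 1" "1 \<le> real n * ?x" "real s \<le> real n * ?x"
  using fourier_freq_scaled[OF s(1,2)] s(3) C by auto
      have "?E n s \<le> C * (real n * (K' * (real n powr (d - 1) * (real n * ?x) powr (- g)))\<^sup>2 + (K * real n powr (d - 1))\<^sup>2)"
      proof (rule upper[rule_format])
        show "cmod (\<Sum>j<k. complex_of_real (frac_coeff (d - 1) j) * cis (real j * ?x)) \<le> K' * (real n powr (d - 1) * (real n * ?x) powr (- g))"
          if "k \<le> n" for k
          unfolding K'_def g_def
          by (rule mono_trig_sum_bound[OF _ frac_coeff_mono[OF e] e K(2) x(1,2,3) that])
            (simp add: less_imp_le frac_coeff_pos[OF e])
        show "(\<Sum>j<n. \<bar>frac_coeff (d - 1) j\<bar>) \<le> K * real n powr (d - 1)"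
          using K(2)[of n] frac_coeff_pos[OF e] by (simp add: abs_of_pos)
      qed (use x s in auto)
      also have "real n * (K' * (real n powr (d - 1) * (real n * ?x) powr (- g)))\<^sup>2 =
          K'\<^sup>2 * ((real n powr 1 * (real n powr (d - 1) * real n powr (d - 1))) * ((real n * ?x) powr (- g) * (real n * ?x) powr (- g)))"
        using s by (simp add: power2_eq_square mult_ac)
      also have "\<dots> = K'\<^sup>2 * (real n powr (2 * d - 1) * (real n * ?x) powr (- (2 * g)))"
        by (simp only: powr_add[symmetric]) (simp add: algebra_simps)
      also have "\<dots> \<le> K'\<^sup>2 * (real n powr (2 * \<beta>) * real s powr (- \<kappa>))"
        using s x g \<beta> by (intro mult_left_mono mult_mono powr_mono powr_trade) auto
      also have "(K * real n powr (d - 1))\<^sup>2 \<le> (K' * real n powr (d - 1))\<^sup>2"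
        using K K' by (intro power_mono mult_right_mono) auto
      also have "(K' * real n powr (d - 1))\<^sup>2 = K'\<^sup>2 * (real n powr (d - 1) * real n powr (d - 1))"
        by (simp add: power2_eq_square)
      also have "real n powr (d - 1) * real n powr (d - 1) = real n powr (2 * d - 1) * real n powr (- 1)"
        by (simp only: powr_add[symmetric]) simp
      also have "\<dots> \<le> real n powr (2 * \<beta>) * real s powr (- \<kappa>)"
        using s g \<beta> by (intro mult_mono powr_mono powr_trade) auto
      finally have "?E n s \<le> C * (K'\<^sup>2 * (real n powr (2 * \<beta>) * real s powr (- \<kappa>)) + K'\<^sup>2 * (real n powr (2 * \<beta>) * real s powr (- \<kappa>)))"
        using C K' by (simp add: mult_left_mono)
      then show ?thesis by (simp add: algebra_simps)
    qed
    show ?thesis using C K' g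
      by - (rule exI[of _ "C * (K'\<^sup>2 * 2)"], rule exI[of _ \<kappa>], rule exI[of _ \<delta>], intro conjI allI impI E, simp_all)
  qed
qed

lemma increments_dft_bound:
  fixes \<mu> :: real
  assumes d: "1 / 2 < d" and \<alpha>: "1 / 2 < \<alpha>" and \<beta>: "\<alpha> \<le> \<beta>" "d - 1 / 2 \<le> \<beta>"
  defines "V \<equiv> \<lambda>t \<omega>. frac_sum d u t \<omega> + \<mu> * real t powr \<alpha>"
  shows "\<exists>C \<kappa> \<delta>. 0 < C \<and> 0 < \<kappa> \<and> \<kappa> \<le> 1 \<and> 0 < \<delta> \<and> \<delta> \<le> 1 \<and>
    (\<forall>n s. 1 \<le> s \<longrightarrow> s \<le> n \<longrightarrow> fourier_freq n s \<le> \<delta> \<longrightarrow>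
      integrable M (\<lambda>\<omega>. (cmod (\<Sum>t=1..n. complex_of_real (V t \<omega> - V (t - 1) \<omega>) * cis (real t * fourier_freq n s)))\<^sup>2) \<and>
      (\<integral>\<omega>. (cmod (\<Sum>t=1..n. complex_of_real (V t \<omega> - V (t - 1) \<omega>) * cis (real t * fourier_freq n s)))\<^sup>2 \<partial>M) \<le>
        C * (real n powr (2 * \<beta>) * real s powr (- \<kappa>)))"
proof -
  have b: "1 / 2 < \<beta>" using \<alpha> \<beta> by simp
  obtain C \<kappa> \<delta> where C: "0 < C" "0 < \<kappa>" "\<kappa> \<le> 1" "0 < \<delta>" "\<delta> \<le> 1" and noise: "\<forall>n s. 1 \<le> s \<longrightarrow> s \<le> n \<longrightarrow> fourier_freq n s \<le> \<delta> \<longrightarrow>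
      (\<integral>\<omega>. (cmod (\<Sum>t=1..n. complex_of_real (frac_sum (d - 1) u t \<omega>) * cis (real t * fourier_freq n s)))\<^sup>2 \<partial>M) \<le>
        C * (real n powr (2 * \<beta>) * real s powr (- \<kappa>))"
    using frac_sum_dft_bound[OF d b \<beta>(2)] by (elim exE conjE)
  obtain K where K: "0 < K" and trend: "\<forall>n x. 0 < x \<longrightarrow> x \<le> 1 \<longrightarrow> 1 \<le> real n * x \<longrightarrow>
    cmod (\<Sum>t=1..n. complex_of_real (real t powr \<alpha> - real (t - 1) powr \<alpha>) * cis (real t * x)) \<le>
      K * (real n powr \<alpha> * (real n * x) powr (- min \<alpha> 1))"
    using trend_increment_dft_bound[of \<alpha>] \<alpha> by auto
  define C' where "C' = 2 * C + 2 * (\<mu> * K)\<^sup>2"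
  have E: "integrable M (\<lambda>\<omega>. (cmod (\<Sum>t=1..n. complex_of_real (V t \<omega> - V (t - 1) \<omega>) * cis (real t * fourier_freq n s)))\<^sup>2) \<and>
      (\<integral>\<omega>. (cmod (\<Sum>t=1..n. complex_of_real (V t \<omega> - V (t - 1) \<omega>) * cis (real t * fourier_freq n s)))\<^sup>2 \<partial>M) \<le>
        C' * (real n powr (2 * \<beta>) * real s powr (- \<kappa>))"
    if s: "1 \<le> s" "s \<le> n" "fourier_freq n s \<le> \<delta>" for n s
  proof -
    let ?x = "fourier_freq n s"
    define N where "N \<omega> = (\<Sum>t=1..n. complex_of_real (frac_sum (d - 1) u t \<omega>) * cis (real t * ?x))" for \<omega>
    define T where "T = (\<Sum>t=1..n. complex_of_real (real t powr \<alpha> - real (t - 1) powr \<alpha>) * cis (real t * ?x))"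
    have x: "0 < ?x" "?x \<le> 1" "1 \<le> real n * ?x" "real s \<le> real n * ?x"
  using fourier_freq_scaled[OF s(1,2)] s(3) C by auto
    have split: "(\<Sum>t=1..n. complex_of_real (V t \<omega> - V (t - 1) \<omega>) * cis (real t * ?x)) = N \<omega> + complex_of_real \<mu> * T" for \<omega>
    proof -
      have "complex_of_real (V t \<omega> - V (t - 1) \<omega>) * cis (real t * ?x) =
          complex_of_real (frac_sum (d - 1) u t \<omega>) * cis (real t * ?x) +
          complex_of_real \<mu> * (complex_of_real (real t powr \<alpha> - real (t - 1) powr \<alpha>) * cis (real t * ?x))" if "t \<in> {1..n}" for t
      proof -
        have "Suc (t - 1) = t" using that by auto
        then have "V t \<omega> - V (t - 1) \<omega> = frac_sum (d - 1) u t \<omega> + \<mu> * (real t powr \<alpha> - real (t - 1) powr \<alpha>)"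
          using frac_sum_diff[of d u "t - 1" \<omega>] by (simp add: V_def right_diff_distrib)
        then show ?thesis by (simp only: of_real_add of_real_mult distrib_right mult.assoc)
      qed
      then show ?thesis by (simp only: N_def T_def sum_distrib_left sum.distrib[symmetric] cong: sum.cong)
    qed
    have sq: "(cmod (N \<omega> + complex_of_real \<mu> * T))\<^sup>2 \<le> 2 * (cmod (N \<omega>))\<^sup>2 + 2 * (\<mu> * cmod T)\<^sup>2" for \<omega>
    proof -
      have "(cmod (N \<omega> + complex_of_real \<mu> * T))\<^sup>2 \<le> (cmod (N \<omega>) + \<bar>\<mu>\<bar> * cmod T)\<^sup>2"
        using norm_triangle_ineq[of "N \<omega>" "complex_of_real \<mu> * T"] by (intro power_mono) (auto simp: norm_mult)
      also have "\<dots> \<le> 2 * (cmod (N \<omega>))\<^sup>2 + 2 * (\<bar>\<mu>\<bar> * cmod T)\<^sup>2"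
        using sum_squares_bound[of "cmod (N \<omega>)" "\<bar>\<mu>\<bar> * cmod T"] by (simp add: power2_sum)
      finally show ?thesis by (simp add: power_mult_distrib)
    qed
    have N_int: "integrable M (\<lambda>\<omega>. (cmod (N \<omega>))\<^sup>2)"
      unfolding N_def by (rule integrable_norm_square_frac_sum_dft)
    have N_meas [measurable]: "N \<in> borel_measurable M" unfolding N_def by measurable
    have sum_int: "integrable M (\<lambda>\<omega>. 2 * (cmod (N \<omega>))\<^sup>2 + 2 * (\<mu> * cmod T)\<^sup>2)" using N_int by simp
    have int: "integrable M (\<lambda>\<omega>. (cmod (N \<omega> + complex_of_real \<mu> * T))\<^sup>2)"
      by (rule Bochner_Integration.integrable_bound[OF sum_int]) (use sq in auto)
    have "cmod T \<le> K * (real n powr \<alpha> * (real n * ?x) powr (- min \<alpha> 1))"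
      unfolding T_def by (rule trend[rule_format, OF x(1,2,3)])
    then have "(\<mu> * cmod T)\<^sup>2 \<le> (\<mu> * (K * (real n powr \<alpha> * (real n * ?x) powr (- min \<alpha> 1))))\<^sup>2"
      unfolding power_mult_distrib[of \<mu>] by (intro mult_left_mono power_mono) auto
    also have "\<dots> = (\<mu> * K)\<^sup>2 * ((real n powr \<alpha> * real n powr \<alpha>) * ((real n * ?x) powr (- min \<alpha> 1) * (real n * ?x) powr (- min \<alpha> 1)))"
      by (simp add: power2_eq_square mult_ac)
    also have "\<dots> = (\<mu> * K)\<^sup>2 * (real n powr (2 * \<alpha>) * (real n * ?x) powr (- (2 * min \<alpha> 1)))"
      by (simp only: powr_add[symmetric]) (simp add: algebra_simps)
    \<comment> \<open>Since \<alpha> > 1 / 2, twice \<open>min \<alpha> 1\<close> is at least 1 and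
      hence at least \<kappa>; this is what the cap \<kappa> \<le> 1 provides.\<close>
    also have "\<dots> \<le> (\<mu> * K)\<^sup>2 * (real n powr (2 * \<beta>) * real s powr (- \<kappa>))"
      using s x C \<alpha> \<beta> by (intro mult_left_mono mult_mono powr_mono powr_trade) auto
    finally have T: "(\<mu> * cmod T)\<^sup>2 \<le> (\<mu> * K)\<^sup>2 * (real n powr (2 * \<beta>) * real s powr (- \<kappa>))" .
    have "(\<integral>\<omega>. (cmod (N \<omega> + complex_of_real \<mu> * T))\<^sup>2 \<partial>M) \<le> (\<integral>\<omega>. 2 * (cmod (N \<omega>))\<^sup>2 + 2 * (\<mu> * cmod T)\<^sup>2 \<partial>M)"
      by (rule integral_mono[OF int sum_int]) (rule sq)
    also have "\<dots> = 2 * (\<integral>\<omega>. (cmod (N \<omega>))\<^sup>2 \<partial>M) + 2 * (\<mu> * cmod T)\<^sup>2"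
      using N_int by (simp add: prob_space)
    also have "\<dots> \<le> 2 * (C * (real n powr (2 * \<beta>) * real s powr (- \<kappa>))) + 2 * ((\<mu> * K)\<^sup>2 * (real n powr (2 * \<beta>) * real s powr (- \<kappa>)))"
      using noise[rule_format, OF s] T unfolding N_def by (intro add_mono mult_left_mono) auto
    also have "\<dots> = C' * (real n powr (2 * \<beta>) * real s powr (- \<kappa>))"
      by (simp add: C'_def algebra_simps)
    finally show ?thesis using int by (simp only: split)
  qed
  have "0 < C'" using C by (simp add: C'_def add_pos_nonneg)
  with C show ?thesis
    by - (rule exI[of _ C'], rule exI[of _ \<kappa>], rule exI[of _ \<delta>], intro conjI allI impI E[THEN conjunct1] E[THEN conjunct2], simp_all)
qed

end

section \<open>The linear process\<close>

lemma (in prob_space) prob_abs_ge_le_square: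
  assumes "in_L2 M X" "0 < a"
  shows "prob {\<omega> \<in> space M. a \<le> \<bar>X \<omega>\<bar>} \<le> (\<integral>\<omega>. (X \<omega>)\<^sup>2 \<partial>M) / a\<^sup>2"
proof -
  have [measurable]: "X \<in> borel_measurable M" using assms by (simp add: in_L2_def)
  have "{\<omega> \<in> space M. a \<le> \<bar>X \<omega>\<bar>} = {\<omega> \<in> space M. a\<^sup>2 \<le> (X \<omega>)\<^sup>2}"
    using assms(2) by (auto simp: abs_le_square_iff[symmetric])
  also have "prob \<dots> \<le> (\<integral>\<omega>. (X \<omega>)\<^sup>2 \<partial>M) / a\<^sup>2"
    by (rule integral_Markov_inequality_measure[where A = "{}"]) (use assms in \<open>auto simp: in_L2_def\<close>)
  finally show ?thesis .
qed

lemma in_L2_diff: "in_L2 M f \<Longrightarrow> in_L2 M g \<Longrightarrow> in_L2 M (\<lambda>x. f x - g x)"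
  using in_L2_add[OF _ in_L2_cmult[of M g "-1"], of f] by simp

lemma in_L2_integral_square_sum_le:
  assumes "\<And>k. k \<in> A \<Longrightarrow> in_L2 M (X k)"
  shows "(\<integral>\<omega>. (\<Sum>k\<in>A. p k * X k \<omega>)\<^sup>2 \<partial>M) \<le> (\<Sum>k\<in>A. (p k)\<^sup>2) * (\<Sum>k\<in>A. (\<integral>\<omega>. (X k \<omega>)\<^sup>2 \<partial>M))"
proof -
  have int: "integrable M (\<lambda>\<omega>. (X k \<omega>)\<^sup>2)" if "k \<in> A" for k using assms[OF that] by (simp add: in_L2_def)
  have "(\<integral>\<omega>. (\<Sum>k\<in>A. p k * X k \<omega>)\<^sup>2 \<partial>M) \<le> (\<integral>\<omega>. (\<Sum>k\<in>A. (p k)\<^sup>2) * (\<Sum>k\<in>A. (X k \<omega>)\<^sup>2) \<partial>M)"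
  proof (rule integral_mono)
    show "integrable M (\<lambda>\<omega>. (\<Sum>k\<in>A. p k * X k \<omega>)\<^sup>2)"
    proof -
      have "in_L2 M (\<lambda>\<omega>. \<Sum>k\<in>A. p k * X k \<omega>)" by (intro in_L2_sum in_L2_cmult assms)
      then show ?thesis by (simp add: in_L2_def)
    qed
    show "integrable M (\<lambda>\<omega>. (\<Sum>k\<in>A. (p k)\<^sup>2) * (\<Sum>k\<in>A. (X k \<omega>)\<^sup>2))"
      by (intro integrable_mult_right Bochner_Integration.integrable_sum int)
  qed (rule Cauchy_Schwarz_ineq_sum)
  also have "\<dots> = (\<Sum>k\<in>A. (p k)\<^sup>2) * (\<Sum>k\<in>A. (\<integral>\<omega>. (X k \<omega>)\<^sup>2 \<partial>M))"
    using int by (simp add: Bochner_Integration.integral_sum)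
  finally show ?thesis .
qed

locale linear_stationary_process = stationary_process M u f + martingale_innovations M \<epsilon>
  for M :: "'a measure" and u f \<epsilon> +
  fixes c :: "nat \<Rightarrow> real"
  assumes linear: "linear_process M c \<epsilon> u"
begin

lemma c_square_summable: "summable (\<lambda>j. (c j)\<^sup>2)"
  using linear by (simp add: linear_process_def)

lemma in_L2_\<epsilon>: "in_L2 M (\<epsilon> t)"
  by (simp add: in_L2_def \<epsilon>_square_integrable)

definition truncated_frac_sum :: "real \<Rightarrow> nat \<Rightarrow> nat \<Rightarrow> 'a \<Rightarrow> real" where
  "truncated_frac_sum d n N \<omega> = (\<Sum>k<n. frac_coeff d k * (\<Sum>j<N. c j * \<epsilon> (int n - int k - int j) \<omega>))"

text \<open>The coefficient of \<open>\<epsilon> (int n - int i)\<close> once the double sum is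
  collected by innovations: a truncated convolution of \<open>c\<close> with the filter
  coefficients. The condition \<open>j \<le> i\<close> guards the subtraction of natural
  numbers.\<close>

definition innovation_weight :: "real \<Rightarrow> nat \<Rightarrow> nat \<Rightarrow> nat \<Rightarrow> real" where
  "innovation_weight d n N i = (\<Sum>j | j < N \<and> j \<le> i \<and> i - j < n. c j * frac_coeff d (i - j))"

lemma truncated_frac_sum_eq:
  "truncated_frac_sum d n N \<omega> = (\<Sum>i<n + N. innovation_weight d n N i * \<epsilon> (int n - int i) \<omega>)"
proof -
  let ?S = "{..<n} \<times> {..<N}"
  let ?h = "\<lambda>(k, j). c j * frac_coeff d k * \<epsilon> (int n - int (k + j)) \<omega>"
  have "truncated_frac_sum d n N \<omega> = (\<Sum>x\<in>?S. ?h x)"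
    by (simp add: truncated_frac_sum_def sum.cartesian_product[symmetric] sum_distrib_left mult_ac diff_diff_eq)
  also have "\<dots> = (\<Sum>i<n + N. \<Sum>x | x \<in> ?S \<and> fst x + snd x = i. ?h x)"
    by (rule sum.group[symmetric]) auto
  also have "\<dots> = (\<Sum>i<n + N. innovation_weight d n N i * \<epsilon> (int n - int i) \<omega>)"
  proof (intro sum.cong refl)
    fix i
    have "(\<Sum>x | x \<in> ?S \<and> fst x + snd x = i. ?h x) =
        (\<Sum>j | j < N \<and> j \<le> i \<and> i - j < n. c j * frac_coeff d (i - j) * \<epsilon> (int n - int i) \<omega>)"
      by (rule sum.reindex_bij_witness[of _ "\<lambda>j. (i - j, j)" snd]) auto
    then show "(\<Sum>x | x \<in> ?S \<and> fst x + snd x = i. ?h x) = innovation_weight d n N i * \<epsilon> (int n - int i) \<omega>"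
      by (simp add: innovation_weight_def sum_distrib_right)
  qed
  finally show ?thesis .
qed

lemma in_L2_truncated: "in_L2 M (truncated_frac_sum d n N)"
  unfolding truncated_frac_sum_def by (intro in_L2_sum in_L2_cmult in_L2_\<epsilon>)

lemma expectation_truncated_square:
  "(\<integral>\<omega>. (truncated_frac_sum d n N \<omega>)\<^sup>2 \<partial>M) = (\<Sum>i<n + N. (innovation_weight d n N i)\<^sup>2)"
  unfolding truncated_frac_sum_eq by (rule expectation_sum_innovations_square) (auto simp: inj_on_def)

text \<open>For fixed n finitely many inputs are involved, each approximated in mean square by its
  truncated series, and Cauchy-Schwarz combines the errors. The convergence comes without uniformity
  in n, so the truncation depth has to depend on n later.\<close>

lemma truncated_frac_sum_tendsto:
  "(\<lambda>N. \<integral>\<omega>. (frac_sum d u n \<omega> - truncated_frac_sum d n N \<omega>)\<^sup>2 \<partial>M) \<longlonglongrightarrow> 0"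
proof -
  let ?e = "\<lambda>N k \<omega>. u (int n - int k) \<omega> - (\<Sum>j<N. c j * \<epsilon> (int n - int k - int j) \<omega>)"
  have lim: "(\<lambda>N. \<integral>\<omega>. (?e N k \<omega>)\<^sup>2 \<partial>M) \<longlonglongrightarrow> 0" if "k \<in> {..<n}" for k
    using linear that unfolding linear_process_def by auto
  have "(\<lambda>N. (\<Sum>k<n. (frac_coeff d k)\<^sup>2) * (\<Sum>k<n. \<integral>\<omega>. (?e N k \<omega>)\<^sup>2 \<partial>M)) \<longlonglongrightarrow> (\<Sum>k<n. (frac_coeff d k)\<^sup>2) * (\<Sum>k<n. 0)"
    by (intro tendsto_mult tendsto_const tendsto_sum lim)
  then have upper: "(\<lambda>N. (\<Sum>k<n. (frac_coeff d k)\<^sup>2) * (\<Sum>k<n. \<integral>\<omega>. (?e N k \<omega>)\<^sup>2 \<partial>M)) \<longlonglongrightarrow> 0" by simp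
  have bound: "(\<integral>\<omega>. (frac_sum d u n \<omega> - truncated_frac_sum d n N \<omega>)\<^sup>2 \<partial>M) \<le>
      (\<Sum>k<n. (frac_coeff d k)\<^sup>2) * (\<Sum>k<n. \<integral>\<omega>. (?e N k \<omega>)\<^sup>2 \<partial>M)" for N
  proof -
    have "frac_sum d u n \<omega> - truncated_frac_sum d n N \<omega> = (\<Sum>k<n. frac_coeff d k * ?e N k \<omega>)" for \<omega>
      by (simp add: frac_sum_def truncated_frac_sum_def right_diff_distrib sum_subtractf)
    then show ?thesis
      by (simp only:) (intro in_L2_integral_square_sum_le in_L2_diff in_L2_u in_L2_sum in_L2_cmult in_L2_\<epsilon>, auto)
  qed
  show ?thesis
    by (rule tendsto_sandwich[OF _ _ tendsto_const upper]) (auto intro: always_eventually bound)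
qed

text \<open>The first \<open>J\<close> coefficients contribute only the order of a single \<open>frac_coeff d k\<close>; the tail of
  the square-summable sequence is handled by Cauchy--Schwarz.\<close>

lemma innovation_weight_small:
  assumes d: "1 < d" and b: "0 < b"
  shows "\<forall>\<^sub>F n in sequentially. \<forall>N i. \<bar>innovation_weight d n N i\<bar> \<le> b * real n powr (d - 1 / 2)"
proof -
  obtain C where C: "0 < C" "\<And>k. frac_coeff d k \<le> C * real (k + 1) powr (d - 1)"
    using frac_coeff_bounds[of d] d by (metis less_trans zero_less_one)
  \<comment> \<open>The tail of the squared coefficients of \<open>c\<close>, times at most n
    squares of filter coefficients of size at most \<open>C * real n powr (d - 1)\<close>, has a
    square root of at most \<open>C * sqrt \<eta> * real n powr (d - 1 / 2)\<close>; this \<eta>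
    makes it half of the allowance.\<close>
  define \<eta> where "\<eta> = (b / (2 * C))\<^sup>2"
  have \<eta>: "0 < \<eta>" "C * sqrt \<eta> = b / 2" using b C by (auto simp: \<eta>_def)
  obtain J where J: "\<And>m n. J \<le> m \<Longrightarrow> norm (\<Sum>k=m..n. (c k)\<^sup>2) < \<eta>"
    using summable_partial_sum_bound[OF c_square_summable \<eta>(1)] by blast
  define K where "K = C * (\<Sum>j<J. \<bar>c j\<bar>)"
  have "(\<lambda>n. K * real n powr (- 1 / 2)) \<longlonglongrightarrow> K * 0"
    by (intro tendsto_intros) real_asymp
  then have "\<forall>\<^sub>F n in sequentially. K * real n powr (- 1 / 2) < b / 2"
    using b by (intro order_tendstoD(2)) auto
  then show ?thesis
    using eventually_gt_at_top[of 0]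
  proof eventually_elim
    case (elim n)
    have \<pi>: "0 \<le> frac_coeff d k" "frac_coeff d k \<le> C * real n powr (d - 1)" if "k < n" for k
    proof -
      show "0 \<le> frac_coeff d k" using d by (intro less_imp_le frac_coeff_pos) auto
      have "real (k + 1) powr (d - 1) \<le> real n powr (d - 1)" using that d by (intro powr_mono2) auto
      then show "frac_coeff d k \<le> C * real n powr (d - 1)" using C by (intro order_trans[OF C(2)] mult_left_mono) auto
    qed
    show ?case
    proof (intro allI)
      fix N i
      define S where "S = {j. j < N \<and> j \<le> i \<and> i - j < n}"
      have fin: "finite S" by (simp add: S_def)
      \<comment> \<open>For fixed i, distinct j give distinct lags i - j below n, so the count does
        not grow with \<open>N\<close>.\<close>
      have card: "card S \<le> n"
      proof -
        have "card S \<le> card {..<n}"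
          by (rule card_inj_on_le[where f = "\<lambda>j. i - j"]) (auto simp: inj_on_def S_def)
        then show ?thesis by simp
      qed
      have "\<bar>innovation_weight d n N i\<bar> \<le> (\<Sum>j\<in>S. \<bar>c j\<bar> * frac_coeff d (i - j))"
        unfolding innovation_weight_def S_def[symmetric]
        by (rule order_trans[OF sum_abs sum_mono]) (use \<pi> in \<open>auto simp: abs_mult S_def\<close>)
      also have "\<dots> = (\<Sum>j\<in>S \<inter> {..<J}. \<bar>c j\<bar> * frac_coeff d (i - j)) + (\<Sum>j\<in>S - {..<J}. \<bar>c j\<bar> * frac_coeff d (i - j))"
        by (rule sum.Int_Diff[OF fin])
      also have "(\<Sum>j\<in>S \<inter> {..<J}. \<bar>c j\<bar> * frac_coeff d (i - j)) \<le> (\<Sum>j\<in>S \<inter> {..<J}. \<bar>c j\<bar> * (C * real n powr (d - 1)))"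
        using \<pi> by (intro sum_mono mult_left_mono) (auto simp: S_def)
      also have "\<dots> \<le> (\<Sum>j<J. \<bar>c j\<bar> * (C * real n powr (d - 1)))"
        using C by (intro sum_mono2) auto
      also have "\<dots> = K * real n powr (- 1 / 2) * real n powr (d - 1 / 2)"
      proof -
        have "real n powr (d - 1) = real n powr (- 1 / 2) * real n powr (d - 1 / 2)"
          by (simp only: powr_add[symmetric]) simp
        then show ?thesis unfolding K_def sum_distrib_left sum_distrib_right by (simp only: mult_ac)
      qed
      also have "\<dots> \<le> b / 2 * real n powr (d - 1 / 2)" using elim(1) by (intro mult_right_mono) auto
      also have "(\<Sum>j\<in>S - {..<J}. \<bar>c j\<bar> * frac_coeff d (i - j)) \<le> b / 2 * real n powr (d - 1 / 2)"
      proof (rule power2_le_imp_le)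
        have "(\<Sum>j\<in>S - {..<J}. \<bar>c j\<bar> * frac_coeff d (i - j))\<^sup>2 \<le> (\<Sum>j\<in>S - {..<J}. \<bar>c j\<bar>\<^sup>2) * (\<Sum>j\<in>S - {..<J}. (frac_coeff d (i - j))\<^sup>2)"
          by (rule Cauchy_Schwarz_ineq_sum)
        also have "\<dots> \<le> \<eta> * (real n * (C * real n powr (d - 1))\<^sup>2)"
        proof (intro mult_mono)
          have "(\<Sum>j\<in>S - {..<J}. \<bar>c j\<bar>\<^sup>2) \<le> (\<Sum>j=J..N. (c j)\<^sup>2)"
            by (simp, rule sum_mono2) (auto simp: S_def)
          also have "\<dots> \<le> \<eta>" using J[of J N] by simp
          finally show "(\<Sum>j\<in>S - {..<J}. \<bar>c j\<bar>\<^sup>2) \<le> \<eta>" .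
          have "(\<Sum>j\<in>S - {..<J}. (frac_coeff d (i - j))\<^sup>2) \<le> (\<Sum>j\<in>S - {..<J}. (C * real n powr (d - 1))\<^sup>2)"
            using \<pi> by (intro sum_mono power_mono) (auto simp: S_def)
          also have "\<dots> = real (card (S - {..<J})) * (C * real n powr (d - 1))\<^sup>2" by simp
          also have "\<dots> \<le> real n * (C * real n powr (d - 1))\<^sup>2"
            using order_trans[OF card_mono[OF fin, of "S - {..<J}"] card] by (intro mult_right_mono) auto
          finally show "(\<Sum>j\<in>S - {..<J}. (frac_coeff d (i - j))\<^sup>2) \<le> real n * (C * real n powr (d - 1))\<^sup>2" .
        qed (use \<eta> in \<open>auto intro: sum_nonneg\<close>)
        also have "\<dots> = (C * sqrt \<eta>)\<^sup>2 * (real n powr 1 * (real n powr (d - 1) * real n powr (d - 1)))"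
          using \<eta>(1) elim(2) by (simp add: power_mult_distrib) (simp add: power2_eq_square mult_ac)
        also have "real n powr 1 * (real n powr (d - 1) * real n powr (d - 1)) = real n powr (d - 1 / 2) * real n powr (d - 1 / 2)"
          by (simp only: powr_add[symmetric]) simp
        also have "(C * sqrt \<eta>)\<^sup>2 * \<dots> = (b / 2 * real n powr (d - 1 / 2))\<^sup>2"
          unfolding \<eta>(2) by (simp add: power2_eq_square mult_ac)
        finally show "(\<Sum>j\<in>S - {..<J}. \<bar>c j\<bar> * frac_coeff d (i - j))\<^sup>2 \<le> (b / 2 * real n powr (d - 1 / 2))\<^sup>2" .
      qed (use b in simp)
      finally show "\<bar>innovation_weight d n N i\<bar> \<le> b * real n powr (d - 1 / 2)" by simp
    qed
  qed
qed

text \<open>The weights \<open>frac_coeff d (n - r)\<close> are positive and sum to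
  \<open>frac_coeff (d + 1) (n - 1)\<close>, which is of order \<open>real n powr d\<close>.
  Squaring and dividing by n gives the exponent 2 d - 1.\<close>

lemma expectation_frac_sum_square_lower:
  assumes d: "0 < d"
  obtains C where "0 < C" "\<forall>\<^sub>F n in sequentially. C * real n powr (2 * d - 1) \<le> (\<integral>\<omega>. (frac_sum d u n \<omega>)\<^sup>2 \<partial>M)"
proof -
  obtain a where a: "0 < a" and lower: "\<forall>\<^sub>F n in sequentially. \<forall>w :: nat \<Rightarrow> real. (\<forall>r. 0 \<le> w r) \<longrightarrow>
      a / real n * (\<Sum>r=1..n. w r)\<^sup>2 \<le> (\<integral>\<omega>. (\<Sum>r=1..n. w r * u (int r) \<omega>)\<^sup>2 \<partial>M)"
    using expectation_square_lower by blast
  obtain b where b: "0 < b" "\<And>k. b * real (k + 1) powr d \<le> frac_coeff (d + 1) k"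
    using frac_coeff_bounds[of "d + 1"] d by (metis add_diff_cancel_right' add_pos_pos zero_less_one)
  have "\<forall>\<^sub>F n in sequentially. a * b\<^sup>2 * real n powr (2 * d - 1) \<le> (\<integral>\<omega>. (frac_sum d u n \<omega>)\<^sup>2 \<partial>M)"
    using lower eventually_gt_at_top[of 0]
  proof eventually_elim
    case (elim n)
    have S: "(\<Sum>r=1..n. frac_coeff d (n - r)) = frac_coeff (d + 1) (n - 1)"
    proof -
      have "(\<Sum>r=1..n. frac_coeff d (n - r)) = (\<Sum>k<n. frac_coeff d k)"
        by (rule sum.reindex_bij_witness[of _ "\<lambda>k. n - k" "\<lambda>r. n - r"]) auto
      also have "\<dots> = frac_coeff (d + 1) (n - 1)" using sum_frac_coeff[of "d + 1" "n - 1"] elim(2) by simp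
      finally show ?thesis .
    qed
    have frac: "frac_sum d u n \<omega> = (\<Sum>r=1..n. frac_coeff d (n - r) * u (int r) \<omega>)" for \<omega>
      unfolding frac_sum_def by (rule sum.reindex_bij_witness[of _ "\<lambda>r. n - r" "\<lambda>k. n - k"]) (auto simp: of_nat_diff)
    have "b * real n powr d \<le> frac_coeff (d + 1) (n - 1)" using b(2)[of "n - 1"] elim(2) by simp
    then have "(b * real n powr d)\<^sup>2 \<le> (frac_coeff (d + 1) (n - 1))\<^sup>2" using b by (intro power_mono) auto
    moreover have "a * b\<^sup>2 * real n powr (2 * d - 1) = a / real n * (b * real n powr d)\<^sup>2"
    proof -
      have "real n powr (2 * d - 1) = real n powr d * real n powr d / real n powr 1"
        by (simp only: powr_add[symmetric] powr_diff[symmetric]) simp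
      then show ?thesis using elim(2) by (simp add: power2_eq_square)
    qed
    ultimately have "a * b\<^sup>2 * real n powr (2 * d - 1) \<le> a / real n * (frac_coeff (d + 1) (n - 1))\<^sup>2"
      using a by (simp add: divide_right_mono)
    also have "\<dots> \<le> (\<integral>\<omega>. (frac_sum d u n \<omega>)\<^sup>2 \<partial>M)"
      unfolding S[symmetric] frac using elim(1) frac_coeff_pos[OF d] by (simp add: less_imp_le)
    finally show ?case .
  qed
  then show ?thesis using that[of "a * b\<^sup>2"] a b by simp
qed

text \<open>Truncating the linear process leaves finitely many innovations, and the central limit theorem
  applies to their normalised sum; the truncation error is negligible in mean square.\<close>

lemma frac_sum_anticoncentration:
  assumes d: "1 < d" and e: "0 < e"
  obtains \<eta> where "0 < \<eta>" "\<forall>\<^sub>F n in sequentially. \<forall>b. prob {\<omega> \<in> space M. \<bar>frac_sum d u n \<omega> + b\<bar> \<le> \<eta> * real n powr (d - 1 / 2)} < e"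
proof -
  \<comment> \<open>A truncation depth is picked for each n separately, with mean-square error below
    1. This is negligible because the second moment of \<open>frac_sum d u n\<close> grows at least
    like a positive power of n.\<close>
  have "\<exists>N. (\<integral>\<omega>. (frac_sum d u n \<omega> - truncated_frac_sum d n N \<omega>)\<^sup>2 \<partial>M) < 1" for n
  proof -
    have "\<forall>\<^sub>F N in sequentially. (\<integral>\<omega>. (frac_sum d u n \<omega> - truncated_frac_sum d n N \<omega>)\<^sup>2 \<partial>M) < 1"
      by (rule order_tendstoD(2)[OF truncated_frac_sum_tendsto]) simp
    then show ?thesis by (auto simp: eventually_sequentially)
  qed
  then obtain N where N: "\<And>n. (\<integral>\<omega>. (frac_sum d u n \<omega> - truncated_frac_sum d n (N n) \<omega>)\<^sup>2 \<partial>M) < 1" by metis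
  define R where "R n = truncated_frac_sum d n (N n)" for n
  have R_L2: "in_L2 M (R n)" for n unfolding R_def by (rule in_L2_truncated)
  have Y_L2: "in_L2 M (frac_sum d u n)" for n by (rule in_L2_frac_sum)
  have D_L2: "in_L2 M (\<lambda>\<omega>. frac_sum d u n \<omega> - R n \<omega>)" for n by (rule in_L2_diff[OF Y_L2 R_L2])
  have [measurable]: "R n \<in> borel_measurable M" for n using R_L2 by (simp add: in_L2_def)
  define k where "k n = n + N n" for n
  define w where "w n i = innovation_weight d n (N n) i" for n i
  define \<sigma> where "\<sigma> n = sqrt (\<Sum>i<k n. (w n i)\<^sup>2)" for n
  have \<sigma>_sq: "(\<sigma> n)\<^sup>2 = (\<integral>\<omega>. (R n \<omega>)\<^sup>2 \<partial>M)" for n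
    by (simp add: \<sigma>_def R_def w_def k_def expectation_truncated_square sum_nonneg)
  \<comment> \<open>The innovations are renumbered from the oldest, at time \<open>s n\<close>, to
    the newest, the order in which the central limit theorem above expects them.\<close>
  define v where "v n j = w n (k n - Suc j) / \<sigma> n" for n j
  define s where "s n = int n - int (k n) + 1" for n
  define S where "S n \<omega> = (\<Sum>j<k n. v n j * \<epsilon> (s n + int j) \<omega>)" for n \<omega>
  have S_meas [measurable]: "S n \<in> borel_measurable M" for n unfolding S_def by measurable
  have S_eq: "S n \<omega> = R n \<omega> / \<sigma> n" for n \<omega>
  proof -
    have "R n \<omega> = (\<Sum>i<k n. w n i * \<epsilon> (int n - int i) \<omega>)"
      by (simp add: R_def w_def k_def truncated_frac_sum_eq)
    also have "\<dots> = (\<Sum>j<k n. w n (k n - Suc j) * \<epsilon> (s n + int j) \<omega>)"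
      by (rule sum.reindex_bij_witness[of _ "\<lambda>j. k n - Suc j" "\<lambda>i. k n - Suc i"]) (auto simp: s_def of_nat_diff algebra_simps)
    finally show ?thesis by (simp add: S_def v_def sum_divide_distrib)
  qed
  obtain C where C: "0 < C" and lower: "\<forall>\<^sub>F n in sequentially. C * real n powr (2 * d - 1) \<le> (\<integral>\<omega>. (frac_sum d u n \<omega>)\<^sup>2 \<partial>M)"
    using expectation_frac_sum_square_lower[of d] d by auto
  \<comment> \<open>From Y^2 \<le> 2 R^2 + 2 (Y - R)^2 the second moment of the truncated sum
    satisfies \<open>2 * (\<sigma> n)\<^sup>2 \<ge> C * real n powr (2 * d - 1) - 2\<close>; the
    threshold 4 makes the right side at least half of its leading term.\<close>
  have "0 < C" "0 < 2 * d - 1" using C d by auto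
  then have "\<forall>\<^sub>F n in sequentially. 4 < C * real n powr (2 * d - 1)" by real_asymp
  with lower eventually_gt_at_top[of 0]
  have \<sigma>_lower: "\<forall>\<^sub>F n in sequentially. 0 < n \<and> sqrt (C / 4) * real n powr (d - 1 / 2) \<le> \<sigma> n"
  proof eventually_elim
    case (elim n)
    have "(\<integral>\<omega>. (frac_sum d u n \<omega>)\<^sup>2 \<partial>M) \<le> (\<integral>\<omega>. 2 * (R n \<omega>)\<^sup>2 + 2 * (frac_sum d u n \<omega> - R n \<omega>)\<^sup>2 \<partial>M)"
    proof (rule integral_mono)
      show "(frac_sum d u n \<omega>)\<^sup>2 \<le> 2 * (R n \<omega>)\<^sup>2 + 2 * (frac_sum d u n \<omega> - R n \<omega>)\<^sup>2" for \<omega>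
        using sum_squares_bound[of "R n \<omega>" "frac_sum d u n \<omega> - R n \<omega>"] power2_sum[of "R n \<omega>" "frac_sum d u n \<omega> - R n \<omega>"] by simp
    qed (use Y_L2 R_L2 D_L2 in \<open>auto simp: in_L2_def\<close>)
    also have "\<dots> = 2 * (\<sigma> n)\<^sup>2 + 2 * (\<integral>\<omega>. (frac_sum d u n \<omega> - R n \<omega>)\<^sup>2 \<partial>M)"
      using R_L2 D_L2 by (simp add: in_L2_def \<sigma>_sq)
    also have "\<dots> \<le> 2 * (\<sigma> n)\<^sup>2 + 2" using N[of n] by (simp add: R_def)
    finally have "C / 4 * real n powr (2 * d - 1) \<le> (\<sigma> n)\<^sup>2" using elim by linarith
    moreover have "(sqrt (C / 4) * real n powr (d - 1 / 2))\<^sup>2 = C / 4 * real n powr (2 * d - 1)"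
    proof -
      have "real n powr (d - 1 / 2) * real n powr (d - 1 / 2) = real n powr (2 * d - 1)"
        by (simp only: powr_add[symmetric]) simp
      moreover have "(sqrt (C / 4))\<^sup>2 = C / 4" using C by simp
      ultimately show ?thesis by (simp only: power_mult_distrib) (simp add: power2_eq_square)
    qed
    ultimately have "(sqrt (C / 4) * real n powr (d - 1 / 2))\<^sup>2 \<le> (\<sigma> n)\<^sup>2" by simp
    then have "sqrt (C / 4) * real n powr (d - 1 / 2) \<le> \<sigma> n"
      by (rule power2_le_imp_le) (simp add: \<sigma>_def sum_nonneg)
    then show ?case using elim by simp
  qed
  have gauss: "(\<lambda>n. CLINT \<omega>|M. iexp (t * S n \<omega>)) \<longlonglongrightarrow> complex_of_real (exp (- (t\<^sup>2 / 2)))" for t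
    unfolding S_def
  proof (rule char_weighted_innovations_tendsto_gaussian)
    show "\<forall>\<^sub>F n in sequentially. (\<Sum>j<k n. (v n j)\<^sup>2) = 1"
      using \<sigma>_lower
    proof eventually_elim
      case (elim n)
      have "0 < sqrt (C / 4) * real n powr (d - 1 / 2)" using elim C by simp
      then have pos: "0 < \<sigma> n" using elim by linarith
      have "(\<Sum>j<k n. (w n (k n - Suc j))\<^sup>2) = (\<Sum>i<k n. (w n i)\<^sup>2)"
        by (rule sum.nat_diff_reindex)
      also have "\<dots> = (\<sigma> n)\<^sup>2" by (simp add: \<sigma>_def sum_nonneg)
      finally show ?case using pos by (simp add: v_def power_divide sum_divide_distrib[symmetric])
    qed
    fix b :: real assume b: "0 < b"
    have "0 < b * sqrt (C / 4)" using b C by simp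
    from innovation_weight_small[OF d this] \<sigma>_lower
    show "\<forall>\<^sub>F n in sequentially. \<forall>j<k n. \<bar>v n j\<bar> \<le> b"
    proof eventually_elim
      case (elim n)
      have "0 < sqrt (C / 4) * real n powr (d - 1 / 2)" using elim C by simp
      then have pos: "0 < \<sigma> n" using elim by linarith
      show ?case
      proof (intro allI impI)
        fix j
        have "\<bar>w n (k n - Suc j)\<bar> \<le> b * (sqrt (C / 4) * real n powr (d - 1 / 2))"
          using elim(1) by (simp add: w_def mult.assoc)
        also have "\<dots> \<le> b * \<sigma> n" using elim(2) b by (intro mult_left_mono) auto
        finally show "\<bar>v n j\<bar> \<le> b" using pos by (simp add: v_def field_simps)
      qed
    qed
  qed
  have "0 < e / 2" using e by simp
  then obtain \<eta>' where \<eta>': "0 < \<eta>'" and anti: "\<forall>\<^sub>F n in sequentially. \<forall>b. prob {\<omega> \<in> space M. \<bar>S n \<omega> + b\<bar> \<le> \<eta>'} < e / 2"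
    by (rule anticoncentration_of_char_tendsto_gaussian[OF S_meas gauss])
  \<comment> \<open>Half of the radius is reserved for the truncation error: if the truncated sum
    plus b exceeds 2 \<eta> r in modulus while \<open>frac_sum\<close> plus b stays within \<eta> r,
    the two sums differ by at least \<eta> r.\<close>
  define \<eta> where "\<eta> = \<eta>' * sqrt (C / 4) / 2"
  have \<eta>: "0 < \<eta>" using \<eta>' C by (simp add: \<eta>_def)
  have "0 < 2 * d - 1" "0 < 1 / \<eta>\<^sup>2" using d \<eta> by auto
  then have "(\<lambda>n. 1 / \<eta>\<^sup>2 * real n powr (- (2 * d - 1))) \<longlonglongrightarrow> 0" by real_asymp
  then have small: "\<forall>\<^sub>F n in sequentially. 1 / \<eta>\<^sup>2 * real n powr (- (2 * d - 1)) < e / 2"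
    using e by (intro order_tendstoD(2)) auto
  show ?thesis
  proof (rule that[OF \<eta>])
    show "\<forall>\<^sub>F n in sequentially. \<forall>b. prob {\<omega> \<in> space M. \<bar>frac_sum d u n \<omega> + b\<bar> \<le> \<eta> * real n powr (d - 1 / 2)} < e"
      using anti small \<sigma>_lower
    proof eventually_elim
      case (elim n)
      define r where "r = real n powr (d - 1 / 2)"
      have r: "0 < r" using elim by (simp add: r_def)
      have "0 < sqrt (C / 4) * r" using r C by simp
      then have pos: "0 < \<sigma> n" using elim by (simp add: r_def)
      show ?case
      proof
        fix b
        let ?A = "{\<omega> \<in> space M. \<eta> * r \<le> \<bar>frac_sum d u n \<omega> - R n \<omega>\<bar>}"
        let ?B = "{\<omega> \<in> space M. \<bar>S n \<omega> + b / \<sigma> n\<bar> \<le> \<eta>'}"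
        have "{\<omega> \<in> space M. \<bar>frac_sum d u n \<omega> + b\<bar> \<le> \<eta> * r} \<subseteq> ?A \<union> ?B"
        proof clarsimp
          fix \<omega> assume \<omega>: "\<bar>frac_sum d u n \<omega> + b\<bar> \<le> \<eta> * r" "\<not> \<bar>S n \<omega> + b / \<sigma> n\<bar> \<le> \<eta>'"
          have "\<eta>' * \<sigma> n < \<bar>S n \<omega> + b / \<sigma> n\<bar> * \<sigma> n" using \<omega>(2) pos by (intro mult_strict_right_mono) auto
          also have "\<dots> = \<bar>(S n \<omega> + b / \<sigma> n) * \<sigma> n\<bar>" using pos by (simp add: abs_mult)
          also have "(S n \<omega> + b / \<sigma> n) * \<sigma> n = R n \<omega> + b" using pos by (simp add: S_eq distrib_right)
          finally have "\<eta>' * \<sigma> n < \<bar>R n \<omega> + b\<bar>" .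
          moreover have "2 * (\<eta> * r) \<le> \<eta>' * \<sigma> n"
          proof -
            have "2 * (\<eta> * r) = \<eta>' * (sqrt (C / 4) * r)" by (simp add: \<eta>_def)
            also have "\<dots> \<le> \<eta>' * \<sigma> n" using elim \<eta>' by (intro mult_left_mono) (auto simp: r_def)
            finally show ?thesis .
          qed
          ultimately show "\<eta> * r \<le> \<bar>frac_sum d u n \<omega> - R n \<omega>\<bar>" using \<omega>(1) by linarith
        qed
        then have "prob {\<omega> \<in> space M. \<bar>frac_sum d u n \<omega> + b\<bar> \<le> \<eta> * r} \<le> prob (?A \<union> ?B)"
          by (intro finite_measure_mono) measurable
        also have "\<dots> \<le> prob ?A + prob ?B" by (intro measure_Un_le) measurable
        also have "prob ?A \<le> (\<integral>\<omega>. (frac_sum d u n \<omega> - R n \<omega>)\<^sup>2 \<partial>M) / (\<eta> * r)\<^sup>2"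
          using \<eta> r by (intro prob_abs_ge_le_square D_L2) auto
        also have "\<dots> \<le> 1 / (\<eta> * r)\<^sup>2"
          using N[of n] by (intro divide_right_mono) (auto simp: R_def)
        also have "\<dots> = 1 / \<eta>\<^sup>2 * real n powr (- (2 * d - 1))"
        proof -
          have "r * r = real n powr (2 * d - 1)" unfolding r_def by (simp only: powr_add[symmetric]) simp
          then have "(\<eta> * r)\<^sup>2 = \<eta>\<^sup>2 * real n powr (2 * d - 1)" by (simp add: power_mult_distrib power2_eq_square)
          then show ?thesis by (simp only: powr_minus inverse_eq_divide times_divide_times_eq mult_1_right)
        qed
        also have "\<dots> < e / 2" by (rule elim(2))
        also have "prob ?B < e / 2" using elim(1) by blast
        finally show "prob {\<omega> \<in> space M. \<bar>frac_sum d u n \<omega> + b\<bar> \<le> \<eta> * real n powr (d - 1 / 2)} < e"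
          by (simp add: r_def)
      qed
    qed
  qed
qed

text \<open>If \<alpha> > d - 1 / 2, the second moment of the noise has exponent
  \<open>max 1 (2 * d - 1)\<close> below 2 \<alpha>, so the noise cancels at most half of the trend
  except with vanishing probability. In the other case, which includes the borderline of equal
  orders, a cancellation to leading order has to be excluded; the trend is treated as a
  deterministic shift, over which the anticoncentration estimate is uniform.\<close>

lemma frac_sum_plus_trend_lower:
  assumes d: "1 / 2 < d" and \<alpha>: "1 / 2 < \<alpha>" and \<mu>: "\<mu> \<noteq> 0" and e: "0 < e"
  obtains \<eta> where "0 < \<eta>" "\<forall>\<^sub>F n in sequentially.
    prob {\<omega> \<in> space M. \<bar>frac_sum d u n \<omega> + \<mu> * real n powr \<alpha>\<bar> \<le> \<eta> * real n powr (max \<alpha> (d - 1 / 2))} < e"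
proof (cases "d - 1 / 2 < \<alpha>")
  case True
  then have m: "max \<alpha> (d - 1 / 2) = \<alpha>" by simp
  obtain C where C: "0 < C" "\<And>n. 1 \<le> n \<Longrightarrow> (\<integral>\<omega>. (frac_sum d u n \<omega>)\<^sup>2 \<partial>M) \<le> C * real n powr max 1 (2 * d - 1)"
    using expectation_frac_sum_square_upper[of d] d by (metis less_trans zero_less_divide_1_iff zero_less_numeral)
  define \<eta> where "\<eta> = \<bar>\<mu>\<bar> / 2"
  have \<eta>: "0 < \<eta>" using \<mu> by (simp add: \<eta>_def)
  define g where "g = 2 * \<alpha> - max 1 (2 * d - 1)"
  have g: "0 < g" using True \<alpha> by (auto simp: g_def)
  have "(\<lambda>n. C / \<eta>\<^sup>2 * real n powr (- g)) \<longlonglongrightarrow> C / \<eta>\<^sup>2 * 0"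
    using g by (intro tendsto_intros) real_asymp
  then have "\<forall>\<^sub>F n in sequentially. C / \<eta>\<^sup>2 * real n powr (- g) < e"
    using e by (intro order_tendstoD(2)) auto
  then have "\<forall>\<^sub>F n in sequentially. prob {\<omega> \<in> space M. \<bar>frac_sum d u n \<omega> + \<mu> * real n powr \<alpha>\<bar> \<le> \<eta> * real n powr \<alpha>} < e"
    using eventually_ge_at_top[of 1]
  proof eventually_elim
    case (elim n)
    have pos: "0 < real n powr \<alpha>" using elim by simp
    have "prob {\<omega> \<in> space M. \<bar>frac_sum d u n \<omega> + \<mu> * real n powr \<alpha>\<bar> \<le> \<eta> * real n powr \<alpha>} \<le>
        prob {\<omega> \<in> space M. \<eta> * real n powr \<alpha> \<le> \<bar>frac_sum d u n \<omega>\<bar>}"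
    proof (rule finite_measure_mono)
      show "{\<omega> \<in> space M. \<bar>frac_sum d u n \<omega> + \<mu> * real n powr \<alpha>\<bar> \<le> \<eta> * real n powr \<alpha>} \<subseteq>
          {\<omega> \<in> space M. \<eta> * real n powr \<alpha> \<le> \<bar>frac_sum d u n \<omega>\<bar>}"
      proof clarsimp
        fix \<omega> assume "\<bar>frac_sum d u n \<omega> + \<mu> * real n powr \<alpha>\<bar> \<le> \<eta> * real n powr \<alpha>"
        moreover have "\<bar>\<mu> * real n powr \<alpha>\<bar> = 2 * (\<eta> * real n powr \<alpha>)" by (simp add: \<eta>_def abs_mult)
        ultimately show "\<eta> * real n powr \<alpha> \<le> \<bar>frac_sum d u n \<omega>\<bar>" by linarith
      qed
    qed measurable
    also have "\<dots> \<le> (\<integral>\<omega>. (frac_sum d u n \<omega>)\<^sup>2 \<partial>M) / (\<eta> * real n powr \<alpha>)\<^sup>2"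
      using \<eta> pos by (intro prob_abs_ge_le_square in_L2_frac_sum) auto
    also have "\<dots> \<le> C * real n powr max 1 (2 * d - 1) / (\<eta> * real n powr \<alpha>)\<^sup>2"
      using C(2)[OF elim(2)] by (intro divide_right_mono) auto
    also have "\<dots> = C / \<eta>\<^sup>2 * real n powr (- g)"
    proof -
      have "real n powr (- g) = real n powr max 1 (2 * d - 1) / (real n powr \<alpha> * real n powr \<alpha>)"
        by (simp only: powr_add[symmetric] powr_diff[symmetric]) (simp add: g_def)
      then show ?thesis by (simp add: power2_eq_square)
    qed
    also have "\<dots> < e" by (rule elim(1))
    finally show ?case .
  qed
  then show ?thesis using that[OF \<eta>] by (simp only: m)
next
  case False
  then have m: "max \<alpha> (d - 1 / 2) = d - 1 / 2" and "1 < d" using \<alpha> by auto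
  obtain \<eta> where "0 < \<eta>" and *: "\<forall>\<^sub>F n in sequentially. \<forall>b. prob {\<omega> \<in> space M. \<bar>frac_sum d u n \<omega> + b\<bar> \<le> \<eta> * real n powr (d - 1 / 2)} < e"
    by (rule frac_sum_anticoncentration[OF \<open>1 < d\<close> e])
  have "\<forall>\<^sub>F n in sequentially. prob {\<omega> \<in> space M. \<bar>frac_sum d u n \<omega> + \<mu> * real n powr \<alpha>\<bar> \<le> \<eta> * real n powr (d - 1 / 2)} < e"
    using * by eventually_elim blast
  then show ?thesis by (rule that[OF \<open>0 < \<eta>\<close>, unfolded m])
qed

end

section \<open>Consistency\<close>

lemma summation_by_parts_cis:
  fixes x :: "nat \<Rightarrow> real"
  shows "(1 - cis \<theta>) * (\<Sum>t=1..n. complex_of_real (x t) * cis (real t * \<theta>)) =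
    (\<Sum>t=1..n. complex_of_real (x t - x (t - 1)) * cis (real t * \<theta>)) - cis \<theta> * (x n * cis (real n * \<theta>) - x 0)"
proof (induction n)
  case (Suc n)
  have "cis (real (Suc n) * \<theta>) = cis \<theta> * cis (real n * \<theta>)" by (simp add: cis_mult distrib_right)
  then show ?case using Suc by (simp add: algebra_simps del: of_nat_Suc)
qed simp

lemma periodogram_eq_increments:
  assumes n: "0 < n"
  shows "(cmod (1 - cis (fourier_freq n j)))\<^sup>2 * periodogram n x j =
    (cmod ((\<Sum>t=1..n. complex_of_real (x t - x (t - 1)) * cis (real t * fourier_freq n j)) -
      cis (fourier_freq n j) * complex_of_real (x n - x 0)))\<^sup>2 / (2 * pi * real n)"
proof -
  let ?l = "fourier_freq n j"
  \<comment> \<open>At a Fourier frequency the boundary phase is 1, and the boundary term becomes a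
    multiple of the end-point difference; an additive constant such as the initial value drops
    out.\<close>
  have "cis (real n * ?l) = 1"
    using n cis_multiple_2pi[of "real j"] by (simp add: fourier_freq_def)
  then have "(1 - cis ?l) * (\<Sum>t=1..n. complex_of_real (x t) * cis (real t * ?l)) =
      (\<Sum>t=1..n. complex_of_real (x t - x (t - 1)) * cis (real t * ?l)) - cis ?l * complex_of_real (x n - x 0)"
    unfolding summation_by_parts_cis by simp
  then have "cmod (1 - cis ?l) * cmod (\<Sum>t=1..n. complex_of_real (x t) * cis (real t * ?l)) =
      cmod ((\<Sum>t=1..n. complex_of_real (x t - x (t - 1)) * cis (real t * ?l)) - cis ?l * complex_of_real (x n - x 0))"
    by (simp only: norm_mult[symmetric])
  moreover have "(cmod (1 - cis ?l))\<^sup>2 * periodogram n x j =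
      (cmod (1 - cis ?l) * cmod (\<Sum>t=1..n. complex_of_real (x t) * cis (real t * ?l)))\<^sup>2 / (2 * pi * real n)"
    by (simp add: periodogram_def dft_def norm_mult norm_divide power_mult_distrib power_divide)
  ultimately show ?thesis by simp
qed

text \<open>When the end-point difference V dominates, the squared modulus of \<open>D\<close> minus
  a rotated V differs from V^2 by a relative error of at most y^2 + 2 y, where y bounds the ratio of
  \<open>D\<close> to V in modulus. Dividing by the number \<open>B\<close> instead of V makes
  moments of y accessible when V is random. Replacing 1 - cis by the frequency costs \<zeta>, and
  \<zeta> \<le> 1 keeps that ratio below 2.\<close>

lemma scaled_periodogram_deviation:
  fixes x :: "nat \<Rightarrow> real"
  defines "D \<equiv> \<lambda>n j. \<Sum>t=1..n. complex_of_real (x t - x (t - 1)) * cis (real t * fourier_freq n j)"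
  assumes n: "0 < n" and B: "0 < B" "B \<le> \<bar>x n - x 0\<bar>"
    and freq: "0 < cmod (1 - cis (fourier_freq n j))" "\<bar>(fourier_freq n j)\<^sup>2 / (cmod (1 - cis (fourier_freq n j)))\<^sup>2 - 1\<bar> \<le> \<zeta>" "\<zeta> \<le> 1"
  shows "\<bar>(fourier_freq n j)\<^sup>2 * periodogram n x j - (x n - x 0)\<^sup>2 / (2 * pi * real n)\<bar> \<le>
    (x n - x 0)\<^sup>2 / (2 * pi * real n) * (2 * ((cmod (D n j) / B)\<^sup>2 + 2 * (cmod (D n j) / B)) + \<zeta>)"
proof -
  let ?l = "fourier_freq n j"
  define V where "V = \<bar>x n - x 0\<bar>"
  define h where "h = ?l\<^sup>2 / (cmod (1 - cis ?l))\<^sup>2"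
  define y where "y = cmod (D n j) / B"
  define P where "P = (cmod (D n j - cis ?l * complex_of_real (x n - x 0)))\<^sup>2"
  have V: "0 < V" "B \<le> V" using B by (auto simp: V_def)
  have y: "0 \<le> y" "cmod (D n j) \<le> y * V"
  proof -
    show "0 \<le> y" using B by (simp add: y_def)
    have "cmod (D n j) = y * B" using B by (simp add: y_def)
    also have "\<dots> \<le> y * V" using \<open>0 \<le> y\<close> V by (intro mult_left_mono) auto
    finally show "cmod (D n j) \<le> y * V" .
  qed
  have h: "0 \<le> h" "h \<le> 2" "\<bar>h - 1\<bar> \<le> \<zeta>" using freq by (auto simp: h_def)
  have per: "?l\<^sup>2 * periodogram n x j = h * P / (2 * pi * real n)"
  proof -
    have *: "(cmod (1 - cis ?l))\<^sup>2 * periodogram n x j = P / (2 * pi * real n)"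
      using periodogram_eq_increments[OF n, of j x] by (simp add: P_def D_def)
    have "periodogram n x j = (cmod (1 - cis ?l))\<^sup>2 * periodogram n x j / (cmod (1 - cis ?l))\<^sup>2"
      using freq(1) by simp
    then have "periodogram n x j = P / (2 * pi * real n) / (cmod (1 - cis ?l))\<^sup>2"
      unfolding * .
    then show ?thesis by (simp add: h_def)
  qed
  have P: "\<bar>P - V\<^sup>2\<bar> \<le> V\<^sup>2 * (y\<^sup>2 + 2 * y)"
  proof -
    let ?a = "cmod (D n j - cis ?l * complex_of_real (x n - x 0))"
    have nV: "cmod (cis ?l * complex_of_real (x n - x 0)) = V" by (simp only: norm_mult norm_cis norm_of_real V_def mult_1_left)
    have "\<bar>?a - V\<bar> \<le> cmod (D n j)"
      using norm_triangle_ineq3[of "D n j - cis ?l * complex_of_real (x n - x 0)" "- (cis ?l * complex_of_real (x n - x 0))"] nV by simp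
    also have "\<dots> \<le> y * V" by (rule y)
    finally have aV: "\<bar>?a - V\<bar> \<le> y * V" .
    have "P - V\<^sup>2 = (?a - V) * (?a + V)" by (simp add: P_def power2_eq_square algebra_simps)
    then have "\<bar>P - V\<^sup>2\<bar> = \<bar>?a - V\<bar> * (?a + V)" using V by (simp add: abs_mult)
    also have "\<dots> \<le> (y * V) * (y * V + 2 * V)" using aV y V by (intro mult_mono) auto
    also have "\<dots> = V\<^sup>2 * (y\<^sup>2 + 2 * y)" by (simp add: power2_eq_square algebra_simps)
    finally show ?thesis .
  qed
  have "\<bar>h * P - V\<^sup>2\<bar> = \<bar>h * (P - V\<^sup>2) + (h - 1) * V\<^sup>2\<bar>" by (simp add: algebra_simps)
  also have "\<dots> \<le> \<bar>h * (P - V\<^sup>2)\<bar> + \<bar>(h - 1) * V\<^sup>2\<bar>" by (rule abs_triangle_ineq)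
  also have "\<dots> \<le> 2 * (V\<^sup>2 * (y\<^sup>2 + 2 * y)) + \<zeta> * V\<^sup>2"
    unfolding abs_mult using h P by (intro add_mono mult_mono) auto
  also have "\<dots> = V\<^sup>2 * (2 * (y\<^sup>2 + 2 * y) + \<zeta>)" by (simp add: algebra_simps)
  finally have main: "\<bar>h * P - V\<^sup>2\<bar> \<le> V\<^sup>2 * (2 * (y\<^sup>2 + 2 * y) + \<zeta>)" .
  have "\<bar>?l\<^sup>2 * periodogram n x j - V\<^sup>2 / (2 * pi * real n)\<bar> = \<bar>h * P - V\<^sup>2\<bar> / (2 * pi * real n)"
    unfolding per using n by (simp add: diff_divide_distrib[symmetric] abs_divide)
  also have "\<dots> \<le> V\<^sup>2 * (2 * (y\<^sup>2 + 2 * y) + \<zeta>) / (2 * pi * real n)"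
    using main by (intro divide_right_mono) auto
  finally show ?thesis by (simp add: V_def y_def)
qed

text \<open>Writing j as m times j / m extracts the factor \<open>real m powr (- k)\<close>; the
  remaining mean has exponent -r - k > -1 and therefore converges.\<close>

lemma weighted_mean_decay_tendsto_0:
  assumes k: "0 < k" and rk: "r + k < 1"
  shows "(\<lambda>m. 1 / real m * (\<Sum>j=1..m. (real j / real m) powr (- r) * real j powr (- k))) \<longlonglongrightarrow> 0"
proof -
  have "(\<lambda>m. real m powr (- k) * (1 / real m * (\<Sum>j=1..m. (real j / real m) powr (- r - k)))) \<longlonglongrightarrow> 0 * (1 / (1 + (- r - k)))"
    by (intro tendsto_mult mean_powr_tendsto) (use k rk in \<open>real_asymp | simp\<close>)+
  moreover have "real m powr (- k) * (1 / real m * (\<Sum>j=1..m. (real j / real m) powr (- r - k))) =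
      1 / real m * (\<Sum>j=1..m. (real j / real m) powr (- r) * real j powr (- k))" for m
  proof -
    have "real m powr (- k) * (real j / real m) powr (- r - k) = (real j / real m) powr (- r) * real j powr (- k)"
      if "j \<in> {1..m}" for j
    proof -
      have "(real j / real m) powr (- r - k) = (real j / real m) powr (- r) * (real j / real m) powr (- k)"
        by (simp add: powr_add[symmetric])
      moreover have "real m powr (- k) * (real j / real m) powr (- k) = real j powr (- k)"
        using that by (simp add: powr_mult[symmetric])
      ultimately show ?thesis by (simp add: mult_ac)
    qed
    then have "(\<Sum>j=1..m. real m powr (- k) * (real j / real m) powr (- r - k)) = (\<Sum>j=1..m. (real j / real m) powr (- r) * real j powr (- k))"
      by (intro sum.cong) auto
    then show ?thesis by (simp add: sum_distrib_left[symmetric] mult_ac)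
  qed
  ultimately show ?thesis by (simp only: mult_zero_left)
qed

text \<open>Both summands are nonnegative, so each of them tends to 0. The eventual positivity
  enters in the divergence of \<open>m\<close>, as the convention 1 / 0 = 0 would otherwise be
  compatible with m n = 0.\<close>

lemma assumption4_limits:
  assumes "assumption4 m"
  shows "filterlim m at_top sequentially" and "(\<lambda>n. real (m n) / real n) \<longlonglongrightarrow> 0"
proof -
  have pos: "\<forall>\<^sub>F n in sequentially. 0 < m n" and lim: "(\<lambda>n. 1 / real (m n) + real (m n) / real n) \<longlonglongrightarrow> 0"
    using assms by (auto simp: assumption4_def)
  show "(\<lambda>n. real (m n) / real n) \<longlonglongrightarrow> 0"
    by (rule tendsto_sandwich[OF _ _ tendsto_const lim]) auto
  have inv: "(\<lambda>n. 1 / real (m n)) \<longlonglongrightarrow> 0"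
    by (rule tendsto_sandwich[OF _ _ tendsto_const lim]) auto
  show "filterlim m at_top sequentially"
    unfolding filterlim_at_top
  proof
    fix K
    have "\<forall>\<^sub>F n in sequentially. 1 / real (m n) < 1 / (real K + 1)"
      by (rule order_tendstoD(2)[OF inv]) (simp add: add_nonneg_pos)
    with pos show "\<forall>\<^sub>F n in sequentially. K \<le> m n"
    proof eventually_elim
      case (elim n)
      then have "real K + 1 < real (m n)" by (simp add: field_simps)
      then show ?case by linarith
    qed
  qed
qed

lemma freq_ratio_near_1:
  assumes "0 < \<zeta>"
  obtains \<delta> where "0 < \<delta>" "\<And>x. 0 < x \<Longrightarrow> x \<le> \<delta> \<Longrightarrow> 0 < cmod (1 - cis x) \<and> \<bar>x\<^sup>2 / (cmod (1 - cis x))\<^sup>2 - 1\<bar> \<le> \<zeta>"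
proof -
  have lim: "((\<lambda>x::real. x\<^sup>2 / (2 - 2 * cos x)) \<longlongrightarrow> 1) (at_right 0)" by real_asymp
  obtain b where b: "0 < b" "\<And>x. 0 < x \<Longrightarrow> x < b \<Longrightarrow> \<bar>x\<^sup>2 / (2 - 2 * cos x) - 1\<bar> < \<zeta>"
    using tendstoD[OF lim assms] by (auto simp: eventually_at_right_field dist_real_def)
  show ?thesis
  proof (rule that[of "min 1 (b / 2)"])
    fix x :: real assume x: "0 < x" "x \<le> min 1 (b / 2)"
    have "(cmod (1 - cis x))\<^sup>2 = 2 - 2 * cos x"
      using sin_cos_squared_add[of x] by (simp add: cmod_power2 power2_diff)
    moreover have "0 < cmod (1 - cis x)" using norm_one_minus_cis_ge[of x] x by linarith
    ultimately show "0 < cmod (1 - cis x) \<and> \<bar>x\<^sup>2 / (cmod (1 - cis x))\<^sup>2 - 1\<bar> \<le> \<zeta>"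
      using b(2)[of x] x by simp
  qed (use b in simp)
qed

context linear_stationary_process
begin

text \<open>Two exceptional events are discarded, a small \<open>V n\<close> and a large
  \<open>T n\<close>, each of probability below p / 2. Off them the scaled ordinates are, on
  weighted average, within relative error \<tau> of the level
  \<open>v = (V n \<omega>)\<^sup>2 / (2 * pi * real n)\<close>. That v is random does no harm,
  since the flatness condition admits any positive level.\<close>

lemma local_whittle_converges_to_1:
  assumes d: "1 / 2 < d" and \<alpha>: "1 / 2 < \<alpha>" and \<mu>: "\<mu> \<noteq> 0" and m: "assumption4 m"
    and one: "1 \<in> {\<Delta>\<^sub>1..\<Delta>\<^sub>2}"
    and est: "local_whittle_estimator M \<Delta>\<^sub>1 \<Delta>\<^sub>2 m (fractional_trend_process d \<mu> \<alpha> X0 u) dhat"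
  shows "converges_in_prob M dhat 1"
  unfolding converges_in_prob_def
proof (intro allI impI)
  fix e :: real assume e: "0 < e"
  define \<beta> where "\<beta> = max \<alpha> (d - 1 / 2)"
  define V where "V t \<omega> = frac_sum d u t \<omega> + \<mu> * real t powr \<alpha>" for t \<omega>
  define D where "D n j \<omega> = (\<Sum>t=1..n. complex_of_real (V t \<omega> - V (t - 1) \<omega>) * cis (real t * fourier_freq n j))" for n j \<omega>
  have [measurable]: "V t \<in> borel_measurable M" for t unfolding V_def by measurable
  have [measurable]: "D n j \<in> borel_measurable M" for n j unfolding D_def by measurable
  have [measurable]: "dhat n \<in> borel_measurable M" for n using est by (simp add: local_whittle_estimator_def)
  have "\<alpha> \<le> \<beta>" "d - 1 / 2 \<le> \<beta>" by (auto simp: \<beta>_def)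
  from increments_dft_bound[OF d \<alpha> this, of \<mu>]
  obtain C \<kappa> \<delta> where C: "0 < C" "0 < \<kappa>" "\<kappa> \<le> 1" "0 < \<delta>" and D_bound: "\<forall>n s. 1 \<le> s \<longrightarrow> s \<le> n \<longrightarrow> fourier_freq n s \<le> \<delta> \<longrightarrow>
      integrable M (\<lambda>\<omega>. (cmod (D n s \<omega>))\<^sup>2) \<and> (\<integral>\<omega>. (cmod (D n s \<omega>))\<^sup>2 \<partial>M) \<le> C * (real n powr (2 * \<beta>) * real s powr (- \<kappa>))"
    unfolding D_def V_def by (elim exE conjE)
  \<comment> \<open>The bound 1 / 4 together with \<kappa> \<le> 1 ensures r + \<kappa> / 2 < 1, so
    that the weights with exponent - r are compatible with the decay in j; r \<le> e turns the bound
    r on twice the estimation error into the accuracy wanted.\<close>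
  define r where "r = min (1 / 4) e"
  have r: "0 < r" "r < 1" "r \<le> e" "r + \<kappa> / 2 < 1" using e C by (auto simp: r_def)
  obtain \<tau> where \<tau>: "0 < \<tau>" and flat: "\<forall>\<^sub>F m in sequentially. \<forall>n x v d \<Delta>\<^sub>1 \<Delta>\<^sub>2. 0 < n \<longrightarrow> 0 < v \<longrightarrow> 1 \<in> {\<Delta>\<^sub>1..\<Delta>\<^sub>2} \<longrightarrow>
       is_arg_min (whittle_R n m x) (\<lambda>d. d \<in> {\<Delta>\<^sub>1..\<Delta>\<^sub>2}) d \<longrightarrow>
       (\<forall>q\<in>{r, 0, - r}. 1 / real m * (\<Sum>j=1..m. (real j / real m) powr q *
          \<bar>(fourier_freq n j)\<^sup>2 * periodogram n x j - v\<bar>) \<le> \<tau> * v) \<longrightarrow> \<bar>2 * (d - 1)\<bar> < r"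
    by (rule whittle_minimiser_of_flat_ordinates[OF r(1,2)])
  \<comment> \<open>The tolerance \<tau> is split into thirds, for \<open>T n\<close>, for twice
    \<rho> and for \<zeta> times \<nu>. As \<nu> tends to 1 / (1 - r), it is eventually below 2 / (1
    - r), and the factor (1 - r) / 6 leaves \<tau> / 3.\<close>
  define \<zeta> where "\<zeta> = min 1 (\<tau> * (1 - r) / 6)"
  have \<zeta>: "0 < \<zeta>" "\<zeta> \<le> 1" using \<tau> r by (auto simp: \<zeta>_def)
  obtain \<delta>' where \<delta>': "0 < \<delta>'" "\<And>x. 0 < x \<Longrightarrow> x \<le> \<delta>' \<Longrightarrow> 0 < cmod (1 - cis x) \<and> \<bar>x\<^sup>2 / (cmod (1 - cis x))\<^sup>2 - 1\<bar> \<le> \<zeta>"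
    using freq_ratio_near_1[OF \<zeta>(1)] by blast
  define \<rho> where "\<rho> m = 1 / real m * (\<Sum>j=1..m. (real j / real m) powr (- r) * real j powr (- (\<kappa> / 2)))" for m :: nat
  define \<nu> where "\<nu> m = 1 / real m * (\<Sum>j=1..m. (real j / real m) powr (- r))" for m :: nat
  have \<rho>_lim: "(\<lambda>n. \<rho> (m n)) \<longlonglongrightarrow> 0"
    by (rule filterlim_compose[OF _ assumption4_limits(1)[OF m]])
      (unfold \<rho>_def, rule weighted_mean_decay_tendsto_0, use C r in auto)
  have \<nu>_lim: "(\<lambda>n. \<nu> (m n)) \<longlonglongrightarrow> 1 / (1 - r)"
    using filterlim_compose[OF mean_powr_tendsto[of "- r"] assumption4_limits(1)[OF m]] r by (simp add: \<nu>_def)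
  have freq_lim: "(\<lambda>n. 2 * pi * (real (m n) / real n)) \<longlonglongrightarrow> 2 * pi * 0"
    by (intro tendsto_intros assumption4_limits(2)[OF m])
  show "(\<lambda>n. prob {\<omega> \<in> space M. e < \<bar>dhat n \<omega> - 1\<bar>}) \<longlonglongrightarrow> 0"
  proof (rule order_tendstoI)
    fix a :: real assume "a < 0"
    then show "\<forall>\<^sub>F n in sequentially. a < prob {\<omega> \<in> space M. e < \<bar>dhat n \<omega> - 1\<bar>}"
      by (intro always_eventually allI) (rule less_le_trans[OF _ measure_nonneg])
  next
    fix p :: real assume p: "0 < p"
    then have "0 < p / 2" by simp
    then obtain \<eta> where \<eta>: "0 < \<eta>" and V_lower: "\<forall>\<^sub>F n in sequentially. prob {\<omega> \<in> space M. \<bar>V n \<omega>\<bar> \<le> \<eta> * real n powr \<beta>} < p / 2"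
      unfolding V_def \<beta>_def by (rule frac_sum_plus_trend_lower[OF d \<alpha> \<mu>])
    define y where "y n j \<omega> = cmod (D n j \<omega>) / (\<eta> * real n powr \<beta>)" for n j \<omega>
    \<comment> \<open>\<open>T n\<close> collects the quadratic part of the deviation, whose mean is
      accessible. The linear term 2 y is split by the arithmetic-geometric mean inequality into y^2
      with weight \<open>real j powr (\<kappa> / 2)\<close> and the deterministic
      \<open>real j powr (- (\<kappa> / 2))\<close>. As the second moment of y is of order at most
      \<open>real j powr (- \<kappa>)\<close>, the weighted square still decays with exponent
      \<kappa> / 2.\<close>
    define T where "T n \<omega> = 2 / real (m n) * (\<Sum>j=1..m n. (real j / real (m n)) powr (- r) * ((1 + real j powr (\<kappa> / 2)) * (y n j \<omega>)\<^sup>2))" for n \<omega>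
    have [measurable]: "y n j \<in> borel_measurable M" for n j unfolding y_def by measurable
    have [measurable]: "T n \<in> borel_measurable M" for n unfolding T_def by measurable
    have T_lim: "(\<lambda>n. (4 * C / \<eta>\<^sup>2 * \<rho> (m n)) / (\<tau> / 3)) \<longlonglongrightarrow> (4 * C / \<eta>\<^sup>2 * 0) / (\<tau> / 3)"
      using \<tau> by (intro tendsto_intros \<rho>_lim) auto
    have "\<forall>\<^sub>F n in sequentially. (4 * C / \<eta>\<^sup>2 * \<rho> (m n)) / (\<tau> / 3) < p / 2"
      using p by (intro order_tendstoD(2)[OF T_lim]) auto
    moreover have "\<forall>\<^sub>F n in sequentially. \<rho> (m n) < \<tau> / 6"
      using \<tau> by (intro order_tendstoD(2)[OF \<rho>_lim]) auto
    moreover have "\<forall>\<^sub>F n in sequentially. \<nu> (m n) < 2 / (1 - r)"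
      using r by (intro order_tendstoD(2)[OF \<nu>_lim] divide_strict_right_mono) auto
    moreover have "\<forall>\<^sub>F n in sequentially. 2 * pi * (real (m n) / real n) < min 1 (min \<delta> \<delta>')"
      using C \<delta>' by (intro order_tendstoD(2)[OF freq_lim]) auto
    moreover have "\<forall>\<^sub>F n in sequentially. 0 < m n" using m by (simp add: assumption4_def)
    moreover note V_lower eventually_gt_at_top[of "0::nat"] eventually_compose_filterlim[OF flat assumption4_limits(1)[OF m]]
    ultimately show "\<forall>\<^sub>F n in sequentially. prob {\<omega> \<in> space M. e < \<bar>dhat n \<omega> - 1\<bar>} < p"
    proof eventually_elim
      case (elim n)
      define B where "B = \<eta> * real n powr \<beta>"
      have B: "0 < B" using \<eta> elim(7) by (simp add: B_def)
      have mn: "m n \<le> n"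
      proof -
        have "1 * (real (m n) / real n) \<le> 2 * pi * (real (m n) / real n)" using pi_gt3 by (intro mult_right_mono) auto
        then have "real (m n) / real n < 1" using elim(4) by linarith
        then show ?thesis using elim(7) by simp
      qed
      have freq: "0 < fourier_freq n j" "fourier_freq n j \<le> \<delta>" "fourier_freq n j \<le> \<delta>'" if "j \<in> {1..m n}" for j
      proof -
        have "fourier_freq n j \<le> 2 * pi * (real (m n) / real n)"
          using that by (auto simp: fourier_freq_def intro!: divide_right_mono)
        then show "fourier_freq n j \<le> \<delta>" "fourier_freq n j \<le> \<delta>'" using elim(4) by auto
        show "0 < fourier_freq n j" using that elim(7) by (simp add: fourier_freq_def)
      qed
      have y_int: "integrable M (\<lambda>\<omega>. (y n j \<omega>)\<^sup>2)"
        and y_le: "(\<integral>\<omega>. (y n j \<omega>)\<^sup>2 \<partial>M) \<le> C / \<eta>\<^sup>2 * real j powr (- \<kappa>)" if j: "j \<in> {1..m n}" for j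
      proof -
        have jn: "1 \<le> j" "j \<le> n" using j mn by auto
        note DB = D_bound[rule_format, OF jn freq(2)[OF j]]
        show "integrable M (\<lambda>\<omega>. (y n j \<omega>)\<^sup>2)" using DB by (simp add: y_def power_divide)
        have "real n powr (2 * \<beta>) = real n powr \<beta> * real n powr \<beta>"
          by (simp only: powr_add[symmetric]) simp
        then have Bsq: "B\<^sup>2 = \<eta>\<^sup>2 * real n powr (2 * \<beta>)" by (simp add: B_def power_mult_distrib power2_eq_square)
        have "(\<integral>\<omega>. (y n j \<omega>)\<^sup>2 \<partial>M) = (\<integral>\<omega>. (cmod (D n j \<omega>))\<^sup>2 \<partial>M) / B\<^sup>2"
          by (simp add: y_def power_divide B_def)
        also have "\<dots> \<le> C * (real n powr (2 * \<beta>) * real j powr (- \<kappa>)) / B\<^sup>2"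
          using DB by (intro divide_right_mono) auto
        also have "\<dots> = C / \<eta>\<^sup>2 * real j powr (- \<kappa>)"
          using elim(7) by (simp add: Bsq)
        finally show "(\<integral>\<omega>. (y n j \<omega>)\<^sup>2 \<partial>M) \<le> C / \<eta>\<^sup>2 * real j powr (- \<kappa>)" .
      qed
      have T_int: "integrable M (T n)" unfolding T_def
        by (intro integrable_mult_right Bochner_Integration.integrable_sum y_int)
      have T_nonneg: "0 \<le> T n \<omega>" for \<omega> unfolding T_def by (intro mult_nonneg_nonneg sum_nonneg) auto
      have "(\<integral>\<omega>. T n \<omega> \<partial>M) = 2 / real (m n) * (\<Sum>j=1..m n. (real j / real (m n)) powr (- r) * ((1 + real j powr (\<kappa> / 2)) * (\<integral>\<omega>. (y n j \<omega>)\<^sup>2 \<partial>M)))"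
        unfolding T_def using y_int by (simp add: Bochner_Integration.integral_sum)
      also have "\<dots> \<le> 2 / real (m n) * (\<Sum>j=1..m n. (real j / real (m n)) powr (- r) * (2 * (C / \<eta>\<^sup>2) * real j powr (- (\<kappa> / 2))))"
      proof (intro mult_left_mono sum_mono)
        fix j assume j: "j \<in> {1..m n}"
        have ge1: "1 \<le> real j powr (\<kappa> / 2)" using j C by (intro ge_one_powr_ge_zero) auto
        have "(1 + real j powr (\<kappa> / 2)) * (\<integral>\<omega>. (y n j \<omega>)\<^sup>2 \<partial>M) \<le> (2 * real j powr (\<kappa> / 2)) * (C / \<eta>\<^sup>2 * real j powr (- \<kappa>))"
          using ge1 y_le[OF j] by (intro mult_mono) auto
        also have "\<dots> = 2 * (C / \<eta>\<^sup>2) * (real j powr (\<kappa> / 2) * real j powr (- \<kappa>))" by simp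
        also have "real j powr (\<kappa> / 2) * real j powr (- \<kappa>) = real j powr (- (\<kappa> / 2))"
          by (simp only: powr_add[symmetric]) simp
        finally show "(1 + real j powr (\<kappa> / 2)) * (\<integral>\<omega>. (y n j \<omega>)\<^sup>2 \<partial>M) \<le> 2 * (C / \<eta>\<^sup>2) * real j powr (- (\<kappa> / 2))" .
      qed auto
      also have "\<dots> = 4 * C / \<eta>\<^sup>2 * \<rho> (m n)"
        by (simp add: \<rho>_def sum_distrib_left sum_divide_distrib mult_ac)
      finally have ET: "(\<integral>\<omega>. T n \<omega> \<partial>M) \<le> 4 * C / \<eta>\<^sup>2 * \<rho> (m n)" .
      have "prob {\<omega> \<in> space M. \<tau> / 3 \<le> T n \<omega>} \<le> (\<integral>\<omega>. T n \<omega> \<partial>M) / (\<tau> / 3)"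
        by (rule integral_Markov_inequality_measure[where A = "{}"]) (use T_int T_nonneg \<tau> in auto)
      also have "\<dots> \<le> (4 * C / \<eta>\<^sup>2 * \<rho> (m n)) / (\<tau> / 3)"
        using ET \<tau> by (intro divide_right_mono) auto
      also have "\<dots> < p / 2" by (rule elim(1))
      finally have T_small: "prob {\<omega> \<in> space M. \<tau> / 3 \<le> T n \<omega>} < p / 2" .
      have close: "\<bar>dhat n \<omega> - 1\<bar> \<le> e" if \<omega>: "\<omega> \<in> space M" "B < \<bar>V n \<omega>\<bar>" "T n \<omega> < \<tau> / 3" for \<omega>
      proof -
        define x where "x t = fractional_trend_process d \<mu> \<alpha> X0 u t \<omega>" for t
        have x: "x t = V t \<omega> + X0 \<omega>" for t
          by (simp add: x_def V_def fractional_trend_process_def frac_sum_def frac_coeff_def)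
        have x_diff: "x t - x (t - 1) = V t \<omega> - V (t - 1) \<omega>" "x t - x 0 = V t \<omega>" for t
          by (simp_all add: x) (simp add: V_def)
        define v where "v = (V n \<omega>)\<^sup>2 / (2 * pi * real n)"
        have v: "0 < v" using \<omega>(2) B elim(7) by (simp add: v_def)
        have dev: "\<bar>(fourier_freq n j)\<^sup>2 * periodogram n x j - v\<bar> \<le>
            v * (2 * ((1 + real j powr (\<kappa> / 2)) * (y n j \<omega>)\<^sup>2) + (2 * real j powr (- (\<kappa> / 2)) + \<zeta>))" if j: "j \<in> {1..m n}" for j
        proof -
          have "\<bar>(fourier_freq n j)\<^sup>2 * periodogram n x j - v\<bar> \<le> v * (2 * ((y n j \<omega>)\<^sup>2 + 2 * y n j \<omega>) + \<zeta>)"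
          proof -
            have "B \<le> \<bar>x n - x 0\<bar>" using \<omega>(2) by (simp only: x_diff)
            moreover have "(\<Sum>t=1..n. complex_of_real (x t - x (t - 1)) * cis (real t * fourier_freq n j)) = D n j \<omega>"
              by (simp only: x_diff D_def)
            moreover note near = \<delta>'(2)[OF freq(1,3)[OF j]]
            ultimately show ?thesis
              using scaled_periodogram_deviation[OF elim(7) B _ conjunct1[OF near] conjunct2[OF near] \<zeta>(2), of x]
              by (simp only: v_def y_def B_def x_diff)
          qed
          also have "2 * y n j \<omega> \<le> real j powr (\<kappa> / 2) * (y n j \<omega>)\<^sup>2 + real j powr (- (\<kappa> / 2))"
          proof -
            let ?a = "real j powr (\<kappa> / 4)" and ?b = "real j powr (- (\<kappa> / 4))"
            have "?a * ?b = 1" "?a * ?a = real j powr (\<kappa> / 2)" "?b * ?b = real j powr (- (\<kappa> / 2))"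
              using j by (simp_all only: powr_add[symmetric]) simp_all
            then show ?thesis
              using sum_squares_bound[of "?a * y n j \<omega>" ?b] by (simp add: power2_eq_square mult_ac)
          qed
          finally show ?thesis using v by (simp add: algebra_simps)
        qed
        have "1 / real (m n) * (\<Sum>j=1..m n. (real j / real (m n)) powr q * \<bar>(fourier_freq n j)\<^sup>2 * periodogram n x j - v\<bar>) \<le> \<tau> * v"
          if q: "q \<in> {r, 0, - r}" for q
        proof -
          \<comment> \<open>since \<open>j \<le> m n\<close>, the weights with exponent \<open>- r\<close> dominate the other two\<close>
          have "1 / real (m n) * (\<Sum>j=1..m n. (real j / real (m n)) powr q * \<bar>(fourier_freq n j)\<^sup>2 * periodogram n x j - v\<bar>) \<le>
              1 / real (m n) * (\<Sum>j=1..m n. (real j / real (m n)) powr (- r) *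
                (v * (2 * ((1 + real j powr (\<kappa> / 2)) * (y n j \<omega>)\<^sup>2) + (2 * real j powr (- (\<kappa> / 2)) + \<zeta>))))"
          proof (intro mult_left_mono sum_mono mult_mono dev)
            fix j assume "j \<in> {1..m n}"
            then show "(real j / real (m n)) powr q \<le> (real j / real (m n)) powr (- r)"
              using q r by (intro powr_mono') (auto simp: divide_le_eq_1)
          qed auto
          also have "\<dots> = v * (T n \<omega> + (2 * \<rho> (m n) + \<zeta> * \<nu> (m n)))"
            by (simp add: T_def \<rho>_def \<nu>_def distrib_left sum.distrib sum_distrib_left mult_ac)
          also have "\<dots> \<le> v * \<tau>"
          proof (rule mult_left_mono)
            have "\<zeta> * \<nu> (m n) \<le> (\<tau> * (1 - r) / 6) * (2 / (1 - r))"
              using elim(3) \<tau> r by (intro mult_mono) (auto simp: \<zeta>_def \<nu>_def intro!: divide_nonneg_nonneg sum_nonneg)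
            also have "\<dots> = \<tau> / 3" using r by (simp add: field_simps)
            finally show "T n \<omega> + (2 * \<rho> (m n) + \<zeta> * \<nu> (m n)) \<le> \<tau>" using \<omega>(3) elim(2) by linarith
          qed (use v in simp)
          finally show ?thesis by (simp add: mult.commute)
        qed
        moreover have "is_arg_min (whittle_R n (m n) x) (\<lambda>d. d \<in> {\<Delta>\<^sub>1..\<Delta>\<^sub>2}) (dhat n \<omega>)"
        proof -
          have "x = (\<lambda>t. fractional_trend_process d \<mu> \<alpha> X0 u t \<omega>)" by (simp add: x_def fun_eq_iff)
          then show ?thesis using est \<omega>(1) unfolding local_whittle_estimator_def by blast
        qed
        ultimately have "\<bar>2 * (dhat n \<omega> - 1)\<bar> < r"
          using elim(8)[rule_format, OF elim(7) v one] by blast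
        then show ?thesis using r by simp
      qed
      have "{\<omega> \<in> space M. e < \<bar>dhat n \<omega> - 1\<bar>} \<subseteq> {\<omega> \<in> space M. \<bar>V n \<omega>\<bar> \<le> B} \<union> {\<omega> \<in> space M. \<tau> / 3 \<le> T n \<omega>}"
        using close by (force simp: not_le[symmetric])
      then have "prob {\<omega> \<in> space M. e < \<bar>dhat n \<omega> - 1\<bar>} \<le> prob ({\<omega> \<in> space M. \<bar>V n \<omega>\<bar> \<le> B} \<union> {\<omega> \<in> space M. \<tau> / 3 \<le> T n \<omega>})"
        by (intro finite_measure_mono) measurable
      also have "\<dots> \<le> prob {\<omega> \<in> space M. \<bar>V n \<omega>\<bar> \<le> B} + prob {\<omega> \<in> space M. \<tau> / 3 \<le> T n \<omega>}"
        by (intro measure_Un_le) measurable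
      also have "\<dots> < p" using elim(6) T_small by (simp add: B_def)
      finally show ?case .
    qed
  qed
qed

end

theorem theorem5p1:
  fixes M :: "'a measure"
    and u :: "int \<Rightarrow> 'a \<Rightarrow> real" and X0 :: "'a \<Rightarrow> real"
    and f\<^sub>u :: "real \<Rightarrow> real"
    and d\<^sub>0 \<mu> \<alpha> \<Delta>\<^sub>1 \<Delta>\<^sub>2 D :: real
    and m :: "nat \<Rightarrow> nat" and dhat :: "nat \<Rightarrow> 'a \<Rightarrow> real"
  assumes "prob_space M"
    and "X0 \<in> borel_measurable M"
    and "\<And>t \<omega>. t \<le> 0 \<Longrightarrow> \<omega> \<in> space M \<Longrightarrow> u t \<omega> = 0"
    and "zero_mean_stationary M u"
    and "has_spectral_density M u f\<^sub>u"
    and "\<mu> \<noteq> 0" and "\<alpha> > 1 / 2"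
    and "- 1 / 2 < \<Delta>\<^sub>1" and "\<Delta>\<^sub>1 < \<Delta>\<^sub>2"
    and "d\<^sub>0 \<in> {\<Delta>\<^sub>1..\<Delta>\<^sub>2}"
    and "1 \<in> {\<Delta>\<^sub>1..\<Delta>\<^sub>2}"
    and "\<And>n. n \<ge> 1 \<Longrightarrow> m n < n"
    and "assumption1 f\<^sub>u" and "assumption2 f\<^sub>u" and "assumption3 M u" and "assumption4 m"
    and "1 < D" and "d\<^sub>0 \<in> {1 / 2<..D}"
    and "local_whittle_estimator M \<Delta>\<^sub>1 \<Delta>\<^sub>2 m (fractional_trend_process d\<^sub>0 \<mu> \<alpha> X0 u) dhat"
  shows "converges_in_prob M dhat 1"
proof -
  obtain c \<epsilon> where "martingale_difference_innovations M \<epsilon>" "uniformly_dominated M \<epsilon>" "linear_process M c \<epsilon> u"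
    using \<open>assumption3 M u\<close> by (auto simp: assumption3_def)
  then interpret linear_stationary_process M u f\<^sub>u \<epsilon> c
    using assms by (intro linear_stationary_process.intro stationary_process.intro martingale_innovations.intro
      stationary_process_axioms.intro martingale_innovations_axioms.intro linear_stationary_process_axioms.intro)
  show ?thesis
    by (rule local_whittle_converges_to_1) (use assms in auto)
qed

end
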